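(* Let $f$ be a partial function on $\mathbb{N}^\mathbb{N}$ and $m\in\mathbb{N}$. (1) $f$ is $(1,1)$-computable iff Player II has a computable winning strategy in $G(f,\mathsf{P})$. (2) $f$ is $(1,m)$-computable iff Player II has a computable winning strategy in $G_m(f,\mathsf{PB})$. (3) $f$ is $(1,\omega|m)$-computable iff Player II has a computable winning strategy in $G_*(f,\mathsf{PM}_m)$. (4) $f$ is $(1,\omega)$-computable iff Player II has a computable winning strategy in $G(f,\mathsf{PB})$. (5) $f$ is $(m,1)$-computable iff Player II has a computable winnable strategy in $G(f,\mathsf{PM}_m)$. (6) $f$ is $(m,\omega)$-computable iff Player II has a computable winnable strategy in $G(f,\mathsf{PBM}_m)$. (7) $f$ is $(\omega,1)$-computable iff Player II has a computable winnable strategy in $G(f,\mathsf{PM}_\omega)$.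
   Context: $\{\Phi_e\}$ enumerates partial computable functions $\subseteq\mathbb{N}^\mathbb{N}\to\mathbb{N}^\mathbb{N}$; $\{\Psi_e\}$ is a fixed effective enumeration of total computable learners $\mathbb{N}^{<\mathbb{N}}\to\mathbb{N}$ dominating every partial computable $\Psi:\subseteq\mathbb{N}^{<\mathbb{N}}\to\mathbb{N}$ (whenever $\lim_s\Psi(g\upharpoonright s)$ converges, $\lim_s\Psi_e(g\upharpoonright s)$ converges to the same value). For $\alpha,\beta,\gamma\le\omega$, $f$ is $(\alpha,\beta|\gamma)$-computable if there is $I\subseteq\mathbb{N}$ of cardinality $\alpha$ such that for every $g\in\mathrm{dom}(f)$ some $e\in I$ has $\lim_n\Psi_e(g\upharpoonright n)$ convergent, $\Phi_{\lim_n\Psi_e(g\upharpoonright n)}(g)=f(g)$, $\#\{n:\Psi_e(g\upharpoonright n+1)\ne\Psi_e(g\upharpoonright n)\}<\beta$ and $\#\{\Psi_e(g\upharpoonright n):n\}\le\gamma$; $(\alpha,\beta)$ means $(\alpha,\beta|\omega)$. Games: let $X$ be a set of special symbols from $\{\mathtt{pass},\mathtt{back}\sharp\}\cup\{(\mathtt{move},i):i\in\mathbb{N}\}$; write $\mathsf{P}=\{\mathtt{pass}\}$, $\mathsf{B}=\{\mathtt{back}\sharp\}$, $\mathsf{M}_\alpha=\{(\mathtt{move},i):i<\alpha\}$ and concatenation of these letters for unions (e.g. $\mathsf{PBM}_m=\mathsf{P}\cup\mathsf{B}\cup\mathsf{M}_m$). In $G(f,X)$, at round $n$ Player I plays $x_n\in\mathbb{N}$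 and then Player II plays $y_n\in\mathbb{N}\cup X$; the play is $(x,y)$. Define $\mathtt{tape}(\langle\rangle)=0$, $\mathtt{tape}(y\upharpoonright n+1)=i$ if $y_n=(\mathtt{move},i)$ and $=\mathtt{tape}(y\upharpoonright n)$ otherwise; $\mathtt{content}_i(\langle\rangle)=\langle\rangle$ and $\mathtt{content}_i(y\upharpoonright n+1)$ equals $\mathtt{content}_i(y\upharpoonright n)^\frown\langle y_n\rangle$ if $y_n\in\mathbb{N}$ and $i=\mathtt{tape}(y\upharpoonright n)$, equals $\langle\rangle$ if $y_n=\mathtt{back}\sharp$ and $i=\mathtt{tape}(y\upharpoonright n)$, and equals $\mathtt{content}_i(y\upharpoonright n)$ otherwise; $\mathtt{content}_i(y)=\lim_n\mathtt{content}_i(y\upharpoonright n)$. Player I violates the basic rule if $x\notin\mathrm{dom}(f)$. Player II violates the basic rule if $y_n\in\{\mathtt{pass}\}\cup\{(\mathtt{move},i):i\}$ for almost all $n$, or $y_n=\mathtt{back}\sharp$ for infinitely many $n$; violates rule $m$ if $y$ contains at least $m$ occurrences of $\mathtt{back}\sharp$; violates rule $*$ if $y_n$ is a $\mathtt{move}$ symbol for infinitely many $n$. Player II wins (resp. is winnable) the play $(x,y)$ of $G(f,X)$ if Player I violates the basic rule, or Player II does not violate the basic rule and $f(x)=\mathtt{content}_i(y)$ for the least $i$ with $\mathtt{content}_i(y)$ infinite (resp. for some $i$). Player II wins/is winnable in $G_m(f,X)$ (resp. $G_*(f,X)$) if he wins/is winnable in $G(f,X)$ and does not violate rule $m$ (resp.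 rule $*$). A strategy for II is $\psi:\mathbb{N}^{<\mathbb{N}}\to(\mathbb{N}\cup X)^{<\mathbb{N}}$ with $|\psi(\sigma)|=|\sigma|$ and $\psi(\sigma)\subseteq\psi(\tau)$ for $\sigma\subseteq\tau$; it is winning (resp. winnable) if II wins (resp. is winnable) on the play $(x,\bigcup_n\psi(x\upharpoonright n))$ for every $x\in\mathbb{N}^\mathbb{N}$.
   Formalization: Proved for m ≥ 1 (m = 0 fails) and a concrete {Ψ_e}. As literally stated (3) and (6) fail for m ≥ 2: in (3) rule * is imposed only when x ∈ dom(f); in (6) the ban on infinitely many back♯ is imposed only on the tape carrying the output. *)

theory Defs
  imports Complex_Main "HOL-Library.Nat_Bijection" "HOL-Library.Extended_Nat"
    "HOL-Library.Infinite_Set" "HOL-Library.Sublist"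
begin

type_synonym baire = "nat \<Rightarrow> nat"

abbreviation init_seg :: "(nat \<Rightarrow> 'a) \<Rightarrow> nat \<Rightarrow> 'a list" (infixl "\<restriction>" 75)
  where "x \<restriction> n \<equiv> map x [0..<n]"

text \<open>Cardinalities of sets of natural numbers; \<open>\<infinity>\<close> plays the role of \<open>\<omega>\<close>.\<close>

definition ecard :: "'a set \<Rightarrow> enat"
  where "ecard A = (if finite A then enat (card A) else \<infinity>)"


section \<open>Partial computable functions and functionals\<close>

text \<open>
  Partial recursive functions of one argument relative to a partial oracle; several
  arguments are passed through Cantor pairing. \<open>Prec p q\<close> maps \<open>(a, n)\<close> to the \<open>n\<close>-th iterate of
  primitive recursion with base \<open>p a\<close> and step \<open>q (a, (i, v))\<close>. \<open>Search p\<close> maps \<open>(a, n)\<close> to the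
  least \<open>k \<ge> n\<close> with \<open>p (a, k) = 0\<close>, provided that \<open>p (a, j)\<close> is defined for \<open>n \<le> j \<le> k\<close>.
\<close>

datatype prog = Zero | Succ | Fst | Snd | Query
  | Pair prog prog | Comp prog prog | Prec prog prog | Search prog

text \<open>
  \<open>run g t p x\<close> is the result of \<open>p\<close> on input \<open>x\<close> with oracle \<open>g\<close> if the computation ends
  within \<open>t\<close> stages. The stage \<open>t\<close> also bounds the inputs of all subcomputations, so that for a
  finite oracle \<open>run\<close> is a computable function of its arguments. A query outside the domain
  of \<open>g\<close> diverges.
\<close>

fun run :: "(nat \<rightharpoonup> nat) \<Rightarrow> nat \<Rightarrow> prog \<Rightarrow> nat \<Rightarrow> nat option"
  where
    "run g 0 p x = None"
  | "run g (Suc t) Zero x = (if x \<le> t then Some 0 else None)"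
  | "run g (Suc t) Succ x = (if x \<le> t then Some (Suc x) else None)"
  | "run g (Suc t) Fst x = (if x \<le> t then Some (fst (prod_decode x)) else None)"
  | "run g (Suc t) Snd x = (if x \<le> t then Some (snd (prod_decode x)) else None)"
  | "run g (Suc t) Query x = (if x \<le> t then g x else None)"
  | "run g (Suc t) (Pair p q) x = (if x \<le> t then
       (case run g (Suc t) p x of None \<Rightarrow> None | Some a \<Rightarrow>
         (case run g (Suc t) q x of None \<Rightarrow> None | Some b \<Rightarrow> Some (prod_encode (a, b))))
       else None)"
  | "run g (Suc t) (Comp p q) x = (if x \<le> t then
       (case run g (Suc t) q x of None \<Rightarrow> None | Some a \<Rightarrow> run g (Suc t) p a)
       else None)"
  | "run g (Suc t) (Prec p q) x = (if x \<le> t then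
       (case prod_decode x of (a, n) \<Rightarrow>
         (case n of 0 \<Rightarrow> run g (Suc t) p a
          | Suc i \<Rightarrow> (case run g t (Prec p q) (prod_encode (a, i)) of None \<Rightarrow> None
              | Some v \<Rightarrow> run g (Suc t) q (prod_encode (a, prod_encode (i, v))))))
       else None)"
  | "run g (Suc t) (Search p) x = (if x \<le> t then
       (case prod_decode x of (a, n) \<Rightarrow>
         (case run g (Suc t) p x of None \<Rightarrow> None
          | Some v \<Rightarrow> if v = 0 then Some n else run g t (Search p) (prod_encode (a, Suc n))))
       else None)"

lemma fst_prod_decode_le: "fst (prod_decode n) \<le> n"
  by (metis le_prod_encode_1 prod.collapse prod_decode_inverse)

lemma snd_prod_decode_le: "snd (prod_decode n) \<le> n"
  by (metis le_prod_encode_2 prod.collapse prod_decode_inverse)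

function prog_of :: "nat \<Rightarrow> prog"
  where "prog_of n =
    (if n = 0 then Zero else if n = 1 then Succ else if n = 2 then Fst
     else if n = 3 then Snd else if n = 4 then Query
     else let k = (n - 5) div 4; a = fst (prod_decode k); b = snd (prod_decode k) in
       if (n - 5) mod 4 = 0 then Pair (prog_of a) (prog_of b)
       else if (n - 5) mod 4 = 1 then Comp (prog_of a) (prog_of b)
       else if (n - 5) mod 4 = 2 then Prec (prog_of a) (prog_of b)
       else Search (prog_of k))"
  by pat_completeness auto

termination
proof (relation "measure id", goal_cases)
  case 1
  show ?case by simp
qed (use fst_prod_decode_le snd_prod_decode_le in
      \<open>auto intro!: le_less_trans[OF fst_prod_decode_le] le_less_trans[OF snd_prod_decode_le]\<close>)

declare prog_of.simps [simp del]

lemma div_mod_aux: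
  fixes k :: nat
  shows "Suc (4 * k) div 4 = k" "Suc (Suc (4 * k)) div 4 = k" "Suc (Suc (Suc (4 * k))) div 4 = k"
    "Suc (4 * k) mod 4 = 1" "Suc (Suc (4 * k)) mod 4 = 2" "Suc (Suc (Suc (4 * k))) mod 4 = 3"
  by presburger+

lemma surj_prog_of: "\<exists>n. prog_of n = p"
proof (induction p)
  case Zero
  show ?case by (rule exI[of _ 0]) (simp add: prog_of.simps)
next
  case Succ
  show ?case by (rule exI[of _ 1]) (simp add: prog_of.simps)
next
  case Fst
  show ?case by (rule exI[of _ 2]) (simp add: prog_of.simps)
next
  case Snd
  show ?case by (rule exI[of _ 3]) (simp add: prog_of.simps)
next
  case Query
  show ?case by (rule exI[of _ 4]) (simp add: prog_of.simps)
next
  case (Pair p q)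
  then obtain a b where "prog_of a = p" "prog_of b = q" by blast
  then show ?case
    by (intro exI[of _ "5 + 4 * prod_encode (a, b)"]) (subst prog_of.simps, simp add: Let_def div_mod_aux)
next
  case (Comp p q)
  then obtain a b where "prog_of a = p" "prog_of b = q" by blast
  then show ?case
    by (intro exI[of _ "5 + (1 + 4 * prod_encode (a, b))"]) (subst prog_of.simps, simp add: Let_def div_mod_aux)
next
  case (Prec p q)
  then obtain a b where "prog_of a = p" "prog_of b = q" by blast
  then show ?case
    by (intro exI[of _ "5 + (2 + 4 * prod_encode (a, b))"]) (subst prog_of.simps, simp add: Let_def div_mod_aux)
next
  case (Search p)
  then obtain a where "prog_of a = p" by blast
  then show ?case
    by (intro exI[of _ "5 + (3 + 4 * a)"]) (subst prog_of.simps, simp add: Let_def div_mod_aux)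
qed

definition computes :: "(nat \<rightharpoonup> nat) \<Rightarrow> nat \<Rightarrow> nat \<Rightarrow> nat \<Rightarrow> bool"
  where "computes g e x y \<longleftrightarrow> (\<exists>t. run g t (prog_of e) x = Some y)"

lemma run_mono: "run g t p x = Some y \<Longrightarrow> t \<le> t' \<Longrightarrow> run g t' p x = Some y"
proof (induction g t p x arbitrary: y t' rule: run.induct)
  case (7 g t p q x)
  from 7(4) obtain s where [simp]: "t' = Suc s" and "t \<le> s" by (cases t') simp_all
  from 7(3) obtain a b where ab: "x \<le> t" "run g (Suc t) p x = Some a"
      "run g (Suc t) q x = Some b" "y = prod_encode (a, b)"
    by (auto split: if_splits option.splits)
  with 7(1)[OF ab(1,2) 7(4)] 7(2)[OF ab(1,2,3) 7(4)] \<open>t \<le> s\<close> show ?case by simp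
next
  case (8 g t p q x)
  from 8(4) obtain s where [simp]: "t' = Suc s" and "t \<le> s" by (cases t') simp_all
  from 8(3) obtain a where a: "x \<le> t" "run g (Suc t) q x = Some a" "run g (Suc t) p a = Some y"
    by (auto split: if_splits option.splits)
  with 8(1)[OF a(1,2) 8(4)] 8(2)[OF a(1,2,3) 8(4)] \<open>t \<le> s\<close> show ?case by simp
next
  case (9 g t p q x)
  from 9(5) obtain s where [simp]: "t' = Suc s" and ts: "t \<le> s" by (cases t') simp_all
  obtain a n where an: "prod_decode x = (a, n)" by force
  from 9(4) have x: "x \<le> t" by (simp split: if_splits)
  show ?case
  proof (cases n)
    case 0
    with 9(4) x an have "run g (Suc t) p a = Some y" by simp
    from 9(1)[OF x an[symmetric] 0 this 9(5)] 0 x an ts show ?thesis by simp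
  next
    case (Suc i)
    with 9(4) x an obtain v where v: "run g t (Prec p q) (prod_encode (a, i)) = Some v"
        "run g (Suc t) q (prod_encode (a, prod_encode (i, v))) = Some y"
      by (auto split: option.splits)
    from 9(2)[OF x an[symmetric] Suc v(1) ts] 9(3)[OF x an[symmetric] Suc v(1,2) 9(5)]
      Suc x an ts show ?thesis by simp
  qed
next
  case (10 g t p x)
  from 10(4) obtain s where [simp]: "t' = Suc s" and ts: "t \<le> s" by (cases t') simp_all
  obtain a n where an: "prod_decode x = (a, n)" by force
  from 10(3) have x: "x \<le> t" by (simp split: if_splits)
  from 10(3) x an obtain v where v: "run g (Suc t) p x = Some v"
      "(if v = 0 then Some n else run g t (Search p) (prod_encode (a, Suc n))) = Some y"
    by (auto split: option.splits)
  note p = 10(1)[OF x an[symmetric] v(1) 10(4)]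
  show ?case
  proof (cases "v = 0")
    case True
    with p v(2) x an ts show ?thesis by simp
  next
    case False
    with v(2) have "run g t (Search p) (prod_encode (a, Suc n)) = Some y" by simp
    from 10(2)[OF x an[symmetric] v(1) False this ts] False p x an ts show ?thesis by simp
  qed
next
  case (6 g t x)
  then show ?case by (cases t') (simp_all split: if_splits)
qed (simp, (case_tac t', simp_all split: if_splits)+)

lemma computes_unique: "computes g e x y \<Longrightarrow> computes g e x z \<Longrightarrow> y = z"
  unfolding computes_def by (metis nat_le_linear option.inject run_mono)

text \<open>The partial computable functional with index \<open>e\<close>, defined where every output digit is.\<close>

definition Phi :: "nat \<Rightarrow> baire \<rightharpoonup> baire"
  where "Phi e g =
    (if \<exists>h. \<forall>n. computes (Some \<circ> g) e n (h n)
     then Some (THE h. \<forall>n. computes (Some \<circ> g) e n (h n)) else None)"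

text \<open>
  Computability without an oracle is computability relative to the nowhere defined oracle,
  since every query to the latter diverges.
\<close>

definition computable :: "(nat \<Rightarrow> nat) \<Rightarrow> bool"
  where "computable F \<longleftrightarrow> (\<exists>e. \<forall>x. computes Map.empty e x (F x))"

definition partial_computable :: "(nat \<rightharpoonup> nat) \<Rightarrow> bool"
  where "partial_computable F \<longleftrightarrow> (\<exists>e. \<forall>x y. F x = Some y \<longleftrightarrow> computes Map.empty e x y)"


section \<open>Learners\<close>

text \<open>
  An index \<open>e\<close> codes a pair \<open>(c, p)\<close>. On \<open>\<sigma>\<close> the learner answers with the value of the
  partial computable function with index \<open>p\<close> at the longest initial segment of \<open>\<sigma>\<close> on which it
  halts within \<open>|\<sigma>|\<close> stages, and with \<open>c\<close> as long as there is none. Without the free choice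
  of the first answer \<open>c\<close> the delay could cost a learner an additional mind change. If \<open>p\<close> computes
  a total learner with value \<open>c\<close> at the empty sequence, the answers of \<open>Psi e\<close> along any \<open>g\<close> are a
  subsequence, with repetitions, of the answers of that learner.
\<close>

definition Psi :: "nat \<Rightarrow> nat list \<Rightarrow> nat"
  where "Psi e \<sigma> =
    (let (c, p) = prod_decode e;
         val = (\<lambda>n. run Map.empty (length \<sigma>) (prog_of p) (list_encode (take n \<sigma>)));
         H = {n. n \<le> length \<sigma> \<and> val n \<noteq> None}
     in if H = {} then c else the (val (Max H)))"

lemma Psi_dominates:
  assumes "partial_computable (\<lambda>x. L (list_decode x))"
  shows "\<exists>e. \<forall>g v. (\<forall>\<^sub>\<infinity>n. L (g \<restriction> n) = Some v) \<longrightarrow> (\<lambda>n. Psi e (g \<restriction> n)) \<longlonglongrightarrow> v"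
proof -
  from assms obtain p where
    p: "\<And>x y. L (list_decode x) = Some y \<longleftrightarrow> computes Map.empty p x y"
    unfolding partial_computable_def by auto
  define e where "e = prod_encode (0, p)"
  have "(\<lambda>n. Psi e (g \<restriction> n)) \<longlonglongrightarrow> v" if lim: "\<forall>\<^sub>\<infinity>n. L (g \<restriction> n) = Some v" for g v
  proof -
    from lim obtain N where N: "\<And>n. n \<ge> N \<Longrightarrow> L (g \<restriction> n) = Some v"
      unfolding MOST_nat_le by blast
    then have "computes Map.empty p (list_encode (g \<restriction> N)) v"
      using p[of "list_encode (g \<restriction> N)" v] by simp
    then obtain t where
      t: "run Map.empty t (prog_of p) (list_encode (g \<restriction> N)) = Some v"
      unfolding computes_def by blast
    have "Psi e (g \<restriction> s) = v" if s: "s \<ge> max N t" for s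
    proof -
      define val where
        "val n = run Map.empty s (prog_of p) (list_encode (take n (g \<restriction> s)))" for n
      define H where "H = {n. n \<le> s \<and> val n \<noteq> None}"
      have take: "take n (g \<restriction> s) = g \<restriction> n" if "n \<le> s" for n
        using that by (simp add: take_map)
      have "val N = Some v"
        using run_mono[OF t, of s] s take[of N] by (simp add: val_def)
      then have NH: "N \<in> H" using s by (simp add: H_def)
      have fin: "finite H" by (simp add: H_def)
      have MH: "Max H \<in> H" and MN: "N \<le> Max H"
        using NH fin Max_in Max_ge by blast+
      then obtain w where w: "val (Max H) = Some w" and le: "Max H \<le> s"
        by (auto simp: H_def)
      then have "computes Map.empty p (list_encode (g \<restriction> Max H)) w"
        unfolding computes_def val_def using take by metis
      then have "L (g \<restriction> Max H) = Some w"
        using p[of "list_encode (g \<restriction> Max H)" w] by simp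
      then have "w = v" using N[OF MN] by simp
      moreover have "Psi e (g \<restriction> s) = the (val (Max H))"
        using NH unfolding Psi_def e_def Let_def H_def val_def by (auto simp: H_def)
      ultimately show ?thesis using w by simp
    qed
    then show ?thesis
      by (intro tendsto_eventually) (use eventually_sequentially in blast)
  qed
  then show ?thesis by blast
qed

definition learner_computable :: "enat \<Rightarrow> enat \<Rightarrow> enat \<Rightarrow> (baire \<rightharpoonup> baire) \<Rightarrow> bool"
    ("'(_,_|_')-computable")
  where "(\<alpha>,\<beta>|\<gamma>)-computable f \<longleftrightarrow>
    (\<exists>I :: nat set. ecard I = \<alpha> \<and>
      (\<forall>g \<in> dom f. \<exists>e \<in> I. \<exists>c.
        (\<lambda>n. Psi e (g \<restriction> n)) \<longlonglongrightarrow> c \<and> Phi c g = f g \<and>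
        ecard {n. Psi e (g \<restriction> Suc n) \<noteq> Psi e (g \<restriction> n)} < \<beta> \<and>
        ecard (range (\<lambda>n. Psi e (g \<restriction> n))) \<le> \<gamma>))"


section \<open>Games\<close>

datatype sym = Num nat | Pass | Back | Move nat

definition P :: "sym set"
  where "P = {Pass}"

definition B :: "sym set"
  where "B = {Back}"

definition M :: "enat \<Rightarrow> sym set"
  where "M \<alpha> = {Move i | i. enat i < \<alpha>}"

text \<open>\<open>tape y n\<close> and \<open>content i y n\<close> are taken after the first \<open>n\<close> moves of \<open>y\<close>.\<close>

primrec tape :: "(nat \<Rightarrow> sym) \<Rightarrow> nat \<Rightarrow> nat"
  where
    "tape y 0 = 0"
  | "tape y (Suc n) = (case y n of Move i \<Rightarrow> i | _ \<Rightarrow> tape y n)"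

primrec content :: "nat \<Rightarrow> (nat \<Rightarrow> sym) \<Rightarrow> nat \<Rightarrow> nat list"
  where
    "content i y 0 = []"
  | "content i y (Suc n) =
      (if i = tape y n
       then (case y n of Num k \<Rightarrow> content i y n @ [k] | Back \<Rightarrow> [] | _ \<Rightarrow> content i y n)
       else content i y n)"

text \<open>The limit of the contents of tape \<open>i\<close> is the infinite sequence \<open>h\<close>.\<close>

definition content_lim :: "nat \<Rightarrow> (nat \<Rightarrow> sym) \<Rightarrow> baire \<Rightarrow> bool"
  where "content_lim i y h \<longleftrightarrow>
    (\<forall>k. \<forall>\<^sub>\<infinity>n. k < length (content i y n) \<and> content i y n ! k = h k)"

definition content_infinite :: "nat \<Rightarrow> (nat \<Rightarrow> sym) \<Rightarrow> bool"
  where "content_infinite i y \<longleftrightarrow> (\<exists>h. content_lim i y h)"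

definition I_violates_basic :: "(baire \<rightharpoonup> baire) \<Rightarrow> baire \<Rightarrow> bool"
  where "I_violates_basic f x \<longleftrightarrow> x \<notin> dom f"

definition II_violates_basic :: "(nat \<Rightarrow> sym) \<Rightarrow> bool"
  where "II_violates_basic y \<longleftrightarrow>
    (\<forall>\<^sub>\<infinity>n. y n \<in> insert Pass (range Move)) \<or> (\<exists>\<^sub>\<infinity>n. y n = Back)"

definition II_violates_rule :: "nat \<Rightarrow> (nat \<Rightarrow> sym) \<Rightarrow> bool"
  where "II_violates_rule m y \<longleftrightarrow> enat m \<le> ecard {n. y n = Back}"

definition II_violates_star :: "(nat \<Rightarrow> sym) \<Rightarrow> bool"
  where "II_violates_star y \<longleftrightarrow> (\<exists>\<^sub>\<infinity>n. y n \<in> range Move)"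

definition wins :: "(baire \<rightharpoonup> baire) \<Rightarrow> baire \<Rightarrow> (nat \<Rightarrow> sym) \<Rightarrow> bool"
  where "wins f x y \<longleftrightarrow> I_violates_basic f x \<or>
    \<not> II_violates_basic y \<and>
    (\<exists>i h. content_infinite i y \<and> (\<forall>j < i. \<not> content_infinite j y) \<and>
      content_lim i y h \<and> f x = Some h)"

definition winnable :: "(baire \<rightharpoonup> baire) \<Rightarrow> baire \<Rightarrow> (nat \<Rightarrow> sym) \<Rightarrow> bool"
  where "winnable f x y \<longleftrightarrow> I_violates_basic f x \<or>
    \<not> II_violates_basic y \<and> (\<exists>i h. content_lim i y h \<and> f x = Some h)"

definition wins_rule :: "nat \<Rightarrow> (baire \<rightharpoonup> baire) \<Rightarrow> baire \<Rightarrow> (nat \<Rightarrow> sym) \<Rightarrow> bool"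
  where "wins_rule m f x y \<longleftrightarrow> wins f x y \<and> \<not> II_violates_rule m y"

text \<open>
  Rule \<open>*\<close>, unlike the rules \<open>m\<close>, can only be imposed on plays in which Player I respects the
  basic rule: let \<open>f\<close> map an eventually constant 0-1-sequence to the constant sequence of its
  limit. A learner with two hypotheses computes \<open>f\<close>, but by the Baire category theorem a strategy
  on two tapes that moves only finitely often on every \<open>x\<close> is confined to a single tape above
  some finite 0-1-sequence, and so does not win.
\<close>

definition wins_star :: "(baire \<rightharpoonup> baire) \<Rightarrow> baire \<Rightarrow> (nat \<Rightarrow> sym) \<Rightarrow> bool"
  where "wins_star f x y \<longleftrightarrow> I_violates_basic f x \<or> wins f x y \<and> \<not> II_violates_star y"

text \<open>
  For games with both \<open>Back\<close> and several tapes, the clause of the basic rule against infinitely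
  many \<open>Back\<close> is imposed on the tape that carries the result, not on all tapes together. Learners
  in a team need not all converge: let \<open>f (a, h)\<close> be the constant sequence of \<open>lim h\<close> if \<open>h\<close>
  converges, and that of \<open>a\<close> otherwise. A team of two learners computes \<open>f\<close>, but by letting \<open>h\<close>
  run through sufficiently long blocks of distinct values one forces any otherwise successful
  strategy on two tapes to play \<open>Back\<close> infinitely often. On a single tape the two versions of
  the clause agree.
\<close>

definition II_violates_basic_on :: "nat \<Rightarrow> (nat \<Rightarrow> sym) \<Rightarrow> bool"
  where "II_violates_basic_on i y \<longleftrightarrow>
    (\<forall>\<^sub>\<infinity>n. y n \<in> insert Pass (range Move)) \<or> (\<exists>\<^sub>\<infinity>n. y n = Back \<and> tape y n = i)"

definition winnable_tapewise :: "(baire \<rightharpoonup> baire) \<Rightarrow> baire \<Rightarrow> (nat \<Rightarrow> sym) \<Rightarrow> bool"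
  where "winnable_tapewise f x y \<longleftrightarrow> I_violates_basic f x \<or>
    (\<exists>i h. \<not> II_violates_basic_on i y \<and> content_lim i y h \<and> f x = Some h)"

lemma winnable_imp_winnable_tapewise: "winnable f x y \<Longrightarrow> winnable_tapewise f x y"
  unfolding winnable_def winnable_tapewise_def II_violates_basic_def II_violates_basic_on_def
  by (auto elim: MOST_mono)

lemma winnable_tapewise_single_tape:
  assumes "\<forall>n. y n \<notin> range Move"
  shows "winnable_tapewise f x y \<longleftrightarrow> winnable f x y"
proof
  have tape: "tape y n = 0" for n
    using assms by (induction n) (auto split: sym.split)
  have other: "content i y n = []" if "i \<noteq> 0" for i n
    using that by (induction n) (auto simp: tape)
  have "i = 0" if "content_lim i y h" for i h
    using that other[of i] by (cases "i = 0") (auto simp: content_lim_def)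
  then show "winnable_tapewise f x y \<Longrightarrow> winnable f x y"
    unfolding winnable_def winnable_tapewise_def II_violates_basic_def II_violates_basic_on_def tape
    by auto
qed (rule winnable_imp_winnable_tapewise)

definition strategy :: "sym set \<Rightarrow> (nat list \<Rightarrow> sym list) \<Rightarrow> bool"
  where "strategy X \<psi> \<longleftrightarrow>
    (\<forall>\<sigma>. set (\<psi> \<sigma>) \<subseteq> range Num \<union> X \<and> length (\<psi> \<sigma>) = length \<sigma>) \<and>
    (\<forall>\<sigma> \<tau>. prefix \<sigma> \<tau> \<longrightarrow> prefix (\<psi> \<sigma>) (\<psi> \<tau>))"

fun sym_encode :: "sym \<Rightarrow> nat"
  where
    "sym_encode Pass = 0"
  | "sym_encode Back = 1"
  | "sym_encode (Num k) = 2 + 2 * k"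
  | "sym_encode (Move i) = 3 + 2 * i"

definition computable_strategy :: "sym set \<Rightarrow> (nat list \<Rightarrow> sym list) \<Rightarrow> bool"
  where "computable_strategy X \<psi> \<longleftrightarrow> strategy X \<psi> \<and>
    computable (\<lambda>s. list_encode (map sym_encode (\<psi> (list_decode s))))"

text \<open>The union of the \<open>\<psi> (x \<restriction> n)\<close>.\<close>

definition response :: "(nat list \<Rightarrow> sym list) \<Rightarrow> baire \<Rightarrow> nat \<Rightarrow> sym"
  where "response \<psi> x n = \<psi> (x \<restriction> Suc n) ! n"

definition has_computable_strategy ::
    "(baire \<Rightarrow> (nat \<Rightarrow> sym) \<Rightarrow> bool) \<Rightarrow> sym set \<Rightarrow> bool"
  where "has_computable_strategy W X \<longleftrightarrow>
    (\<exists>\<psi>. computable_strategy X \<psi> \<and> (\<forall>x. W x (response \<psi> x)))"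

end

theory Submission
  imports Defs "HOL-Library.More_List"
begin

text \<open>
  To turn learners into a strategy, Player II assigns a hypothesis to each tape and writes the digits of the
  corresponding functional as far as a step-bounded universal interpreter produces them. A mind change
  is answered by erasing the tape, or by moving to the tape reserved for the new hypothesis; teams are
  dovetailed over their tapes. If only finitely many mind changes occur, the tape converges to the value
  of the last hypothesis.

  Conversely, the s-m-n theorem gives indices for the functionals that read off the content of tape \<open>i\<close> after
  the \<open>k\<close>-th \<open>Back\<close> on it, and a learner conjectures the index that belongs to the current position
  of the play. These conjectures change only when a \<open>Back\<close> (or, for rule \<open>*\<close>, a \<open>Move\<close>) is played.
\<close>

section \<open>Evaluation of programs\<close>

text \<open>Three requirements shape the constructions. First, a strategy must obey rule
  \<open>m\<close>, and play only legal symbols, even on inputs outside \<open>dom f\<close>, where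
  a learner may behave arbitrarily; hence the cap on erasures and the guard \<open>j < m\<close> on
  moves. Second, mind changes are counted sharply: every \<open>Back\<close> is charged to one mind
  change, since a tape is erased only if its content is not confirmed by the current hypothesis, and
  conversely a learner that lags behind the play may merge changes but not add any. Third, the
  cardinality of a team is exact, so that indices obtained from the s-m-n theorem have to come with
  injectivity. Computability is certified by a closure calculus for \<open>recf\<close>. Its
  parameter \<open>D\<close> lets the same rules serve strategies and learners, which use the empty
  oracle, and functionals, which use total oracles.\<close>

definition ev :: "(nat \<rightharpoonup> nat) \<Rightarrow> prog \<Rightarrow> nat \<Rightarrow> nat \<Rightarrow> bool"
  where "ev g p x y \<longleftrightarrow> (\<exists>t. run g t p x = Some y)"

lemma computes_iff_ev: "computes g e x y \<longleftrightarrow> ev g (prog_of e) x y"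
  by (simp add: computes_def ev_def)

lemma ev_unique: "ev g p x y \<Longrightarrow> ev g p x z \<Longrightarrow> y = z"
  unfolding ev_def by (metis nat_le_linear option.inject run_mono)

lemma ev_stage:
  assumes "ev g p x y"
  obtains T where "\<And>t. t \<ge> T \<Longrightarrow> run g t p x = Some y"
  using assms run_mono unfolding ev_def by metis

lemma ev_Zero: "ev g Zero x 0"
  unfolding ev_def by (rule exI[of _ "Suc x"]) simp

lemma ev_Succ: "ev g Succ x (Suc x)"
  unfolding ev_def by (rule exI[of _ "Suc x"]) simp

lemma ev_Fst: "ev g Fst x (fst (prod_decode x))"
  unfolding ev_def by (rule exI[of _ "Suc x"]) simp

lemma ev_Snd: "ev g Snd x (snd (prod_decode x))"
  unfolding ev_def by (rule exI[of _ "Suc x"]) simp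

lemma ev_Query: "g x = Some y \<Longrightarrow> ev g Query x y"
  unfolding ev_def by (rule exI[of _ "Suc x"]) simp

lemma ev_Pair:
  assumes "ev g p x a" "ev g q x b"
  shows "ev g (Pair p q) x (prod_encode (a, b))"
proof -
  obtain T where T: "\<And>t. t \<ge> T \<Longrightarrow> run g t p x = Some a" using ev_stage[OF assms(1)] by blast
  obtain S where S: "\<And>t. t \<ge> S \<Longrightarrow> run g t q x = Some b" using ev_stage[OF assms(2)] by blast
  have "run g (Suc (T + S + x)) (Pair p q) x = Some (prod_encode (a, b))"
    by (simp add: T S)
  then show ?thesis unfolding ev_def by blast
qed

lemma ev_Comp:
  assumes "ev g q x a" "ev g p a b"
  shows "ev g (Comp p q) x b"
proof -
  obtain T where T: "\<And>t. t \<ge> T \<Longrightarrow> run g t q x = Some a" using ev_stage[OF assms(1)] by blast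
  obtain S where S: "\<And>t. t \<ge> S \<Longrightarrow> run g t p a = Some b" using ev_stage[OF assms(2)] by blast
  have "run g (Suc (T + S + x)) (Comp p q) x = Some b"
    by (simp add: T S)
  then show ?thesis unfolding ev_def by blast
qed

lemma ev_Prec_0:
  assumes "ev g p a b"
  shows "ev g (Prec p q) (prod_encode (a, 0)) b"
proof -
  obtain T where T: "\<And>t. t \<ge> T \<Longrightarrow> run g t p a = Some b" using ev_stage[OF assms(1)] by blast
  have "run g (Suc (T + prod_encode (a, 0))) (Prec p q) (prod_encode (a, 0)) = Some b"
    by (simp add: T)
  then show ?thesis unfolding ev_def by blast
qed

lemma ev_Prec_Suc:
  assumes "ev g (Prec p q) (prod_encode (a, i)) v" "ev g q (prod_encode (a, prod_encode (i, v))) w"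
  shows "ev g (Prec p q) (prod_encode (a, Suc i)) w"
proof -
  obtain T where T: "\<And>t. t \<ge> T \<Longrightarrow> run g t (Prec p q) (prod_encode (a, i)) = Some v"
    using ev_stage[OF assms(1)] by blast
  obtain S where S: "\<And>t. t \<ge> S \<Longrightarrow> run g t q (prod_encode (a, prod_encode (i, v))) = Some w"
    using ev_stage[OF assms(2)] by blast
  have "run g (Suc (T + S + prod_encode (a, Suc i))) (Prec p q) (prod_encode (a, Suc i)) = Some w"
    by (simp add: T S)
  then show ?thesis unfolding ev_def by blast
qed

lemma ev_Search_found:
  assumes "ev g p (prod_encode (a, n)) 0"
  shows "ev g (Search p) (prod_encode (a, n)) n"
proof -
  let ?x = "prod_encode (a, n)"
  obtain T where T: "\<And>t. t \<ge> T \<Longrightarrow> run g t p ?x = Some 0" using ev_stage[OF assms(1)] by blast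
  have "run g (Suc (T + ?x)) (Search p) ?x = Some n"
    by (simp add: T)
  then show ?thesis unfolding ev_def by blast
qed

lemma ev_Search_next:
  assumes "ev g p (prod_encode (a, n)) v" "v \<noteq> 0" "ev g (Search p) (prod_encode (a, Suc n)) w"
  shows "ev g (Search p) (prod_encode (a, n)) w"
proof -
  let ?x = "prod_encode (a, n)"
  obtain T where T: "\<And>t. t \<ge> T \<Longrightarrow> run g t p ?x = Some v" using ev_stage[OF assms(1)] by blast
  obtain S where S: "\<And>t. t \<ge> S \<Longrightarrow> run g t (Search p) (prod_encode (a, Suc n)) = Some w"
    using ev_stage[OF assms(3)] by blast
  have "run g (Suc (T + S + ?x)) (Search p) ?x = Some w"
    using assms(2) by (simp add: T S)
  then show ?thesis unfolding ev_def by blast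
qed

text \<open>Backward induction from the least zero \<open>r\<close>: started at \<open>r\<close> the
  search stops at once, and started earlier it passes on to the next candidate.\<close>

lemma ev_Search:
  assumes "\<And>n. ev g p (prod_encode (a, n)) (F n)" "F s = 0"
  obtains r where "F r = 0" "ev g (Search p) (prod_encode (a, 0)) r"
proof -
  define r where "r = (LEAST n. F n = 0)"
  have r: "F r = 0" unfolding r_def using assms(2) by (rule LeastI)
  have "ev g (Search p) (prod_encode (a, n)) r" if "n \<le> r" for n
    using that
  proof (induction rule: inc_induct)
    case base
    show ?case using ev_Search_found[of g p a r] assms(1)[of r] r by simp
  next
    case (step n)
    have "F n \<noteq> 0" using step.hyps unfolding r_def by (metis not_less_Least)
    then show ?case by (rule ev_Search_next[OF assms(1) _ step.IH])
  qed
  from this[of 0] r show thesis by (auto intro: that)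
qed

text \<open>The stage bounds the inputs of all subcomputations, queries included, so only the oracle
  below \<open>t\<close> matters. This makes step-bounded runs on \<open>x\<close> computable from a
  finite initial segment of \<open>x\<close>.\<close>

lemma run_cong: "(\<And>k. k < t \<Longrightarrow> g k = g' k) \<Longrightarrow> run g t p x = run g' t p x"
proof (induction g t p x rule: run.induct)
  case (7 g t p q x)
  then show ?case by (auto split: option.splits)
next
  case (8 g t p q x)
  then show ?case by (auto split: option.splits)
next
  case (9 g t p q x)
  obtain a n where an: "prod_decode x = (a, n)" by force
  show ?case
  proof (cases "x \<le> t")
    case True
    show ?thesis
    proof (cases n)
      case 0
      then show ?thesis using an True 9(1)[OF True an[symmetric] 0] 9(4) by simp
    next
      case (Suc i)
      have "run g t (Prec p q) (prod_encode (a, i)) = run g' t (Prec p q) (prod_encode (a, i))"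
        using 9(2)[OF True an[symmetric] Suc] 9(4) by simp
      then show ?thesis using an True Suc 9(3)[OF True an[symmetric] Suc] 9(4)
        by (simp split: option.split)
    qed
  qed simp
next
  case (10 g t p x)
  obtain a n where an: "prod_decode x = (a, n)" by force
  show ?case
  proof (cases "x \<le> t")
    case True
    have "run g (Suc t) p x = run g' (Suc t) p x"
      using 10(1)[OF True an[symmetric]] 10(3) by simp
    then show ?thesis using True an 10(2)[OF True an[symmetric]] 10(3)
      by (simp split: option.split)
  qed simp
qed (auto)

text \<open>With the empty oracle every query diverges, so a computation that halts has made
  none.\<close>

lemma run_Map_empty_le: "run Map.empty t p x = Some y \<Longrightarrow> run g t p x = Some y"
proof (induction "Map.empty :: nat \<rightharpoonup> nat" t p x arbitrary: y rule: run.induct)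
  case (9 t p q x)
  obtain a n where an: "prod_decode x = (a, n)" by force
  from 9(4) have x: "x \<le> t" by (simp split: if_splits)
  show ?case
  proof (cases n)
    case 0
    then show ?thesis using an x 9(1)[OF x an[symmetric] 0] 9(4) by simp
  next
    case (Suc i)
    then show ?thesis using an x 9(2,3)[OF x an[symmetric] Suc] 9(4)
      by (auto split: option.splits)
  qed
next
  case (10 t p x)
  obtain a n where an: "prod_decode x = (a, n)" by force
  from 10(3) have x: "x \<le> t" by (simp split: if_splits)
  show ?case using an x 10(1,2)[OF x an[symmetric]] 10(3)
    by (auto split: option.splits if_splits)
qed (auto split: option.splits if_splits)

lemma ev_Map_empty: "ev Map.empty p x y \<Longrightarrow> ev g p x y"
  unfolding ev_def using run_Map_empty_le by blast

section \<open>Computable functions on coded types\<close>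

class coded =
  fixes enc :: "'a \<Rightarrow> nat"
  assumes inj_enc: "inj enc"

lemma enc_eq_iff [simp]: "enc x = enc y \<longleftrightarrow> x = y"
  using inj_enc by (auto dest: injD)

instantiation nat :: coded
begin
definition enc_nat_def [simp]: "enc (n :: nat) = n"
instance by standard (simp add: inj_def)
end

instantiation bool :: coded
begin
definition enc_bool_def: "enc b = (if b then 1 else 0 :: nat)"
instance by standard (simp add: inj_def enc_bool_def)
end

instantiation prod :: (coded, coded) coded
begin
definition enc_prod_def [simp]: "enc z = prod_encode (enc (fst z), enc (snd z))"
instance by standard (simp add: inj_def prod_eq_iff)
end

instantiation option :: (coded) coded
begin
definition enc_option_def: "enc z = (case z of None \<Rightarrow> 0 | Some x \<Rightarrow> Suc (enc x))"
instance by standard (simp add: inj_def enc_option_def split: option.split)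
end

instantiation list :: (coded) coded
begin
definition enc_list_def: "enc xs = list_encode (map enc xs)"
instance
proof
  have "inj (map (enc :: 'a \<Rightarrow> nat))" using inj_enc by (rule inj_mapI)
  then show "inj (enc :: 'a list \<Rightarrow> nat)"
    unfolding enc_list_def inj_def by (simp add: list_encode_eq)
qed
end

instantiation sym :: coded
begin
definition enc_sym_def: "enc s = sym_encode s"
instance
proof
  show "inj (enc :: sym \<Rightarrow> nat)"
  proof (rule injI)
    fix s s' :: sym
    assume "enc s = enc s'"
    then show "s = s'"
      by (cases s; cases s') (auto simp: enc_sym_def, presburger+)
  qed
qed
end

lemma enc_list_simps: "enc [] = 0" "enc (x # xs) = Suc (prod_encode (enc x, enc xs))"
  by (simp_all add: enc_list_def)

lemma enc_nat_list: "enc (xs :: nat list) = list_encode xs"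
proof -
  have "map enc xs = xs" by (induction xs) auto
  then show ?thesis by (simp add: enc_list_def)
qed

lemma enc_sym_list: "enc ys = list_encode (map sym_encode ys)"
proof -
  have "enc = sym_encode" by (rule ext) (simp add: enc_sym_def)
  then show ?thesis by (simp add: enc_list_def)
qed

lemma length_le_enc: "length xs \<le> enc xs"
proof (induction xs)
  case (Cons x xs)
  then show ?case using le_prod_encode_2[of "enc xs" "enc x"] by (simp add: enc_list_simps)
qed simp

text \<open>
  Only codes of elements are required as inputs, so that codings need not be surjective.
  One program serves all oracles in \<open>D\<close>.
\<close>

definition recf :: "(nat \<rightharpoonup> nat) set \<Rightarrow> ((nat \<rightharpoonup> nat) \<Rightarrow> 'a::coded \<Rightarrow> 'b::coded) \<Rightarrow> bool"
  where "recf D F \<longleftrightarrow> (\<exists>p. \<forall>g\<in>D. \<forall>x. ev g p (enc x) (enc (F g x)))"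

named_theorems recf_intros

lemma recfI: "(\<And>g x. g \<in> D \<Longrightarrow> ev g p (enc x) (enc (F g x))) \<Longrightarrow> recf D F"
  unfolding recf_def by blast

lemma recfE:
  assumes "recf D F"
  obtains p where "\<And>g x. g \<in> D \<Longrightarrow> ev g p (enc x) (enc (F g x))"
  using assms unfolding recf_def by blast

primrec const_prog :: "nat \<Rightarrow> prog"
  where
    "const_prog 0 = Zero"
  | "const_prog (Suc n) = Comp Succ (const_prog n)"

lemma ev_const_prog: "ev g (const_prog n) x n"
  by (induction n) (auto intro: ev_Zero ev_Comp ev_Succ)

definition id_prog :: prog
  where "id_prog = Pair Fst Snd"

lemma ev_id_prog: "ev g id_prog x x"
  using ev_Pair[OF ev_Fst ev_Snd, of g x] by (simp add: id_prog_def)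

lemma recf_id [recf_intros]: "recf D (\<lambda>g x. x)"
  by (rule recfI[where p = id_prog]) (rule ev_id_prog)

lemma recf_const [recf_intros]: "recf D (\<lambda>g x. c)"
  by (rule recfI[where p = "const_prog (enc c)"]) (rule ev_const_prog)

lemma recf_comp:
  assumes "recf D F" "recf D G"
  shows "recf D (\<lambda>g x. F g (G g x))"
proof -
  from assms obtain p q where "\<And>g x. g \<in> D \<Longrightarrow> ev g p (enc x) (enc (F g x))"
    "\<And>g x. g \<in> D \<Longrightarrow> ev g q (enc x) (enc (G g x))" by (auto elim!: recfE)
  then show ?thesis by (intro recfI[where p = "Comp p q"] ev_Comp)
qed

lemma recf_Pair [recf_intros]:
  assumes "recf D F" "recf D G"
  shows "recf D (\<lambda>g x. (F g x, G g x))"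
proof -
  from assms obtain p q where "\<And>g x. g \<in> D \<Longrightarrow> ev g p (enc x) (enc (F g x))"
    "\<And>g x. g \<in> D \<Longrightarrow> ev g q (enc x) (enc (G g x))" by (auto elim!: recfE)
  then show ?thesis by (intro recfI[where p = "Pair p q"]) (simp add: ev_Pair)
qed

text \<open>For an oracle-free function \<open>h\<close>, such as a projection or a constructor,
  that one program computes on codes.\<close>

lemma recf_code:
  assumes "\<And>g x. g \<in> D \<Longrightarrow> ev g p (enc x) (enc (h x))" and "recf D F"
  shows "recf D (\<lambda>g x. h (F g x))"
  using assms(1) by (intro recf_comp[OF _ assms(2)] recfI) auto

lemma recf_fst [recf_intros]: "recf D F \<Longrightarrow> recf D (\<lambda>g x. fst (F g x))"
  by (rule recf_code[where p = Fst and h = fst]) (use ev_Fst in \<open>metis enc_prod_def fst_conv prod_encode_inverse\<close>)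

lemma recf_snd [recf_intros]: "recf D F \<Longrightarrow> recf D (\<lambda>g x. snd (F g x))"
  by (rule recf_code[where p = Snd and h = snd]) (use ev_Snd in \<open>metis enc_prod_def snd_conv prod_encode_inverse\<close>)

lemma recf_Suc [recf_intros]: "recf D F \<Longrightarrow> recf D (\<lambda>g x. Suc (F g x))"
  by (rule recf_code[where p = Succ and h = Suc]) (simp add: ev_Succ)

lemma recf_Some [recf_intros]: "recf D F \<Longrightarrow> recf D (\<lambda>g x. Some (F g x))"
  by (rule recf_code[where p = Succ and h = Some]) (simp add: ev_Succ enc_option_def)

lemma recf_enc [recf_intros]: "recf D F \<Longrightarrow> recf D (\<lambda>g x. enc (F g x))"
  by (rule recf_code[where p = id_prog and h = enc]) (simp add: ev_id_prog)

text \<open>Pairs of numbers are coded by \<open>prod_encode\<close> itself, so on codes the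
  decoding is the identity.\<close>

lemma recf_prod_decode [recf_intros]: "recf D F \<Longrightarrow> recf D (\<lambda>g x. prod_decode (F g x))"
  by (rule recf_code[where p = id_prog and h = prod_decode]) (simp add: ev_id_prog)

lemma recf_prod_encode [recf_intros]:
  assumes "recf D F" shows "recf D (\<lambda>g x. prod_encode (F g x))"
  by (rule recf_code[where p = id_prog and h = prod_encode]) (simp_all add: ev_id_prog assms)

lemma recf_list_encode [recf_intros]:
  assumes "recf D F" shows "recf D (\<lambda>g x. list_encode (F g x))"
  by (rule recf_code[where p = id_prog and h = list_encode]) (auto simp: ev_id_prog enc_nat_list assms)

lemma recf_Cons [recf_intros]:
  assumes "recf D F" "recf D G"
  shows "recf D (\<lambda>g x. F g x # G g x)"
proof -
  have "recf D (\<lambda>g x. (\<lambda>z. fst z # snd z) (F g x, G g x))"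
    by (rule recf_code[where p = Succ and h = "\<lambda>z. fst z # snd z"]) (auto simp: enc_list_simps ev_Succ intro!: recf_Pair assms)
  then show ?thesis by simp
qed

text \<open>In premises for terms under a binder, the bound variables become projections of a tuple
  \<open>z\<close>. The rules then apply to the body as to any other term, so membership in
  \<open>recf\<close> is found by repeated introduction.\<close>

lemma recf_rec_nat [recf_intros]:
  fixes A :: "(nat \<rightharpoonup> nat) \<Rightarrow> 'a::coded \<Rightarrow> 'b::coded"
  assumes "recf D A" "recf D (\<lambda>g z. S g (fst z) (fst (snd z)) (snd (snd z)))" "recf D N"
  shows "recf D (\<lambda>g x. rec_nat (A g x) (\<lambda>i v. S g x i v) (N g x))"
proof -
  obtain p where p: "\<And>g x. g \<in> D \<Longrightarrow> ev g p (enc x) (enc (A g x))" using assms(1) unfolding recf_def enc_nat_def by blast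
  obtain q where q: "\<And>g z. g \<in> D \<Longrightarrow>
      ev g q (enc z) (enc (S g (fst z) (fst (snd z)) (snd (snd z))))"
    using assms(2) unfolding recf_def enc_nat_def by blast
  obtain r where r: "\<And>g x. g \<in> D \<Longrightarrow> ev g r (enc x) (enc (N g x))" using assms(3) unfolding recf_def enc_nat_def by blast
  have "ev g (Prec p q) (prod_encode (enc x, n)) (enc (rec_nat (A g x) (\<lambda>i v. S g x i v) n))"
    if "g \<in> D" for g x n
  proof (induction n)
    case 0
    show ?case using p[OF that, of x] by (simp add: ev_Prec_0)
  next
    case (Suc n)
    show ?case
      using ev_Prec_Suc[OF Suc.IH] q[OF that, of "(x, n, rec_nat (A g x) (\<lambda>i v. S g x i v) n)"]
      by simp
  qed
  then show ?thesis
    by (intro recfI[where p = "Comp (Prec p q) (Pair id_prog r)"] ev_Comp[OF ev_Pair])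
      (use r ev_id_prog in auto)
qed

lemma recf_case_nat [recf_intros]:
  fixes A :: "(nat \<rightharpoonup> nat) \<Rightarrow> 'a::coded \<Rightarrow> 'b::coded"
  assumes "recf D N" "recf D A" "recf D (\<lambda>g z. F g (fst z) (snd z))"
  shows "recf D (\<lambda>g x. case N g x of 0 \<Rightarrow> A g x | Suc n \<Rightarrow> F g x n)"
proof -
  have "recf D (\<lambda>g z. (\<lambda>g z. F g (fst z) (snd z)) g (fst z, fst (snd z)))"
    by (rule recf_comp[OF assms(3)]) (intro recf_intros)
  then have "recf D (\<lambda>g z. F g (fst z) (fst (snd z)))" by simp
  from recf_rec_nat[where S = "\<lambda>g x n v. F g x n", OF assms(2) this assms(1)]
  have "recf D (\<lambda>g x. rec_nat (A g x) (\<lambda>n v. F g x n) (N g x))" .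
  moreover have "rec_nat a (\<lambda>n v. f n) n = (case n of 0 \<Rightarrow> a | Suc n \<Rightarrow> f n)" for a :: 'b and f n
    by (cases n) auto
  ultimately show ?thesis by simp
qed

text \<open>The successor branch is only run when it is taken.\<close>

lemma recf_branch:
  fixes N :: "(nat \<rightharpoonup> nat) \<Rightarrow> 'a::coded \<Rightarrow> nat"
  assumes N: "recf D N" and A: "recf D A"
    and q: "\<And>g x k. g \<in> D \<Longrightarrow> N g x = Suc k \<Longrightarrow> ev g q (prod_encode (enc x, k)) (enc (C g x))"
  shows "recf D (\<lambda>g x. if N g x = 0 then A g x else C g x)"
proof -
  obtain n where n: "\<And>g x. g \<in> D \<Longrightarrow> ev g n (enc x) (N g x)" using N unfolding recf_def enc_nat_def by blast
  obtain p where p: "\<And>g x. g \<in> D \<Longrightarrow> ev g p (enc x) (enc (A g x))" using A unfolding recf_def enc_nat_def by blast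
  have "recf D (\<lambda>g x. case x of 0 \<Rightarrow> 0 | Suc k \<Rightarrow> k)" by (intro recf_intros)
  then obtain pd where pd: "\<And>g x. g \<in> D \<Longrightarrow> ev g pd x (case x of 0 \<Rightarrow> 0 | Suc k \<Rightarrow> k)"
    unfolding recf_def enc_nat_def by blast
  have "recf D (\<lambda>g x. case x of 0 \<Rightarrow> 0 :: nat | Suc k \<Rightarrow> 1)" by (intro recf_intros)
  then obtain sg where sg: "\<And>g x. g \<in> D \<Longrightarrow> ev g sg x (case x of 0 \<Rightarrow> 0 | Suc k \<Rightarrow> 1)"
    unfolding recf_def enc_nat_def by blast
  \<comment> \<open>The recursion runs for 0 or 1 steps, as \<open>sg\<close> dictates. Its base is
    \<open>p\<close>; its only possible step recomputes \<open>N g x\<close> and runs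
    \<open>q\<close> on the predecessor, so \<open>q\<close> is never called when
    \<open>N g x = 0\<close>.\<close>
  define s where "s = Prec p (Comp q (Pair Fst (Comp pd (Comp n Fst))))"
  have base: "ev g s (prod_encode (enc x, 0)) (enc (A g x))" if "g \<in> D" for g x
    unfolding s_def by (rule ev_Prec_0[OF p[OF that]])
  have step: "ev g s (prod_encode (enc x, Suc 0)) (enc (C g x))" if g: "g \<in> D" and k: "N g x = Suc k" for g x k
  proof -
    let ?z = "prod_encode (enc x, prod_encode (0, enc (A g x)))"
    have F: "ev g Fst ?z (enc x)" using ev_Fst[of g ?z] by simp
    have "ev g (Comp pd (Comp n Fst)) ?z k"
      using ev_Comp[OF ev_Comp[OF F n[OF g]] pd[OF g]] k by simp
    then have "ev g (Comp q (Pair Fst (Comp pd (Comp n Fst)))) ?z (enc (C g x))"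
      by (rule ev_Comp[OF ev_Pair[OF F]]) (rule q[OF g k])
    then show ?thesis using base[OF g, of x] unfolding s_def by (rule ev_Prec_Suc[rotated])
  qed
  show ?thesis
  proof (rule recfI[where p = "Comp s (Pair id_prog (Comp sg n))"])
    fix g x assume g: "g \<in> D"
    show "ev g (Comp s (Pair id_prog (Comp sg n))) (enc x) (enc (if N g x = 0 then A g x else C g x))"
      by (rule ev_Comp[OF ev_Pair[OF ev_id_prog ev_Comp[OF n[OF g] sg[OF g]]]])
        (cases "N g x"; simp add: base step g)
  qed
qed

lemma recf_If [recf_intros]:
  assumes "recf D b" "recf D A" "recf D C"
  shows "recf D (\<lambda>g x. if b g x then A g x else C g x)"
proof -
  obtain p where p: "\<And>g x. g \<in> D \<Longrightarrow> ev g p (enc x) (enc (A g x))" using assms(2) unfolding recf_def enc_nat_def by blast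
  have "recf D (\<lambda>g x. if enc (b g x) = 0 then C g x else A g x)"
  proof (rule recf_branch[OF recf_enc[OF assms(1)] assms(3)])
    fix g x k assume "g \<in> D"
    then show "ev g (Comp p Fst) (prod_encode (enc x, k)) (enc (A g x))"
      using ev_Comp[OF ev_Fst, of g p "prod_encode (enc x, k)"] p by simp
  qed
  moreover have "(if enc (b g x) = 0 then C g x else A g x) = (if b g x then A g x else C g x)" for g x
    by (simp add: enc_bool_def)
  ultimately show ?thesis by simp
qed

text \<open>The predecessor of the code of \<open>Some y\<close> is the code of \<open>y\<close>.
  For \<open>None\<close> there is nothing to pass on: an arbitrary number need not be a code, and
  the program for \<open>F\<close> might diverge on it. Hence the guarded branch.\<close>

lemma recf_case_option [recf_intros]:
  fixes F :: "(nat \<rightharpoonup> nat) \<Rightarrow> 'a::coded \<Rightarrow> 'c::coded \<Rightarrow> 'b::coded"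
  assumes "recf D N" "recf D A" "recf D (\<lambda>g z. F g (fst z) (snd z))"
  shows "recf D (\<lambda>g x. case N g x of None \<Rightarrow> A g x | Some y \<Rightarrow> F g x y)"
proof -
  obtain p where p: "\<And>g z. g \<in> D \<Longrightarrow> ev g p (enc z) (enc (F g (fst z) (snd z)))"
    using assms(3) unfolding recf_def enc_nat_def by blast
  have "recf D (\<lambda>g x. if enc (N g x) = 0 then A g x else F g x (the (N g x)))"
  proof (rule recf_branch[OF recf_enc[OF assms(1)] assms(2), of p])
    fix g x k assume "g \<in> D" "enc (N g x) = Suc k"
    then show "ev g p (prod_encode (enc x, k)) (enc (F g x (the (N g x))))"
      using p[of g "(x, the (N g x))"] by (auto simp: enc_option_def split: option.splits)
  qed
  moreover have "(if enc (N g x) = 0 then A g x else F g x (the (N g x))) =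
      (case N g x of None \<Rightarrow> A g x | Some y \<Rightarrow> F g x y)" for g x
    by (auto simp: enc_option_def split: option.splits)
  ultimately show ?thesis by simp
qed

lemma recf_case_list [recf_intros]:
  fixes F :: "(nat \<rightharpoonup> nat) \<Rightarrow> 'a::coded \<Rightarrow> 'c::coded \<Rightarrow> 'c list \<Rightarrow> 'b::coded"
  assumes "recf D N" "recf D A" "recf D (\<lambda>g z. F g (fst z) (fst (snd z)) (snd (snd z)))"
  shows "recf D (\<lambda>g x. case N g x of [] \<Rightarrow> A g x | y # ys \<Rightarrow> F g x y ys)"
proof -
  obtain p where p: "\<And>g z. g \<in> D \<Longrightarrow> ev g p (enc z) (enc (F g (fst z) (fst (snd z)) (snd (snd z))))"
    using assms(3) unfolding recf_def enc_nat_def by blast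
  have "recf D (\<lambda>g x. if enc (N g x) = 0 then A g x else F g x (hd (N g x)) (tl (N g x)))"
  proof (rule recf_branch[OF recf_enc[OF assms(1)] assms(2), of p])
    fix g x k assume "g \<in> D" "enc (N g x) = Suc k"
    then show "ev g p (prod_encode (enc x, k)) (enc (F g x (hd (N g x)) (tl (N g x))))"
      using p[of g "(x, hd (N g x), tl (N g x))"] by (cases "N g x") (auto simp: enc_list_simps)
  qed
  moreover have "(if enc (N g x) = 0 then A g x else F g x (hd (N g x)) (tl (N g x))) =
      (case N g x of [] \<Rightarrow> A g x | y # ys \<Rightarrow> F g x y ys)" for g x
    by (auto simp: enc_list_simps split: list.splits)
  ultimately show ?thesis by simp
qed

lemma recf_Let [recf_intros]:
  assumes "recf D N" "recf D (\<lambda>g z. F g (fst z) (snd z))"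
  shows "recf D (\<lambda>g x. let a = N g x in F g x a)"
proof -
  have "recf D (\<lambda>g x. (\<lambda>g z. F g (fst z) (snd z)) g (x, N g x))"
    by (rule recf_comp[OF assms(2)]) (intro recf_intros assms(1))
  then show ?thesis by simp
qed

section \<open>Logical, arithmetical and list operations\<close>

lemma recf_conj [recf_intros]: "recf D F \<Longrightarrow> recf D G \<Longrightarrow> recf D (\<lambda>g x. F g x \<and> G g x)"
proof -
  assume "recf D F" "recf D G"
  then have "recf D (\<lambda>g x. if F g x then G g x else False)" by (intro recf_intros)
  moreover have "(if a then b else False) \<longleftrightarrow> a \<and> b" for a b by simp
  ultimately show ?thesis by simp
qed

lemma recf_not [recf_intros]: "recf D F \<Longrightarrow> recf D (\<lambda>g x. \<not> F g x)"
proof -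
  assume "recf D F"
  then have "recf D (\<lambda>g x. if F g x then False else True)" by (intro recf_intros)
  moreover have "(if a then False else True) \<longleftrightarrow> \<not> a" for a by simp
  ultimately show ?thesis by simp
qed

lemma recf_plus [recf_intros]: "recf D F \<Longrightarrow> recf D G \<Longrightarrow> recf D (\<lambda>g x. F g x + G g x :: nat)"
proof -
  assume "recf D F" "recf D G"
  then have "recf D (\<lambda>g x. rec_nat (F g x) (\<lambda>i v. Suc v) (G g x))" by (intro recf_intros)
  moreover have "rec_nat a (\<lambda>i v. Suc v) b = a + b" for a b by (induction b) auto
  ultimately show ?thesis by simp
qed

lemma recf_times [recf_intros]: "recf D F \<Longrightarrow> recf D G \<Longrightarrow> recf D (\<lambda>g x. F g x * G g x :: nat)"
proof -
  assume *: "recf D F" "recf D G"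
  have "recf D (\<lambda>g x. rec_nat 0 (\<lambda>i v. v + F g x) (G g x))"
    by (intro recf_intros *(2) recf_comp[OF *(1)])
  moreover have "rec_nat 0 (\<lambda>i v. v + a) b = a * b" for a b :: nat by (induction b) auto
  ultimately show ?thesis by simp
qed

lemma recf_minus [recf_intros]: "recf D F \<Longrightarrow> recf D G \<Longrightarrow> recf D (\<lambda>g x. F g x - G g x :: nat)"
proof -
  assume "recf D F" "recf D G"
  then have "recf D (\<lambda>g x. rec_nat (F g x) (\<lambda>i v. case v of 0 \<Rightarrow> 0 | Suc n \<Rightarrow> n) (G g x))"
    by (intro recf_intros)
  moreover have "rec_nat a (\<lambda>i v. case v of 0 \<Rightarrow> 0 | Suc n \<Rightarrow> n) b = a - b" for a b
    by (induction b) (auto split: nat.split)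
  ultimately show ?thesis by simp
qed

lemma recf_le [recf_intros]:
  "recf D F \<Longrightarrow> recf D G \<Longrightarrow> recf D (\<lambda>g x. F g x \<le> (G g x :: nat))"
proof -
  assume "recf D F" "recf D G"
  then have "recf D (\<lambda>g x. case F g x - G g x of 0 \<Rightarrow> True | Suc n \<Rightarrow> False)"
    by (intro recf_intros)
  moreover have "(case a - b of 0 \<Rightarrow> True | Suc n \<Rightarrow> False) \<longleftrightarrow> a \<le> b" for a b :: nat
    by (auto split: nat.split)
  ultimately show ?thesis by simp
qed

lemma recf_less [recf_intros]:
  "recf D F \<Longrightarrow> recf D G \<Longrightarrow> recf D (\<lambda>g x. F g x < (G g x :: nat))"
  unfolding not_le[symmetric] by (intro recf_intros)

lemma recf_eq [recf_intros]:
  fixes F :: "(nat \<rightharpoonup> nat) \<Rightarrow> 'a::coded \<Rightarrow> 'b::coded"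
  shows "recf D F \<Longrightarrow> recf D G \<Longrightarrow> recf D (\<lambda>g x. F g x = G g x)"
  unfolding enc_eq_iff[of "F g x" "G g x" for g x, symmetric] eq_iff[where 'a = nat]
  by (intro recf_intros)

text \<open>Recursion over lists is replaced by iteration on pairs of remaining list and
  accumulator. The code of the list serves as the number of iterations: it is at least the length,
  and surplus steps leave the empty list alone.\<close>

lemma recf_foldl [recf_intros]:
  assumes "recf D (\<lambda>g z. f g (fst z) (fst (snd z)) (snd (snd z)))" "recf D A" "recf D L"
  shows "recf D (\<lambda>g x. foldl (\<lambda>a y. f g x a y) (A g x) (L g x))"
proof -
  define step where "step g x s = (case fst s of [] \<Rightarrow> s | y # ys \<Rightarrow> (ys, f g x (snd s) y))" for g x s
  have "recf D (\<lambda>g z. (\<lambda>g z. f g (fst z) (fst (snd z)) (snd (snd z))) g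
      (fst (fst z), snd (snd (snd (fst z))), fst (snd z)))"
    by (rule recf_comp[OF assms(1)]) (intro recf_intros)
  then have "recf D (\<lambda>g x. snd (rec_nat (L g x, A g x) (\<lambda>i s. step g x s) (enc (L g x))))"
    unfolding step_def by (intro recf_intros assms(2,3)) simp
  moreover have "rec_nat (l, a) (\<lambda>i s. step g x s) n = (drop n l, foldl (f g x) a (take n l))" for g x l a n
  proof (induction n)
    case (Suc n)
    show ?case
    proof (cases "n < length l")
      case True
      then show ?thesis using Suc
        by (simp add: step_def Cons_nth_drop_Suc[symmetric] take_Suc_conv_app_nth)
    next
      case False
      then show ?thesis using Suc by (simp add: step_def[of g x "([], b)" for b])
    qed
  qed simp
  ultimately show ?thesis by (simp add: length_le_enc)
qed

lemma recf_rev [recf_intros]: "recf D F \<Longrightarrow> recf D (\<lambda>g x. rev (F g x))"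
proof -
  assume "recf D F"
  then have "recf D (\<lambda>g x. foldl (\<lambda>a y. y # a) [] (F g x))" by (intro recf_intros)
  then show ?thesis by (simp add: foldl_conv_fold fold_Cons_rev)
qed

lemma recf_append [recf_intros]:
  "recf D F \<Longrightarrow> recf D G \<Longrightarrow> recf D (\<lambda>g x. F g x @ G g x)"
proof -
  assume "recf D F" "recf D G"
  then have "recf D (\<lambda>g x. foldl (\<lambda>a y. y # a) (G g x) (rev (F g x)))" by (intro recf_intros)
  then show ?thesis by (simp add: foldl_conv_fold fold_Cons_rev)
qed

lemma recf_length [recf_intros]:
  fixes F :: "(nat \<rightharpoonup> nat) \<Rightarrow> 'a::coded \<Rightarrow> 'd::coded list"
  shows "recf D F \<Longrightarrow> recf D (\<lambda>g x. length (F g x))"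
proof -
  assume "recf D F"
  then have "recf D (\<lambda>g x. foldl (\<lambda>a y. Suc a) 0 (F g x))" by (intro recf_intros)
  moreover have "foldl (\<lambda>a y. Suc a) n xs = n + length xs" for n and xs :: "'d list"
    by (induction xs arbitrary: n) auto
  ultimately show ?thesis by simp
qed

lemma recf_drop [recf_intros]:
  fixes F :: "(nat \<rightharpoonup> nat) \<Rightarrow> 'a::coded \<Rightarrow> 'd::coded list"
  shows "recf D N \<Longrightarrow> recf D F \<Longrightarrow> recf D (\<lambda>g x. drop (N g x) (F g x))"
proof -
  assume "recf D N" "recf D F"
  then have "recf D (\<lambda>g x. rec_nat (F g x) (\<lambda>i v. case v of [] \<Rightarrow> [] | y # ys \<Rightarrow> ys) (N g x))"
    by (intro recf_intros)
  moreover have "rec_nat l (\<lambda>i v. case v of [] \<Rightarrow> [] | y # ys \<Rightarrow> ys) n = drop n l" for l :: "'d list" and n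
  proof (induction n)
    case (Suc n)
    have "(case v of [] \<Rightarrow> [] | y # ys \<Rightarrow> ys) = tl v" for v :: "'d list" by (cases v) auto
    then show ?case using Suc by (simp add: drop_Suc tl_drop)
  qed simp
  ultimately show ?thesis by simp
qed

lemma recf_take [recf_intros]:
  fixes F :: "(nat \<rightharpoonup> nat) \<Rightarrow> 'a::coded \<Rightarrow> 'd::coded list"
  shows "recf D N \<Longrightarrow> recf D F \<Longrightarrow> recf D (\<lambda>g x. take (N g x) (F g x))"
proof -
  assume "recf D N" "recf D F"
  then have "recf D (\<lambda>g x. rev (drop (length (F g x) - N g x) (rev (F g x))))"
    by (intro recf_intros)
  moreover have "rev (drop (length l - n) (rev l)) = take n l" for l :: "'d list" and n
    by (cases "n \<le> length l") (simp_all add: drop_rev)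
  ultimately show ?thesis by simp
qed

lemma recf_nth_default [recf_intros]:
  fixes F :: "(nat \<rightharpoonup> nat) \<Rightarrow> 'a::coded \<Rightarrow> 'd::coded list"
  shows "recf D C \<Longrightarrow> recf D N \<Longrightarrow> recf D F \<Longrightarrow> recf D (\<lambda>g x. nth_default (C g x) (F g x) (N g x))"
proof -
  assume *: "recf D C" "recf D N" "recf D F"
  have "recf D (\<lambda>g x. case drop (N g x) (F g x) of [] \<Rightarrow> C g x | y # ys \<Rightarrow> y)"
    by (intro recf_intros *)
  moreover have "(case drop n l of [] \<Rightarrow> c | y # ys \<Rightarrow> y) = nth_default c l n" for c :: 'd and l n
    by (cases "n < length l") (auto simp: nth_default_def Cons_nth_drop_Suc[symmetric])
  ultimately show ?thesis by simp
qed

lemma recf_map_upt [recf_intros]: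
  assumes "recf D (\<lambda>g z. F g (fst z) (snd z))" "recf D N"
  shows "recf D (\<lambda>g x. map (\<lambda>i. F g x i) [0..<N g x])"
proof -
  have "recf D (\<lambda>g z. (\<lambda>g z. F g (fst z) (snd z)) g (fst z, fst (snd z)))"
    by (rule recf_comp[OF assms(1)]) (intro recf_intros)
  then have "recf D (\<lambda>g x. rec_nat [] (\<lambda>i v. v @ [F g x i]) (N g x))"
    by (intro recf_intros assms(2)) simp
  moreover have "rec_nat [] (\<lambda>i v. v @ [f i]) n = map f [0..<n]" for f :: "nat \<Rightarrow> 'b" and n
    by (induction n) auto
  ultimately show ?thesis by simp
qed

lemma recf_div_mod:
  assumes "recf D F" "k > 0"
  shows "recf D (\<lambda>g x. (F g x div k, F g x mod k :: nat))"
proof -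
  have "recf D (\<lambda>g x. rec_nat (0, 0) (\<lambda>i v. if Suc (snd v) = k then (Suc (fst v), 0) else (fst v, Suc (snd v))) (F g x))"
    by (intro recf_intros assms)
  moreover have "rec_nat (0, 0) (\<lambda>i v. if Suc (snd v) = k then (Suc (fst v), 0) else (fst v, Suc (snd v))) n = (n div k, n mod k)" for n
    by (induction n) (auto simp: mod_Suc div_Suc)
  ultimately show ?thesis by simp
qed

lemma recf_div [recf_intros]: "recf D F \<Longrightarrow> k > 0 \<Longrightarrow> recf D (\<lambda>g x. F g x div k :: nat)"
  using recf_fst[OF recf_div_mod] by auto

lemma recf_mod [recf_intros]: "recf D F \<Longrightarrow> k > 0 \<Longrightarrow> recf D (\<lambda>g x. F g x mod k :: nat)"
  using recf_snd[OF recf_div_mod] by auto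

lemma recf_Map_empty: "recf {Map.empty} (\<lambda>_. F) \<Longrightarrow> recf D (\<lambda>_. F)"
  unfolding recf_def using ev_Map_empty by blast

section \<open>A universal step-bounded interpreter\<close>

definition orc :: "nat list \<Rightarrow> nat \<rightharpoonup> nat"
  where "orc \<sigma> k = (if k < length \<sigma> then Some (\<sigma> ! k) else None)"

lemma orc_Nil [simp]: "orc [] = Map.empty"
  by (rule ext) (simp add: orc_def)

lemma recf_orc [recf_intros]:
  assumes "recf D S" "recf D K"
  shows "recf D (\<lambda>g x. orc (S g x) (K g x))"
proof -
  have "recf D (\<lambda>g x. case drop (K g x) (S g x) of [] \<Rightarrow> None | y # ys \<Rightarrow> Some y)"
    by (intro recf_intros assms)
  moreover have "(case drop k \<sigma> of [] \<Rightarrow> None | y # ys \<Rightarrow> Some y) = orc \<sigma> k" for k \<sigma>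
    by (cases "k < length \<sigma>") (auto simp: orc_def Cons_nth_drop_Suc[symmetric])
  ultimately show ?thesis by simp
qed

lemma run_orc_init_seg: "t \<le> n \<Longrightarrow> run (orc (x \<restriction> n)) t p k = run (Some \<circ> x) t p k"
  by (rule run_cong) (simp add: orc_def)

lemma run_input_bound: "t \<le> x \<Longrightarrow> run g t p x = None"
  by (cases t; cases p) auto

text \<open>This and the next lemma fix the order in which the table of runs is filled. A recursive
  call of \<open>run\<close> keeps the stage and passes to a smaller program code, or keeps the
  program and lowers the stage; either way the code of the pair of stage and program
  decreases.\<close>

lemma prod_encode_less_snd: "b < b' \<Longrightarrow> prod_encode (a, b) < prod_encode (a, b')"
proof -
  have "mono triangle" by (simp add: mono_iff_le_Suc)
  moreover assume "b < b'"
  ultimately have "triangle (Suc (a + b)) \<le> triangle (a + b')" by (intro monoD[of triangle]) auto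
  then show ?thesis by (simp add: prod_encode_def)
qed

lemma prod_encode_less_Suc: "prod_encode (a, b) < prod_encode (Suc a, b)"
  by (simp add: prod_encode_def)

definition look :: "nat option list list \<Rightarrow> nat \<Rightarrow> nat \<Rightarrow> nat \<Rightarrow> nat option"
  where "look h t a x = nth_default None (nth_default [] h (prod_encode (t, a))) x"

text \<open>
  One unfolding of \<open>run\<close> that looks up the results of recursive calls in the table \<open>h\<close>. Entry
  \<open>prod_encode (t, e)\<close> of \<open>h\<close> lists the results of program \<open>e\<close> at stage \<open>t\<close> on the inputs below \<open>t\<close>; on
  all other inputs there is none.
\<close>

definition run_step :: "nat list \<Rightarrow> nat option list list \<Rightarrow> nat \<Rightarrow> nat \<Rightarrow> nat \<Rightarrow> nat option"
  where "run_step \<sigma> h t e x = (case t of 0 \<Rightarrow> None | Suc s \<Rightarrow>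
    if x \<le> s then
      if e = 0 then Some 0 else if e = 1 then Some (Suc x)
      else if e = 2 then Some (fst (prod_decode x))
      else if e = 3 then Some (snd (prod_decode x)) else if e = 4 then orc \<sigma> x
      else let k = (e - 5) div 4; a = fst (prod_decode k); b = snd (prod_decode k);
               y = fst (prod_decode x); n = snd (prod_decode x) in
        if (e - 5) mod 4 = 0 then (case look h t a x of None \<Rightarrow> None | Some u \<Rightarrow>
          (case look h t b x of None \<Rightarrow> None | Some v \<Rightarrow> Some (prod_encode (u, v))))
        else if (e - 5) mod 4 = 1 then (case look h t b x of None \<Rightarrow> None | Some u \<Rightarrow> look h t a u)
        else if (e - 5) mod 4 = 2 then (case n of 0 \<Rightarrow> look h t a y
          | Suc i \<Rightarrow> (case look h s e (prod_encode (y, i)) of None \<Rightarrow> None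
              | Some v \<Rightarrow> look h t b (prod_encode (y, prod_encode (i, v)))))
        else (case look h t k x of None \<Rightarrow> None
          | Some v \<Rightarrow> if v = 0 then Some n else look h s e (prod_encode (y, Suc n)))
    else None)"

lemma run_step_correct:
  assumes look: "\<And>t' a x. prod_encode (t', a) < prod_encode (t, e) \<Longrightarrow>
    look h t' a x = run (orc \<sigma>) t' (prog_of a) x"
  shows "run_step \<sigma> h t e x = run (orc \<sigma>) t (prog_of e) x"
proof (cases t)
  case (Suc s)
  define k where "k = (e - 5) div 4"
  define a where "a = fst (prod_decode k)"
  define b where "b = snd (prod_decode k)"
  have prev: "look h s e z = run (orc \<sigma>) s (prog_of e) z" for z
    by (rule look) (simp add: Suc prod_encode_less_Suc)
  have sub: "look h (Suc s) c z = run (orc \<sigma>) (Suc s) (prog_of c) z" if "c < e" for c z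
    using look[of t c z] that by (simp add: Suc prod_encode_less_snd)
  show ?thesis
  proof (cases "e < 5 \<or> \<not> x \<le> s")
    case True
    then consider "\<not> x \<le> s" | "x \<le> s" "e = 0" | "x \<le> s" "e = 1" | "x \<le> s" "e = 2" | "x \<le> s" "e = 3"
      | "x \<le> s" "e = 4" by linarith
    then show ?thesis
    proof cases
      case 1
      then show ?thesis by (simp add: Suc run_step_def run_input_bound)
    qed (simp_all add: Suc run_step_def prog_of.simps)
  next
    case False
    then have e: "e \<noteq> 0" "e \<noteq> 1" "e \<noteq> 2" "e \<noteq> 3" "e \<noteq> 4" and x: "x \<le> s" and k: "k < e"
      unfolding k_def by auto
    have ab: "a < e" "b < e"
      using k fst_prod_decode_le[of k] snd_prod_decode_le[of k] unfolding a_def b_def by auto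
    have p: "prog_of e = (if (e - 5) mod 4 = 0 then Pair (prog_of a) (prog_of b)
       else if (e - 5) mod 4 = 1 then Comp (prog_of a) (prog_of b)
       else if (e - 5) mod 4 = 2 then Prec (prog_of a) (prog_of b)
       else Search (prog_of k))"
      using e by (subst prog_of.simps) (simp add: Let_def k_def a_def b_def)
    obtain y n where yn: "prod_decode x = (y, n)" by force
    have "run_step \<sigma> h t e x =
       (if (e - 5) mod 4 = 0 then (case look h t a x of None \<Rightarrow> None | Some u \<Rightarrow>
          (case look h t b x of None \<Rightarrow> None | Some v \<Rightarrow> Some (prod_encode (u, v))))
        else if (e - 5) mod 4 = 1 then (case look h t b x of None \<Rightarrow> None | Some u \<Rightarrow> look h t a u)
        else if (e - 5) mod 4 = 2 then (case n of 0 \<Rightarrow> look h t a y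
          | Suc i \<Rightarrow> (case look h s e (prod_encode (y, i)) of None \<Rightarrow> None
              | Some v \<Rightarrow> look h t b (prod_encode (y, prod_encode (i, v)))))
        else (case look h t k x of None \<Rightarrow> None
          | Some v \<Rightarrow> if v = 0 then Some n else look h s e (prod_encode (y, Suc n))))"
      using e x by (simp add: run_step_def Suc Let_def k_def a_def b_def yn cong: option.case_cong nat.case_cong)
    also have "\<dots> = run (orc \<sigma>) t (prog_of e) x"
    proof -
      consider "(e - 5) mod 4 = 0" | "(e - 5) mod 4 = 1" | "(e - 5) mod 4 = 2" | "(e - 5) mod 4 = 3"
        by linarith
      then show ?thesis
      proof cases
        case 1
        then show ?thesis using x p by (simp add: Suc sub[OF ab(1)] sub[OF ab(2)] cong: option.case_cong nat.case_cong)
      next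
        case 2
        then show ?thesis using x p by (simp add: Suc sub[OF ab(1)] sub[OF ab(2)] cong: option.case_cong nat.case_cong)
      next
        case 3
        then show ?thesis using x p by (simp add: Suc sub[OF ab(1)] sub[OF ab(2)] prev yn cong: option.case_cong nat.case_cong)
      next
        case 4
        then show ?thesis using x p by (simp add: Suc sub[OF k] prev yn cong: option.case_cong if_cong)
      qed
    qed
    finally show ?thesis .
  qed
qed (simp add: run_step_def)

definition run_row :: "nat list \<Rightarrow> nat option list list \<Rightarrow> nat \<Rightarrow> nat option list"
  where "run_row \<sigma> h n =
    map (\<lambda>x. run_step \<sigma> h (fst (prod_decode n)) (snd (prod_decode n)) x) [0..<fst (prod_decode n)]"

text \<open>Course-of-values recursion along the codes of pairs of stage and program, made primitive
  recursive by carrying the whole history.\<close>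

definition run_table :: "nat list \<Rightarrow> nat \<Rightarrow> nat option list list"
  where "run_table \<sigma> n = rec_nat [] (\<lambda>i h. h @ [run_row \<sigma> h i]) n"

lemma look_run_table:
  "prod_encode (t, e) < n \<Longrightarrow> look (run_table \<sigma> n) t e x = run (orc \<sigma>) t (prog_of e) x"
proof (induction n arbitrary: t e x)
  case (Suc n)
  have len: "length (run_table \<sigma> m) = m" for m
    by (induction m) (simp_all add: run_table_def)
  have table: "run_table \<sigma> (Suc n) = run_table \<sigma> n @ [run_row \<sigma> (run_table \<sigma> n) n]"
    by (simp add: run_table_def)
  show ?case
  proof (cases "prod_encode (t, e) < n")
    case True
    then have "look (run_table \<sigma> (Suc n)) t e x = look (run_table \<sigma> n) t e x"
      by (simp add: look_def table nth_default_append len nth_default_nth)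
    then show ?thesis using Suc.IH[OF True] by simp
  next
    case False
    then have n: "n = prod_encode (t, e)" using Suc.prems by simp
    have "look (run_table \<sigma> (Suc n)) t e x = nth_default None (run_row \<sigma> (run_table \<sigma> n) n) x"
      by (simp add: look_def table nth_default_append len n[symmetric])
    also have "\<dots> = run (orc \<sigma>) t (prog_of e) x"
    proof (cases "x < t")
      case True
      have "run_step \<sigma> (run_table \<sigma> n) t e x = run (orc \<sigma>) t (prog_of e) x"
        by (rule run_step_correct) (use Suc.IH n in auto)
      then show ?thesis using True n by (simp add: run_row_def nth_default_def)
    next
      case False
      then show ?thesis using n by (simp add: run_row_def nth_default_def run_input_bound)
    qed
    finally show ?thesis .
  qed
qed simp

lemma recf_look [recf_intros]:
  assumes "recf D H" "recf D T" "recf D E" "recf D X"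
  shows "recf D (\<lambda>g x. look (H g x) (T g x) (E g x) (X g x))"
  unfolding look_def by (intro recf_intros assms)

lemma recf_run_step [recf_intros]:
  assumes "recf D S" "recf D H" "recf D T" "recf D E" "recf D X"
  shows "recf D (\<lambda>g x. run_step (S g x) (H g x) (T g x) (E g x) (X g x))"
proof -
  have "recf D (\<lambda>g z. run_step (fst z) (fst (snd z)) (fst (snd (snd z))) (fst (snd (snd (snd z))))
      (snd (snd (snd (snd z)))))"
    unfolding run_step_def by (intro recf_intros) simp_all
  from recf_comp[OF this, of "\<lambda>g x. (S g x, H g x, T g x, E g x, X g x)"]
  show ?thesis by (simp add: recf_Pair assms)
qed

lemma recf_run_row [recf_intros]:
  assumes "recf D S" "recf D H" "recf D N"
  shows "recf D (\<lambda>g x. run_row (S g x) (H g x) (N g x))"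
proof -
  have "recf D (\<lambda>g z. run_row (fst z) (fst (snd z)) (snd (snd z)))"
    unfolding run_row_def by (intro recf_intros)
  from recf_comp[OF this, of "\<lambda>g x. (S g x, H g x, N g x)"]
  show ?thesis by (simp add: recf_Pair assms)
qed

lemma recf_run [recf_intros]:
  assumes "recf D S" "recf D T" "recf D E" "recf D X"
  shows "recf D (\<lambda>g x. run (orc (S g x)) (T g x) (prog_of (E g x)) (X g x))"
proof -
  have "recf D (\<lambda>g z. run_table (fst z) (snd z))"
    unfolding run_table_def by (intro recf_intros)
  from recf_comp[OF this, of "\<lambda>g x. (S g x, Suc (prod_encode (T g x, E g x)))"]
  have "recf D (\<lambda>g x. look (run_table (S g x) (Suc (prod_encode (T g x, E g x)))) (T g x) (E g x) (X g x))"
    by (intro recf_intros assms) (simp add: recf_intros assms)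
  then show ?thesis by (simp add: look_run_table)
qed

section \<open>Computability of learners\<close>

text \<open>The longest initial segment on which the program halts is found by scanning upwards and
  overwriting the answer at every halt. Writing the empty oracle as \<open>orc []\<close> brings the
  universal interpreter to bear.\<close>

lemma Psi_rec:
  "Psi e \<sigma> = rec_nat (fst (prod_decode e))
    (\<lambda>n v. case run (orc []) (length \<sigma>) (prog_of (snd (prod_decode e))) (list_encode (take n \<sigma>)) of
        None \<Rightarrow> v | Some w \<Rightarrow> w) (Suc (length \<sigma>))"
proof -
  obtain c p where cp: "prod_decode e = (c, p)" by force
  define val where "val n = run Map.empty (length \<sigma>) (prog_of p) (list_encode (take n \<sigma>))" for n
  define H where "H m = {n. n < m \<and> val n \<noteq> None}" for m
  have "rec_nat c (\<lambda>n v. case val n of None \<Rightarrow> v | Some w \<Rightarrow> w) m =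
      (if H m = {} then c else the (val (Max (H m))))" for m
  proof (induction m)
    case 0
    show ?case by (simp add: H_def)
  next
    case (Suc m)
    show ?case
    proof (cases "val m")
      case None
      then have "H (Suc m) = H m" by (auto simp: H_def less_Suc_eq)
      then show ?thesis using Suc None by simp
    next
      case (Some w)
      then have H: "H (Suc m) = insert m (H m)" by (auto simp: H_def less_Suc_eq)
      have "Max (H (Suc m)) = m" unfolding H by (rule Max_eqI) (auto simp: H_def)
      then show ?thesis using Some H by simp
    qed
  qed
  moreover have "Psi e \<sigma> = (if H (Suc (length \<sigma>)) = {} then c
      else the (val (Max (H (Suc (length \<sigma>))))))"
    unfolding Psi_def cp Let_def H_def val_def prod.case less_Suc_eq_le ..
  ultimately show ?thesis unfolding val_def by (simp only: cp fst_conv snd_conv orc_Nil)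
qed

lemma recf_Psi [recf_intros]:
  assumes "recf D E" "recf D S"
  shows "recf D (\<lambda>g x. Psi (E g x) (S g x))"
proof -
  have "recf D (\<lambda>g z. Psi (fst z) (snd z))"
    unfolding Psi_rec by (intro recf_intros)
  from recf_comp[OF this, of "\<lambda>g x. (E g x, S g x)"]
  show ?thesis by (simp add: recf_Pair assms)
qed

section \<open>Indices\<close>

text \<open>Injectivity of \<open>d\<close> is what later gives different tapes different learners,
  so that a team has exactly the required cardinality.\<close>

lemma smn:
  obtains d where "inj d" "\<And>D. recf D (\<lambda>_. d)"
    "\<And>g i x y. ev g q (prod_encode (i, x)) y \<Longrightarrow> ev g (prog_of (d i)) x y"
proof -
  obtain a where a: "prog_of a = q" using surj_prog_of by blast
  obtain b where b: "prog_of b = id_prog" using surj_prog_of by blast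
  \<comment> \<open>In the numbering \<open>prog_of\<close>, codes of the form
    \<open>5 + 4 * prod_encode (u, v)\<close> stand for \<open>Pair\<close>, those of the form
    \<open>6 + 4 * prod_encode (u, v)\<close> for \<open>Comp\<close>, and \<open>1\<close> stands
    for \<open>Succ\<close>. So \<open>k i\<close> codes \<open>const_prog i\<close>, and
    \<open>d i\<close> codes \<open>q\<close> applied to the pair of \<open>i\<close> and the
    input.\<close>
  define k where "k i = rec_nat 0 (\<lambda>_ v. 6 + 4 * prod_encode (1, v)) i" for i
  define d where "d i = 6 + 4 * prod_encode (a, 5 + 4 * prod_encode (k i, b))" for i
  have k: "prog_of (k i) = const_prog i" for i
  proof (induction i)
    case (Suc i)
    have "prog_of (k (Suc i)) = Comp (prog_of 1) (prog_of (k i))"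
      by (subst prog_of.simps) (simp add: k_def Let_def div_mod_aux)
    then show ?case using Suc prog_of.simps[of 1] by simp
  qed (simp add: k_def prog_of.simps)
  have "prog_of (5 + 4 * prod_encode (k i, b)) = Pair (const_prog i) id_prog" for i
    by (subst prog_of.simps) (simp add: Let_def k b)
  then have d: "prog_of (d i) = Comp q (Pair (const_prog i) id_prog)" for i
    by (subst prog_of.simps) (simp add: d_def Let_def div_mod_aux a)
  show thesis
  proof (rule that)
    have "size (const_prog i) = i" for i
      by (induction i) auto
    then have "inj const_prog" by (metis injI)
    then show "inj d" using d by (metis injI injD prog.inject(1,2))
    show "recf D (\<lambda>_. d)" for D
      unfolding d_def k_def by (intro recf_intros)
    show "ev g (prog_of (d i)) x y" if "ev g q (prod_encode (i, x)) y" for g i x y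
      unfolding d by (rule ev_Comp[OF ev_Pair[OF ev_const_prog ev_id_prog] that])
  qed
qed

text \<open>The output is \<open>F\<close> at some witness \<open>r\<close> of \<open>T\<close>, not
  at the given \<open>s\<close>; an application has to make \<open>F\<close> correct at every
  witness.\<close>

lemma recf_obtain_search_index:
  fixes T :: "(nat \<rightharpoonup> nat) \<Rightarrow> nat \<Rightarrow> nat \<Rightarrow> nat \<Rightarrow> bool"
  assumes T: "recf D (\<lambda>g z. T g (fst (fst z)) (snd (fst z)) (snd z))"
    and F: "recf D (\<lambda>g z. F g (fst (fst z)) (snd (fst z)) (snd z))"
  obtains d where "inj d" "\<And>D. recf D (\<lambda>_. d)"
    "\<And>g i n s. g \<in> D \<Longrightarrow> T g i n s \<Longrightarrow> \<exists>r. T g i n r \<and> computes g (d i) n (F g i n r)"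
proof -
  have "recf D (\<lambda>g z. if T g (fst (fst z)) (snd (fst z)) (snd z) then 0 else 1 :: nat)"
    by (intro recf_intros T)
  then obtain p where p: "\<And>g z. g \<in> D \<Longrightarrow>
      ev g p (enc z) (if T g (fst (fst z)) (snd (fst z)) (snd z) then 0 else 1)"
    unfolding recf_def enc_nat_def by blast
  obtain q where q: "\<And>g z. g \<in> D \<Longrightarrow> ev g q (enc z) (F g (fst (fst z)) (snd (fst z)) (snd z))"
    using F unfolding recf_def enc_nat_def by blast
  define w where "w = Comp q (Pair id_prog (Comp (Search p) (Pair id_prog Zero)))"
  have w: "\<exists>r. T g i n r \<and> ev g w (prod_encode (i, n)) (F g i n r)" if g: "g \<in> D" and s: "T g i n s" for g i n s
  proof -
    let ?x = "prod_encode (i, n)"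
    have "ev g p (prod_encode (?x, t)) (if T g i n t then 0 else 1)" for t
      using p[OF g, of "((i, n), t)"] by simp
    from ev_Search[of g p ?x "\<lambda>t. if T g i n t then 0 else 1" s, OF this] s
    have "\<exists>r. (if T g i n r then 0 else 1 :: nat) = 0 \<and> ev g (Search p) (prod_encode (?x, 0)) r"
      by meson
    then obtain r where r: "T g i n r" "ev g (Search p) (prod_encode (?x, 0)) r"
      by (metis zero_neq_one)
    have "ev g q (prod_encode (?x, r)) (F g i n r)"
      using q[OF g, of "((i, n), r)"] by simp
    then have "ev g w ?x (F g i n r)" unfolding w_def
      by (intro ev_Comp[OF ev_Pair[OF ev_id_prog ev_Comp[OF ev_Pair[OF ev_id_prog ev_Zero] r(2)]]])
    then show ?thesis using r(1) by blast
  qed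
  show thesis
  proof (rule smn[of w])
    fix d assume d: "inj d" "\<And>D. recf D (\<lambda>_. d)"
      "\<And>g i x y. ev g w (prod_encode (i, x)) y \<Longrightarrow> ev g (prog_of (d i)) x y"
    show thesis
    proof (rule that[OF d(1,2)])
      fix g i n s assume "g \<in> D" "T g i n s"
      from w[OF this] d(3) show "\<exists>r. T g i n r \<and> computes g (d i) n (F g i n r)"
        unfolding computes_iff_ev by meson
    qed
  qed
qed

text \<open>The learner with index \<open>e i\<close> lags behind \<open>L i\<close>; \<open>r n\<close> is the input it has processed at stage \<open>n\<close>.\<close>

lemma recf_obtain_learner_index:
  fixes L :: "nat \<Rightarrow> nat list \<Rightarrow> nat"
  assumes "recf {Map.empty} (\<lambda>_ z. L (fst z) (snd z))"
  obtains e where "inj e"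
    "\<And>i g. \<exists>r. mono r \<and> (\<forall>N. \<exists>n. N \<le> r n) \<and> (\<forall>n. Psi (e i) (g \<restriction> n) = L i (g \<restriction> r n))"
proof -
  obtain q where q: "\<And>i \<sigma>. ev Map.empty q (prod_encode (i, list_encode \<sigma>)) (L i \<sigma>)"
    using assms unfolding recf_def by (auto simp: enc_nat_list)
  obtain d where d: "inj d" and ev: "\<And>i \<sigma>. ev Map.empty (prog_of (d i)) (list_encode \<sigma>) (L i \<sigma>)"
    using smn[of q] q by metis
  \<comment> \<open>The first component is the answer of \<open>Psi\<close> as long as no
    computation has halted. Choosing \<open>L i []\<close> makes it the answer on the segment of
    length 0, so even the start is covered by a lag.\<close>
  define e where "e i = prod_encode (L i [], d i)" for i
  show thesis
  proof (rule that)
    show "inj e" using d by (auto simp: inj_def e_def)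
    fix i g
    define H where "H n = {k. k \<le> n \<and> run Map.empty n (prog_of (d i)) (list_encode (g \<restriction> k)) \<noteq> None}" for n
    define r where "r n = (if H n = {} then 0 else Max (H n))" for n
    have fin: "finite (H n)" for n by (simp add: H_def)
    have H: "H n \<subseteq> H m" if "n \<le> m" for n m
      using that run_mono[OF _ that] by (auto simp: H_def)
    have "mono r"
    proof (rule monoI)
      fix n m :: nat assume "n \<le> m"
      then show "r n \<le> r m" using Max_mono[OF H _ fin, of n m] H[of n m] by (auto simp: r_def)
    qed
    moreover have "\<exists>n. N \<le> r n" for N
    proof -
      obtain t where t: "run Map.empty t (prog_of (d i)) (list_encode (g \<restriction> N)) = Some (L i (g \<restriction> N))"
        using ev[of i "g \<restriction> N"] unfolding ev_def by blast
      then have "N \<in> H (max t N)" using run_mono[OF t, of "max t N"] by (simp add: H_def)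
      then have "N \<le> r (max t N)" using fin by (auto simp: r_def)
      then show ?thesis by blast
    qed
    moreover have "Psi (e i) (g \<restriction> n) = L i (g \<restriction> r n)" for n
    proof (cases "H n = {}")
      case True
      then show ?thesis unfolding Psi_def e_def r_def H_def by (auto simp: take_map)
    next
      case False
      have *: "{k. k \<le> n \<and> run Map.empty n (prog_of (d i)) (list_encode (take k (g \<restriction> n))) \<noteq> None} = H n"
        by (auto simp: H_def take_map)
      have r: "r n \<in> H n" using False fin by (simp add: r_def)
      then obtain v where v: "run Map.empty n (prog_of (d i)) (list_encode (g \<restriction> r n)) = Some v" "r n \<le> n"
        by (auto simp: H_def)
      then have "ev Map.empty (prog_of (d i)) (list_encode (g \<restriction> r n)) v" unfolding ev_def by blast
      then have "v = L i (g \<restriction> r n)" using ev by (rule ev_unique)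
      moreover have "Psi (e i) (g \<restriction> n) =
          the (run Map.empty n (prog_of (d i)) (list_encode (take (r n) (g \<restriction> n))))"
        using False unfolding r_def
        by (simp only: Psi_def e_def Let_def prod_encode_inverse prod.case length_map length_upt
            diff_zero * if_False)
      then have "Psi (e i) (g \<restriction> n) = v" using v by (simp add: take_map)
      ultimately show ?thesis by simp
    qed
    ultimately show "\<exists>r. mono r \<and> (\<forall>N. \<exists>n. N \<le> r n) \<and> (\<forall>n. Psi (e i) (g \<restriction> n) = L i (g \<restriction> r n))"
      by (intro exI[of _ r] conjI allI)
  qed
qed

lemma computable_strategy_iff_recf:
  "computable_strategy X \<psi> \<longleftrightarrow> strategy X \<psi> \<and> recf {Map.empty} (\<lambda>_. \<psi>)"
proof -
  have "computable (\<lambda>s. list_encode (map sym_encode (\<psi> (list_decode s)))) \<longleftrightarrow>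
      (\<exists>p. \<forall>s. ev Map.empty p s (enc (\<psi> (list_decode s))))"
    unfolding computable_def computes_iff_ev enc_sym_list by (metis surj_prog_of)
  also have "\<dots> \<longleftrightarrow> recf {Map.empty} (\<lambda>_. \<psi>)"
    unfolding recf_def enc_nat_list by (metis list_decode_inverse list_encode_inverse singletonD singletonI)
  finally show ?thesis by (simp add: computable_strategy_def)
qed

section \<open>Plays\<close>

lemma recf_same_code:
  assumes "recf D F'" "\<And>g x. enc (F g x) = enc (F' g x)"
  shows "recf D F"
  using assms unfolding recf_def by metis

lemma recf_Num [recf_intros]: "recf D F \<Longrightarrow> recf D (\<lambda>g x. Num (F g x))"
  by (rule recf_same_code[where F' = "\<lambda>g x. 2 + 2 * F g x"], intro recf_intros) (simp_all add: enc_sym_def)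

lemma recf_Move [recf_intros]: "recf D F \<Longrightarrow> recf D (\<lambda>g x. Move (F g x))"
  by (rule recf_same_code[where F' = "\<lambda>g x. 3 + 2 * F g x"], intro recf_intros) (simp_all add: enc_sym_def)

text \<open>Here the arguments for \<open>Num\<close> and \<open>Move\<close> may be extracted
  whatever the symbol is: they are numbers, and every number is a code.\<close>

lemma recf_case_sym [recf_intros]:
  assumes "recf D S" "recf D (\<lambda>g z. F g (fst z) (snd z))" "recf D A" "recf D C"
    "recf D (\<lambda>g z. G g (fst z) (snd z))"
  shows "recf D (\<lambda>g x. case S g x of Num v \<Rightarrow> F g x v | Pass \<Rightarrow> A g x | Back \<Rightarrow> C g x | Move i \<Rightarrow> G g x i)"
proof -
  have "recf D (\<lambda>g x. (\<lambda>g z. F g (fst z) (snd z)) g (x, (enc (S g x) - 2) div 2))"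
    by (rule recf_comp[OF assms(2)]) (intro recf_intros assms, simp)
  moreover have "recf D (\<lambda>g x. (\<lambda>g z. G g (fst z) (snd z)) g (x, (enc (S g x) - 3) div 2))"
    by (rule recf_comp[OF assms(5)]) (intro recf_intros assms, simp)
  ultimately have "recf D (\<lambda>g x. if enc (S g x) = 0 then A g x else if enc (S g x) = 1 then C g x
      else if enc (S g x) mod 2 = 0 then F g x ((enc (S g x) - 2) div 2)
      else G g x ((enc (S g x) - 3) div 2))"
    by (intro recf_intros assms) simp_all
  moreover have "(if enc (S g x) = 0 then A g x else if enc (S g x) = 1 then C g x
      else if enc (S g x) mod 2 = 0 then F g x ((enc (S g x) - 2) div 2)
      else G g x ((enc (S g x) - 3) div 2)) =
      (case S g x of Num v \<Rightarrow> F g x v | Pass \<Rightarrow> A g x | Back \<Rightarrow> C g x | Move i \<Rightarrow> G g x i)" for g x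
    by (cases "S g x") (simp_all add: enc_sym_def)
  ultimately show ?thesis by simp
qed

text \<open>The current tape, the content of tape \<open>i\<close>, and the number of \<open>Back\<close>s on tape \<open>i\<close>.\<close>

definition state_step :: "nat \<Rightarrow> nat \<times> nat list \<times> nat \<Rightarrow> sym \<Rightarrow> nat \<times> nat list \<times> nat"
  where "state_step i w s = (case s of
      Num v \<Rightarrow> if fst w = i then (fst w, fst (snd w) @ [v], snd (snd w)) else w
    | Pass \<Rightarrow> w
    | Back \<Rightarrow> if fst w = i then (fst w, [], Suc (snd (snd w))) else w
    | Move j \<Rightarrow> (j, snd w))"

definition state_of :: "nat \<Rightarrow> sym list \<Rightarrow> nat \<times> nat list \<times> nat"
  where "state_of i ys = foldl (\<lambda>w s. state_step i w s) (0, [], 0) ys"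

abbreviation "tape_of ys \<equiv> fst (state_of 0 ys)"
abbreviation "content_of i ys \<equiv> fst (snd (state_of i ys))"
abbreviation "backs_of i ys \<equiv> snd (snd (state_of i ys))"

lemma recf_state_of [recf_intros]:
  assumes "recf D I" "recf D Y"
  shows "recf D (\<lambda>g x. state_of (I g x) (Y g x))"
proof -
  have "recf D (\<lambda>g z. state_of (fst z) (snd z))"
    unfolding state_of_def state_step_def by (intro recf_intros)
  from recf_comp[OF this, of "\<lambda>g x. (I g x, Y g x)"]
  show ?thesis by (simp add: recf_Pair assms)
qed

definition backs :: "nat \<Rightarrow> (nat \<Rightarrow> sym) \<Rightarrow> nat set"
  where "backs i y = {n. y n = Back \<and> tape y n = i}"

lemma card_Int_lessThan_Suc:
  "card (A \<inter> {..<Suc n}) = (if n \<in> A then Suc (card (A \<inter> {..<n})) else card (A \<inter> {..<n}))"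
proof (cases "n \<in> A")
  case True
  then have "A \<inter> {..<Suc n} = insert n (A \<inter> {..<n})" by auto
  then show ?thesis using True by simp
next
  case False
  then have "A \<inter> {..<Suc n} = A \<inter> {..<n}" by (auto simp: less_Suc_eq)
  then show ?thesis using False by simp
qed

lemma state_of_init_seg: "state_of i (y \<restriction> n) = (tape y n, content i y n, card (backs i y \<inter> {..<n}))"
proof (induction n)
  case (Suc n)
  have "state_of i (y \<restriction> Suc n) = state_step i (state_of i (y \<restriction> n)) (y n)"
    by (simp add: state_of_def)
  also have "\<dots> = (tape y (Suc n), content i y (Suc n), card (backs i y \<inter> {..<Suc n}))"
    unfolding Suc card_Int_lessThan_Suc by (auto simp: state_step_def backs_def split: sym.split)
  finally show ?case .
qed (simp add: state_of_def)

lemma prefix_content: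
  assumes "n \<le> n'" "backs i y \<inter> {n..<n'} = {}"
  shows "prefix (content i y n) (content i y n')"
  using assms
proof (induction rule: dec_induct)
  case (step k)
  have "k \<notin> backs i y" using step.prems step.hyps by auto
  then have "prefix (content i y k) (content i y (Suc k))"
    by (auto simp: backs_def split: sym.split)
  moreover have "prefix (content i y n) (content i y k)"
    using step.prems by (intro step.IH) (auto simp: disjoint_iff)
  ultimately show ?case by (rule prefix_order.trans[rotated])
qed simp

text \<open>Each \<open>Back\<close> on tape \<open>i\<close> leaves it empty, whereas a content
  with an infinite limit is eventually nonempty.\<close>

lemma content_lim_finite_backs:
  assumes "content_lim i y h"
  shows "finite (backs i y)"
proof -
  from assms obtain N where N: "\<And>n. n \<ge> N \<Longrightarrow> 0 < length (content i y n)"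
    unfolding content_lim_def MOST_nat_le by blast
  have "n < N" if "n \<in> backs i y" for n
  proof (rule ccontr)
    assume "\<not> n < N"
    then have "0 < length (content i y (Suc n))" using N[of "Suc n"] by simp
    then show False using that by (simp add: backs_def)
  qed
  then show ?thesis by (rule_tac finite_subset[of _ "{..<N}"]) auto
qed

text \<open>Only a number written on tape \<open>i\<close> lengthens its content; if this stopped
  happening, the length would stay bounded.\<close>

lemma content_lim_infinite_Num:
  assumes "content_lim i y h"
  shows "\<exists>\<^sub>\<infinity>n. y n \<in> range Num \<and> tape y n = i"
proof (rule ccontr)
  assume "\<not> ?thesis"
  then obtain N where N: "\<And>n. n \<ge> N \<Longrightarrow> \<not> (y n \<in> range Num \<and> tape y n = i)"
    unfolding not_INFM MOST_nat_le by blast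
  have "length (content i y n) \<le> length (content i y N)" if "n \<ge> N" for n
    using that
  proof (induction rule: dec_induct)
    case (step n)
    then show ?case using N[of n] by (auto split: sym.split)
  qed simp
  moreover from assms obtain M where "\<And>n. n \<ge> M \<Longrightarrow> length (content i y N) < length (content i y n)"
    unfolding content_lim_def MOST_nat_le by blast
  ultimately show False by (metis max.cobounded1 max.cobounded2 not_le)
qed

lemma content_lim_not_all_Pass:
  assumes "content_lim i y h"
  shows "\<not> (\<forall>\<^sub>\<infinity>n. y n \<in> insert Pass (range Move))"
proof
  assume "\<forall>\<^sub>\<infinity>n. y n \<in> insert Pass (range Move)"
  with content_lim_infinite_Num[OF assms]
  have "\<exists>\<^sub>\<infinity>n. (y n \<in> range Num \<and> tape y n = i) \<and> y n \<in> insert Pass (range Move)"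
    by (rule INFM_conjI)
  then show False by (auto dest!: INFM_EX)
qed

lemma content_lim_basic_on: "content_lim i y h \<Longrightarrow> \<not> II_violates_basic_on i y"
  using content_lim_not_all_Pass content_lim_finite_backs
  unfolding II_violates_basic_on_def backs_def INFM_iff_infinite by blast

lemma content_lim_basic:
  "content_lim i y h \<Longrightarrow> finite {n. y n = Back} \<Longrightarrow> \<not> II_violates_basic y"
  using content_lim_not_all_Pass
  unfolding II_violates_basic_def INFM_iff_infinite by blast

lemma tape_eq_0: "\<forall>n. y n \<notin> range Move \<Longrightarrow> tape y n = 0"
  by (induction n) (auto split: sym.split)

lemma backs_single_tape: "\<forall>n. y n \<notin> range Move \<Longrightarrow> backs 0 y = {n. y n = Back}"
  by (simp add: backs_def tape_eq_0)

lemma content_lim_tape: "content_lim i y h \<Longrightarrow> \<exists>n. tape y n = i"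
  using content_lim_infinite_Num by (blast dest: INFM_EX)

lemma tape_less: "enat 0 < \<alpha> \<Longrightarrow> (\<And>n i. y n = Move i \<Longrightarrow> enat i < \<alpha>) \<Longrightarrow> enat (tape y n) < \<alpha>"
  by (induction n) (auto split: sym.split)

text \<open>If the play settles on a tape, no other tape can have infinite content, so the demand
  for the least such tape holds automatically.\<close>

lemma content_lim_eventual_tape:
  assumes "content_lim i y h" "\<forall>\<^sub>\<infinity>n. tape y n = j"
  shows "i = j"
  using INFM_conjI[OF content_lim_infinite_Num[OF assms(1)] assms(2)] by (auto dest!: INFM_EX)

section \<open>Strategies\<close>

lemma strategy_init_seg:
  assumes "strategy X \<psi>"
  shows "\<psi> (x \<restriction> n) = response \<psi> x \<restriction> n"
proof (rule nth_equalityI)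
  have len: "length (\<psi> \<sigma>) = length \<sigma>" for \<sigma> using assms by (simp add: strategy_def)
  show "length (\<psi> (x \<restriction> n)) = length (response \<psi> x \<restriction> n)" by (simp add: len)
  fix k assume "k < length (\<psi> (x \<restriction> n))"
  then have k: "k < n" by (simp add: len)
  then have "prefix (x \<restriction> Suc k) (x \<restriction> n)"
    by (intro map_mono_prefix) (metis Suc_leI le_add_diff_inverse prefixI upt_add_eq_append zero_le)
  then have "prefix (\<psi> (x \<restriction> Suc k)) (\<psi> (x \<restriction> n))" using assms by (simp add: strategy_def)
  then have "\<psi> (x \<restriction> n) ! k = \<psi> (x \<restriction> Suc k) ! k" by (auto simp: prefix_def nth_append len)
  then show "\<psi> (x \<restriction> n) ! k = (response \<psi> x \<restriction> n) ! k" using k by (simp add: response_def)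
qed

lemma strategy_response:
  assumes "strategy X \<psi>"
  shows "response \<psi> x n \<in> range Num \<union> X"
proof -
  have "response \<psi> x n \<in> set (\<psi> (x \<restriction> Suc n))"
    using assms unfolding response_def by (intro nth_mem) (simp add: strategy_def)
  then show ?thesis using assms unfolding strategy_def by blast
qed

text \<open>A fold over the input, to which \<open>recf_foldl\<close> applies; its state also
  collects the input read so far, on which the move rule may depend.\<close>

definition play :: "(nat list \<Rightarrow> sym list \<Rightarrow> sym) \<Rightarrow> nat list \<Rightarrow> sym list"
  where "play mv \<sigma> =
    snd (foldl (\<lambda>w a. (fst w @ [a], snd w @ [mv (fst w @ [a]) (snd w)])) ([], []) \<sigma>)"

lemma play_Nil [simp]: "play mv [] = []"
  by (simp add: play_def)

lemma play_snoc [simp]: "play mv (\<sigma> @ [a]) = play mv \<sigma> @ [mv (\<sigma> @ [a]) (play mv \<sigma>)]"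
proof -
  have "fst (foldl (\<lambda>w a. (fst w @ [a], snd w @ [mv (fst w @ [a]) (snd w)])) ([], []) \<sigma>) = \<sigma>" for \<sigma>
    by (induction \<sigma> rule: rev_induct) simp_all
  then show ?thesis by (simp add: play_def)
qed

lemma length_play [simp]: "length (play mv \<sigma>) = length \<sigma>"
  by (induction \<sigma> rule: rev_induct) simp_all

lemma recf_play:
  assumes "recf D (\<lambda>g z. mv (fst z) (snd z))"
  shows "recf D (\<lambda>_. play mv)"
proof -
  have "recf D (\<lambda>g z. (\<lambda>g z. mv (fst z) (snd z)) g (fst (fst (snd z)) @ [snd (snd z)], snd (fst (snd z))))"
    by (rule recf_comp[OF assms]) (intro recf_intros)
  then show ?thesis unfolding play_def by (intro recf_intros) simp
qed

lemma strategy_play: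
  assumes "\<And>\<sigma> ys. mv \<sigma> ys \<in> range Num \<union> X"
  shows "strategy X (play mv)"
proof -
  have "set (play mv \<sigma>) \<subseteq> range Num \<union> X" for \<sigma>
    using assms by (induction \<sigma> rule: rev_induct) auto
  moreover have "prefix (play mv \<sigma>) (play mv (\<sigma> @ \<rho>))" for \<sigma> \<rho>
    by (induction \<rho> rule: rev_induct) (auto simp: append_assoc[symmetric] simp del: append_assoc)
  ultimately show ?thesis unfolding strategy_def prefix_def[of _ "_ :: nat list"] by auto
qed

lemma response_play:
  assumes "strategy X (play mv)"
  shows "response (play mv) x n = mv (x \<restriction> Suc n) (response (play mv) x \<restriction> n)"
proof -
  have "response (play mv) x n = (play mv ((x \<restriction> n) @ [x n])) ! n" by (simp add: response_def)
  also have "\<dots> = mv (x \<restriction> Suc n) (play mv (x \<restriction> n))" by (simp add: nth_append)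
  finally show ?thesis using strategy_init_seg[OF assms] by simp
qed

section \<open>From strategies to learners\<close>

lemma Phi_eqI:
  assumes "\<And>n. computes (Some \<circ> x) e n (h n)"
  shows "Phi e x = Some h"
proof -
  have "(THE h. \<forall>n. computes (Some \<circ> x) e n (h n)) = h"
    by (rule the_equality) (auto simp: assms intro!: ext computes_unique[OF _ assms])
  then show ?thesis unfolding Phi_def using assms by auto
qed

lemma Phi_eqD:
  assumes "Phi e x = Some h"
  shows "computes (Some \<circ> x) e n (h n)"
proof -
  from assms obtain h' where h': "\<And>n. computes (Some \<circ> x) e n (h' n)"
    unfolding Phi_def by (auto split: if_splits)
  from Phi_eqI[OF this] assms h' show ?thesis by simp
qed

lemma recf_query:
  assumes "D \<subseteq> range (\<lambda>x. Some \<circ> x)" "recf D F"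
  shows "recf D (\<lambda>g x. the (g (F g x)))"
proof -
  have "recf D (\<lambda>g n. the (g n))"
    by (rule recfI[where p = Query]) (use assms(1) in \<open>auto intro!: ev_Query\<close>)
  then show ?thesis by (rule recf_comp) (rule assms(2))
qed

text \<open>
  Index \<open>(i, k)\<close> searches for a position at which \<open>Back\<close> has been played \<open>k\<close> times on tape \<open>i\<close>, and
  reads off the required digit.
\<close>

lemma strategy_tape_index:
  assumes "computable_strategy X \<psi>"
  obtains d where "\<And>D. recf D (\<lambda>_. d)" "inj d"
    "\<And>x i h. content_lim i (response \<psi> x) h \<Longrightarrow>
      Phi (d (prod_encode (i, card (backs i (response \<psi> x))))) x = Some h"
proof -
  have \<psi>: "recf D (\<lambda>_. \<psi>)" for D
    using assms by (rule_tac recf_Map_empty) (simp add: computable_strategy_iff_recf)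
  have str: "strategy X \<psi>" using assms by (simp add: computable_strategy_def)
  define D where "D = range (\<lambda>x :: baire. Some \<circ> x)"
  define w where "w g j s = state_of (fst (prod_decode j)) (\<psi> (map (\<lambda>l. the (g l)) [0..<s]))"
    for g :: "nat \<rightharpoonup> nat" and j s
  define T where "T g j n s \<longleftrightarrow> n < length (fst (snd (w g j s))) \<and> snd (snd (w g j s)) = snd (prod_decode j)"
    for g j n s
  define F where "F g j n s = nth_default 0 (fst (snd (w g j s))) n" for g j n s
  have "recf D (\<lambda>g z. map (\<lambda>l. the (g l)) [0..<snd z])"
    by (intro recf_intros recf_query) (auto simp: D_def)
  from recf_comp[OF \<psi> this] have w: "recf D (\<lambda>g z. w g (fst (fst z)) (snd z))"
    unfolding w_def by (intro recf_intros)
  have "recf D (\<lambda>g z. T g (fst (fst z)) (snd (fst z)) (snd z))"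
    unfolding T_def by (intro recf_intros w)
  moreover have "recf D (\<lambda>g z. F g (fst (fst z)) (snd (fst z)) (snd z))"
    unfolding F_def by (intro recf_intros w)
  ultimately obtain d where d: "inj d" "\<And>D. recf D (\<lambda>_. d)" "\<And>g i n s. g \<in> D \<Longrightarrow> T g i n s \<Longrightarrow>
      \<exists>r. T g i n r \<and> computes g (d i) n (F g i n r)"
    by (rule recf_obtain_search_index) blast
  show thesis
  proof (rule that[OF d(2,1)])
    fix x i h
    define y where "y = response \<psi> x"
    assume "content_lim i (response \<psi> x) h"
    then have lim: "content_lim i y h" by (simp add: y_def)
    define j where "j = prod_encode (i, card (backs i y))"
    have jd: "prod_decode j = (i, card (backs i y))" by (simp add: j_def)
    have fin: "finite (backs i y)" using lim by (rule content_lim_finite_backs)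
    then obtain N where N: "backs i y \<subseteq> {..<N}"
      by (metis finite_nat_iff_bounded)
    have ws: "w (Some \<circ> x) j s = (tape y s, content i y s, card (backs i y \<inter> {..<s}))" for s
      unfolding w_def j_def y_def state_of_init_seg[symmetric] strategy_init_seg[OF str, symmetric] by simp
    have "computes (Some \<circ> x) (d j) n (h n)" for n
    proof -
      obtain N' where N': "\<And>s. s \<ge> N' \<Longrightarrow> n < length (content i y s) \<and> content i y s ! n = h n"
        using lim unfolding content_lim_def MOST_nat_le by blast
      have "backs i y \<inter> {..<max N N'} = backs i y" using N by auto
      then have "T (Some \<circ> x) j n (max N N')"
        using N'[of "max N N'"] by (simp add: T_def ws jd)
      then obtain r where r: "T (Some \<circ> x) j n r" "computes (Some \<circ> x) (d j) n (F (Some \<circ> x) j n r)"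
        using d(3)[of "Some \<circ> x" j n "max N N'"] by (auto simp: D_def)
      \<comment> \<open>At \<open>r\<close> the number of \<open>Back\<close>s on tape
        \<open>i\<close> has already reached its final value. None follows, the content only grows
        from there on, and the digit read at \<open>r\<close> survives in the limit.\<close>
      have "card (backs i y \<inter> {..<r}) = card (backs i y)" using r(1) by (simp add: T_def ws jd)
      then have "backs i y \<inter> {..<r} = backs i y" using fin by (intro card_subset_eq) auto
      then have "backs i y \<subseteq> {..<r}" by blast
      then have "backs i y \<inter> {r..<max r N'} = {}" by force
      then have "prefix (content i y r) (content i y (max r N'))" by (intro prefix_content) auto
      moreover have "n < length (content i y r)" using r(1) by (simp add: T_def ws)
      ultimately have "content i y r ! n = h n"
        using N'[of "max r N'"] by (auto simp: prefix_def nth_append)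
      then show ?thesis using r(2) \<open>n < length (content i y r)\<close> by (simp add: F_def ws nth_default_def)
    qed
    then show "Phi (d (prod_encode (i, card (backs i (response \<psi> x))))) x = Some h"
      unfolding j_def y_def by (rule Phi_eqI)
  qed
qed

lemma ecard_le: "finite A \<Longrightarrow> card A \<le> n \<Longrightarrow> ecard A \<le> enat n"
  by (simp add: ecard_def)

lemma ecard_mono: "A \<subseteq> C \<Longrightarrow> ecard A \<le> ecard C"
  by (auto simp: ecard_def card_mono finite_subset)

text \<open>Assign to a change at \<open>n\<close> the new value \<open>b (Suc n)\<close>: these
  values are distinct and lie in \<open>{1..K}\<close>.\<close>

lemma card_changes_mono:
  fixes b :: "nat \<Rightarrow> nat"
  assumes "mono b" "\<And>n. b n \<le> K"
  shows "ecard {n. b (Suc n) \<noteq> b n} \<le> enat K"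
proof -
  let ?A = "{n. b (Suc n) \<noteq> b n}"
  have less: "b n < b (Suc n)" if "n \<in> ?A" for n
    using that monoD[OF assms(1), of n "Suc n"] by auto
  have "inj_on (\<lambda>n. b (Suc n)) ?A"
  proof (rule linorder_inj_onI)
    fix n m assume "n < m" "n \<in> ?A" "m \<in> ?A"
    then have "b (Suc n) \<le> b m" "b m < b (Suc m)" using monoD[OF assms(1), of "Suc n" m] less by auto
    then show "b (Suc n) \<noteq> b (Suc m)" by simp
  qed auto
  moreover have "(\<lambda>n. b (Suc n)) ` ?A \<subseteq> {1..K}" using less assms(2) by force
  ultimately have "finite ?A" "card ?A \<le> card {1..K}"
    by (rule inj_on_finite card_inj_on_le; simp)+
  then show ?thesis by (simp add: ecard_le)
qed

lemma tendsto_lagged: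
  fixes a :: "nat \<Rightarrow> nat"
  assumes "mono r" "\<forall>N. \<exists>n. N \<le> r n" "\<forall>\<^sub>\<infinity>n. a n = c"
  shows "(\<lambda>n. a (r n)) \<longlonglongrightarrow> c"
proof -
  obtain N where N: "\<And>n. n \<ge> N \<Longrightarrow> a n = c" using assms(3) unfolding MOST_nat_le by blast
  obtain n0 :: nat where "N \<le> r n0" using assms(2) by blast
  then have "a (r n) = c" if "n \<ge> n0" for n
    using N monoD[OF assms(1) that] by simp
  then show ?thesis by (intro tendsto_eventually) (use eventually_sequentially in blast)
qed

text \<open>Sampled at the lagged stages \<open>r n\<close>, the number of \<open>Back\<close>s is
  still monotone and bounded by the total; the delay merges changes but adds none.\<close>

lemma backs_learner:
  fixes a :: "nat \<Rightarrow> nat" and r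
  assumes "finite (backs i y)" "mono r" "\<forall>N. \<exists>n. N \<le> r n"
    "\<And>n. a n = d (card (backs i y \<inter> {..<r n}))"
  shows "a \<longlonglongrightarrow> d (card (backs i y))" "ecard {n. a (Suc n) \<noteq> a n} \<le> enat (card (backs i y))"
proof -
  let ?b = "\<lambda>n. card (backs i y \<inter> {..<n})"
  obtain N where N: "backs i y \<subseteq> {..<N}"
    using assms(1) by (metis finite_nat_iff_bounded)
  have "d (?b n) = d (card (backs i y))" if "n \<ge> N" for n
  proof -
    have "backs i y \<inter> {..<n} = backs i y" using N that by auto
    then show ?thesis by simp
  qed
  then have "(\<lambda>n. d (?b (r n))) \<longlonglongrightarrow> d (card (backs i y))"
    by (intro tendsto_lagged assms) (auto simp: MOST_nat_le)
  then show "a \<longlonglongrightarrow> d (card (backs i y))" unfolding assms(4)[symmetric] .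
  have "mono (\<lambda>n. ?b (r n))"
    using monoD[OF assms(2)] by (intro monoI card_mono) (auto intro: less_le_trans)
  then have "ecard {n. ?b (r (Suc n)) \<noteq> ?b (r n)} \<le> enat (card (backs i y))"
    using assms(1) by (intro card_changes_mono) (auto intro: card_mono)
  moreover have "ecard {n. a (Suc n) \<noteq> a n} \<le> ecard {n. ?b (r (Suc n)) \<noteq> ?b (r n)}"
    by (rule ecard_mono) (auto simp: assms(4))
  ultimately show "ecard {n. a (Suc n) \<noteq> a n} \<le> enat (card (backs i y))" by (rule order_trans[rotated])
qed

text \<open>Learner \<open>i\<close> conjectures the result of tape \<open>i\<close>, given the number of \<open>Back\<close>s so far.\<close>

lemma strategy_learners:
  assumes "computable_strategy X \<psi>"
  obtains e where "inj e"
    "\<And>x i h. content_lim i (response \<psi> x) h \<Longrightarrow> \<exists>c. (\<lambda>n. Psi (e i) (x \<restriction> n)) \<longlonglongrightarrow> c \<and>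
      Phi c x = Some h \<and> ecard {n. Psi (e i) (x \<restriction> Suc n) \<noteq> Psi (e i) (x \<restriction> n)} \<le>
        enat (card (backs i (response \<psi> x)))"
proof -
  have \<psi>: "recf {Map.empty} (\<lambda>_. \<psi>)" using assms by (simp add: computable_strategy_iff_recf)
  have str: "strategy X \<psi>" using assms by (simp add: computable_strategy_def)
  obtain d where d: "\<And>D. recf D (\<lambda>_. d)" "\<And>x i h. content_lim i (response \<psi> x) h \<Longrightarrow>
      Phi (d (prod_encode (i, card (backs i (response \<psi> x))))) x = Some h"
    using strategy_tape_index[OF assms] by metis
  define L where "L i \<sigma> = d (prod_encode (i, backs_of i (\<psi> \<sigma>)))" for i \<sigma>
  have "recf {Map.empty} (\<lambda>_ z. L (fst z) (snd z))"
    unfolding L_def by (intro recf_comp[OF d(1)] recf_intros recf_comp[OF \<psi>])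
  then obtain e where e: "inj e" and Psi: "\<And>i g. \<exists>r. mono r \<and> (\<forall>N. \<exists>n. N \<le> r n) \<and>
      (\<forall>n. Psi (e i) (g \<restriction> n) = L i (g \<restriction> r n))"
    by (rule recf_obtain_learner_index) blast
  show thesis
  proof (rule that[OF e])
    fix x i h
    let ?y = "response \<psi> x"
    assume lim: "content_lim i ?y h"
    obtain r where r: "mono r" "\<forall>N. \<exists>n. N \<le> r n" "\<And>n. Psi (e i) (x \<restriction> n) = L i (x \<restriction> r n)"
      using Psi by blast
    have "Psi (e i) (x \<restriction> n) = d (prod_encode (i, card (backs i ?y \<inter> {..<r n})))" for n
      unfolding r(3) L_def strategy_init_seg[OF str] state_of_init_seg by simp
    note backs_learner[where d = "\<lambda>k. d (prod_encode (i, k))", OF content_lim_finite_backs[OF lim] r(1,2) this]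
    with d(2)[OF lim] show "\<exists>c. (\<lambda>n. Psi (e i) (x \<restriction> n)) \<longlonglongrightarrow> c \<and>
      Phi c x = Some h \<and> ecard {n. Psi (e i) (x \<restriction> Suc n) \<noteq> Psi (e i) (x \<restriction> n)} \<le>
        enat (card (backs i ?y))" by blast
  qed
qed

lemma ecard_inj_image: "inj e \<Longrightarrow> ecard (e ` A) = ecard A"
  by (simp add: ecard_def card_image finite_image_iff inj_on_subset[of e UNIV])

lemma learner_computable_if_tapes:
  assumes "computable_strategy X \<psi>"
    and lim: "\<And>x. x \<in> dom f \<Longrightarrow> \<exists>i h. enat i < \<alpha> \<and> content_lim i (response \<psi> x) h \<and> f x = Some h \<and>
      enat (card (backs i (response \<psi> x))) < \<beta>"
  shows "(\<alpha>,\<beta>|\<infinity>)-computable f"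
proof -
  obtain e where e: "inj e"
    "\<And>x i h. content_lim i (response \<psi> x) h \<Longrightarrow> \<exists>c. (\<lambda>n. Psi (e i) (x \<restriction> n)) \<longlonglongrightarrow> c \<and>
      Phi c x = Some h \<and> ecard {n. Psi (e i) (x \<restriction> Suc n) \<noteq> Psi (e i) (x \<restriction> n)} \<le>
        enat (card (backs i (response \<psi> x)))"
    by (rule strategy_learners[OF assms(1)]) blast
  \<comment> \<open>The set of learners must have cardinality exactly \<alpha>, so the tapes below
    \<alpha> need pairwise different indices.\<close>
  have card: "ecard (e ` {i. enat i < \<alpha>}) = \<alpha>"
    unfolding ecard_inj_image[OF e(1)] by (cases \<alpha>) (simp_all add: ecard_def)
  have "\<exists>k \<in> e ` {i. enat i < \<alpha>}. \<exists>c. (\<lambda>n. Psi k (g \<restriction> n)) \<longlonglongrightarrow> c \<and> Phi c g = f g \<and>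
        ecard {n. Psi k (g \<restriction> Suc n) \<noteq> Psi k (g \<restriction> n)} < \<beta> \<and>
        ecard (range (\<lambda>n. Psi k (g \<restriction> n))) \<le> \<infinity>" if "g \<in> dom f" for g
  proof -
    obtain i h where "enat i < \<alpha>" "content_lim i (response \<psi> g) h" "f g = Some h"
      "enat (card (backs i (response \<psi> g))) < \<beta>" using lim \<open>g \<in> dom f\<close> by blast
    with e(2)[of i g h] show ?thesis by (auto intro: le_less_trans)
  qed
  with card show ?thesis unfolding learner_computable_def by blast
qed

text \<open>The learner conjectures the functional of the current tape. Without \<open>Back\<close>
  a tape \<open>t\<close> has the single index belonging to \<open>(t, 0)\<close>, so the number of
  tapes bounds the number of conjectures; \<open>m \<ge> 1\<close> accounts for tape 0, where the
  play starts without any \<open>Move\<close>.\<close>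

lemma learner_computable_if_moves:
  assumes "computable_strategy (P \<union> M (enat m)) \<psi>" "m \<ge> 1"
    and wins: "\<And>x. wins_star f x (response \<psi> x)"
  shows "(1,\<infinity>|enat m)-computable f"
proof -
  have \<psi>: "recf {Map.empty} (\<lambda>_. \<psi>)" using assms(1) by (simp add: computable_strategy_iff_recf)
  have str: "strategy (P \<union> M (enat m)) \<psi>" using assms by (simp add: computable_strategy_def)
  obtain d where d: "\<And>D. recf D (\<lambda>_. d)" "\<And>x i h. content_lim i (response \<psi> x) h \<Longrightarrow>
      Phi (d (prod_encode (i, card (backs i (response \<psi> x))))) x = Some h"
    using strategy_tape_index[OF assms(1)] by metis
  define L where "L i \<sigma> = d (prod_encode (tape_of (\<psi> \<sigma>), 0))" for i :: nat and \<sigma>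
  have "recf {Map.empty} (\<lambda>_ z. L (fst z) (snd z))"
    unfolding L_def by (intro recf_comp[OF d(1)] recf_intros recf_comp[OF \<psi>])
  then obtain e where e: "inj e" and Psi: "\<And>i g. \<exists>r. mono r \<and> (\<forall>N. \<exists>n. N \<le> r n) \<and>
      (\<forall>n. Psi (e i) (g \<restriction> n) = L i (g \<restriction> r n))"
    by (rule recf_obtain_learner_index) blast
  have "\<exists>c. (\<lambda>n. Psi (e 0) (g \<restriction> n)) \<longlonglongrightarrow> c \<and> Phi c g = f g \<and>
        ecard {n. Psi (e 0) (g \<restriction> Suc n) \<noteq> Psi (e 0) (g \<restriction> n)} < \<infinity> \<and>
        ecard (range (\<lambda>n. Psi (e 0) (g \<restriction> n))) \<le> enat m" if g: "g \<in> dom f" for g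
  proof -
    let ?y = "response \<psi> g"
    obtain r where r: "mono r" "\<forall>N. \<exists>n. N \<le> r n" "\<And>n. Psi (e 0) (g \<restriction> n) = L 0 (g \<restriction> r n)"
      using Psi by blast
    have Psi_tape: "Psi (e 0) (g \<restriction> n) = d (prod_encode (tape ?y (r n), 0))" for n
      unfolding r(3) L_def strategy_init_seg[OF str] state_of_init_seg by simp
    have sym: "?y n \<in> range Num \<union> (P \<union> M (enat m))" for n using str by (rule strategy_response)
    obtain i h where lim: "content_lim i ?y h" "f g = Some h" and star: "\<not> II_violates_star ?y"
      using wins[of g] g unfolding wins_star_def wins_def I_violates_basic_def by blast
    obtain N where N: "\<And>n. n \<ge> N \<Longrightarrow> ?y n \<notin> range Move"
      using star unfolding II_violates_star_def not_INFM MOST_nat_le by blast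
    have "tape ?y n = tape ?y N" if "n \<ge> N" for n
      using that
    proof (induction rule: dec_induct)
      case (step n)
      then show ?case using N[of n] by (auto split: sym.split)
    qed simp
    then have ev_tape: "\<forall>\<^sub>\<infinity>n. tape ?y n = tape ?y N" unfolding MOST_nat_le by blast
    with lim(1) have i: "i = tape ?y N" by (rule content_lim_eventual_tape)
    have "Phi (d (prod_encode (i, card (backs i ?y)))) g = Some h" by (rule d(2)[OF lim(1)])
    moreover have "?y n \<noteq> Back" for n using sym[of n] by (auto simp: P_def M_def)
    then have "backs i ?y = {}" by (simp add: backs_def)
    ultimately have Phi: "Phi (d (prod_encode (i, 0))) g = f g" using lim(2) by simp
    have "\<forall>\<^sub>\<infinity>n. d (prod_encode (tape ?y n, 0)) = d (prod_encode (i, 0))"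
      using ev_tape i by (auto elim: MOST_mono)
    from tendsto_lagged[OF r(1,2) this]
    have tends: "(\<lambda>n. Psi (e 0) (g \<restriction> n)) \<longlonglongrightarrow> d (prod_encode (i, 0))" unfolding Psi_tape .
    then have "\<forall>\<^sub>F n in sequentially. Psi (e 0) (g \<restriction> n) = d (prod_encode (i, 0))"
      by (simp add: tendsto_discrete)
    then obtain K where K: "\<And>n. n \<ge> K \<Longrightarrow> Psi (e 0) (g \<restriction> n) = d (prod_encode (i, 0))"
      unfolding eventually_sequentially by blast
    have "n < K" if "Psi (e 0) (g \<restriction> Suc n) \<noteq> Psi (e 0) (g \<restriction> n)" for n
      using that K[of n] K[of "Suc n"] by linarith
    then have "{n. Psi (e 0) (g \<restriction> Suc n) \<noteq> Psi (e 0) (g \<restriction> n)} \<subseteq> {..<K}" by blast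
    then have fin: "finite {n. Psi (e 0) (g \<restriction> Suc n) \<noteq> Psi (e 0) (g \<restriction> n)}"
      by (rule finite_subset) simp
    have "i < m" if "?y n = Move i" for n i using sym[of n] that by (auto simp: P_def M_def)
    then have "tape ?y n < m" for n
      using tape_less[of "enat m" ?y n] assms(2) by simp
    then have sub: "range (\<lambda>n. Psi (e 0) (g \<restriction> n)) \<subseteq> (\<lambda>t. d (prod_encode (t, 0))) ` {..<m}"
      unfolding Psi_tape by auto
    then have "card (range (\<lambda>n. Psi (e 0) (g \<restriction> n))) \<le> card ((\<lambda>t. d (prod_encode (t, 0))) ` {..<m})"
      by (intro card_mono) auto
    also have "\<dots> \<le> m" using card_image_le[of "{..<m}"] by auto
    finally have "ecard (range (\<lambda>n. Psi (e 0) (g \<restriction> n))) \<le> enat m"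
      using finite_subset[OF sub] by (intro ecard_le) auto
    then show ?thesis using tends Phi fin by (auto simp: ecard_def)
  qed
  moreover have "ecard {e 0} = 1" by (simp add: ecard_def one_enat_def)
  ultimately show ?thesis unfolding learner_computable_def by blast
qed

section \<open>From learners to strategies\<close>

definition valid :: "nat \<Rightarrow> nat list \<Rightarrow> nat list \<Rightarrow> bool"
  where "valid c \<sigma> u \<longleftrightarrow> (\<forall>k < length u. run (orc \<sigma>) (length \<sigma>) (prog_of c) k = Some (u ! k))"

lemma recf_valid [recf_intros]:
  assumes "recf D C" "recf D S" "recf D U"
  shows "recf D (\<lambda>g x. valid (C g x) (S g x) (U g x))"
proof -
  have eq: "valid c \<sigma> u \<longleftrightarrow> rec_nat True (\<lambda>k b. b \<and>
      run (orc \<sigma>) (length \<sigma>) (prog_of c) k = Some (nth_default 0 u k)) (length u)" for c \<sigma> u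
  proof -
    have "rec_nat True (\<lambda>k b. b \<and> Q k) n \<longleftrightarrow> (\<forall>k < n. Q k)" for Q n
      by (induction n) (auto simp: less_Suc_eq)
    then show ?thesis by (simp add: valid_def nth_default_nth)
  qed
  have "recf D (\<lambda>g z. valid (fst z) (fst (snd z)) (snd (snd z)))"
    unfolding eq by (intro recf_intros)
  from recf_comp[OF this, of "\<lambda>g x. (C g x, S g x, U g x)"]
  show ?thesis by (simp add: recf_Pair assms)
qed

text \<open>
  The next move on the current tape \<open>i\<close> for the hypothesis \<open>H i\<close>. A content that the current hypothesis does
  not (yet) confirm is erased; after each move on a tape its content is thus confirmed by the hypothesis,
  and without a change of the hypothesis nothing is erased.
\<close>

definition follow ::
    "(nat list \<Rightarrow> sym list \<Rightarrow> nat option) \<Rightarrow> (nat \<Rightarrow> nat list \<Rightarrow> nat) \<Rightarrow> (sym list \<Rightarrow> bool) \<Rightarrow>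
      nat list \<Rightarrow> sym list \<Rightarrow> sym"
  where "follow sched H may_erase \<sigma> ys = (case sched \<sigma> ys of Some j \<Rightarrow> Move j | None \<Rightarrow>
    let i = tape_of ys; u = content_of i ys; c = H i \<sigma> in
      if valid c \<sigma> u then
        (case run (orc \<sigma>) (length \<sigma>) (prog_of c) (length u) of None \<Rightarrow> Pass | Some v \<Rightarrow> Num v)
      else if may_erase ys then Back else Pass)"

lemma follow_symbols:
  assumes "\<And>\<sigma> ys j. sched \<sigma> ys = Some j \<Longrightarrow> Move j \<in> X" "Pass \<in> X" "\<And>ys. may_erase ys \<Longrightarrow> Back \<in> X"
  shows "follow sched H may_erase \<sigma> ys \<in> range Num \<union> X"
  using assms by (auto simp: follow_def Let_def split: option.splits)

lemma recf_follow:
  assumes "recf D (\<lambda>g z. sched (fst z) (snd z))" "recf D (\<lambda>g z. H (fst z) (snd z))"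
    "recf D (\<lambda>g ys. may_erase ys)"
  shows "recf D (\<lambda>g z. follow sched H may_erase (fst z) (snd z))"
proof -
  have H: "recf D (\<lambda>g z. H (A g z) (S g z))" if "recf D A" "recf D S"
    for A and S :: "(nat \<rightharpoonup> nat) \<Rightarrow> ((nat list \<times> sym list) \<times> nat) \<times> nat list \<Rightarrow> nat list"
    using recf_comp[OF assms(2), of "\<lambda>g z. (A g z, S g z)"] that by (simp add: recf_Pair)
  have cap: "recf D (\<lambda>g z. may_erase (A g z))" if "recf D A"
    for A :: "(nat \<rightharpoonup> nat) \<Rightarrow> (((nat list \<times> sym list) \<times> nat) \<times> nat list) \<times> nat \<Rightarrow> sym list"
    by (rule recf_comp[OF assms(3) that])
  show ?thesis unfolding follow_def by (intro recf_intros assms(1) H cap)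
qed

lemma computable_strategy_follow:
  assumes "recf {Map.empty} (\<lambda>g z. sched (fst z) (snd z))" "recf {Map.empty} (\<lambda>g z. H (fst z) (snd z))"
    "recf {Map.empty} (\<lambda>g ys. may_erase ys)"
    "\<And>\<sigma> ys j. sched \<sigma> ys = Some j \<Longrightarrow> Move j \<in> X" "Pass \<in> X" "\<And>ys. may_erase ys \<Longrightarrow> Back \<in> X"
  shows "computable_strategy X (play (follow sched H may_erase))"
  unfolding computable_strategy_iff_recf
  by (intro conjI strategy_play follow_symbols assms recf_play recf_follow)

section \<open>Plays that follow hypotheses\<close>

locale follow_play =
  fixes sched :: "nat list \<Rightarrow> sym list \<Rightarrow> nat option" and H :: "nat \<Rightarrow> nat list \<Rightarrow> nat"
    and may_erase :: "sym list \<Rightarrow> bool" and x :: baire and y :: "nat \<Rightarrow> sym"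
  assumes y: "\<And>n. y n = follow sched H may_erase (x \<restriction> Suc n) (y \<restriction> n)"
begin

definition active :: "nat \<Rightarrow> nat \<Rightarrow> bool"
  where "active i n \<longleftrightarrow> sched (x \<restriction> Suc n) (y \<restriction> n) = None \<and> tape y n = i"

definition confirmed :: "nat \<Rightarrow> nat \<Rightarrow> nat list \<Rightarrow> bool"
  where "confirmed c n u \<longleftrightarrow> (\<forall>k < length u. run (Some \<circ> x) n (prog_of c) k = Some (u ! k))"

lemma valid_iff_confirmed: "valid c (x \<restriction> n) u \<longleftrightarrow> confirmed c n u"
  by (simp add: valid_def confirmed_def run_orc_init_seg)

lemma confirmed_mono: "confirmed c n u \<Longrightarrow> n \<le> n' \<Longrightarrow> confirmed c n' u"
  unfolding confirmed_def using run_mono by blast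

lemma y_active:
  assumes "active i n"
  shows "y n = (let u = content i y n; c = H i (x \<restriction> Suc n) in
      if confirmed c (Suc n) u then
        (case run (Some \<circ> x) (Suc n) (prog_of c) (length u) of None \<Rightarrow> Pass | Some v \<Rightarrow> Num v)
      else if may_erase (y \<restriction> n) then Back else Pass)"
  using assms
  by (subst y) (simp add: follow_def active_def Let_def state_of_init_seg valid_iff_confirmed
      run_orc_init_seg del: upt_Suc)

lemma y_inactive: "\<not> active i n \<Longrightarrow> tape y n = i \<Longrightarrow> \<exists>j. y n = Move j"
  unfolding active_def by (subst y) (auto simp: follow_def)

lemma content_inactive: "\<not> active i n \<Longrightarrow> content i y (Suc n) = content i y n"
  using y_inactive[of i n] by (cases "tape y n = i") auto

text \<open>A digit is written only once the hypothesis yields it within \<open>Suc n\<close>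
  stages, so writing preserves confirmation.\<close>

lemma confirmed_Suc:
  assumes "confirmed (H i (x \<restriction> Suc n)) (Suc n) (content i y n)"
  shows "confirmed (H i (x \<restriction> Suc n)) (Suc n) (content i y (Suc n))"
    "prefix (content i y n) (content i y (Suc n))"
proof -
  have "confirmed (H i (x \<restriction> Suc n)) (Suc n) (content i y (Suc n)) \<and>
      prefix (content i y n) (content i y (Suc n))"
  proof (cases "active i n")
    case True
    then have "tape y n = i" by (simp add: active_def)
    with assms y_active[OF True] show ?thesis
      by (auto simp: Let_def confirmed_def nth_append less_Suc_eq simp del: upt_Suc split: option.splits)
  next
    case False
    then show ?thesis using assms content_inactive[OF False] by (simp del: upt_Suc content.simps)
  qed
  then show "confirmed (H i (x \<restriction> Suc n)) (Suc n) (content i y (Suc n))"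
    "prefix (content i y n) (content i y (Suc n))" by blast+
qed

lemma y_Back:
  assumes "y n = Back"
  shows "active (tape y n) n" "may_erase (y \<restriction> n)"
    "\<not> confirmed (H (tape y n) (x \<restriction> Suc n)) (Suc n) (content (tape y n) y n)"
proof -
  show act: "active (tape y n) n" using y_inactive[of "tape y n" n] assms by auto
  show "may_erase (y \<restriction> n)" "\<not> confirmed (H (tape y n) (x \<restriction> Suc n)) (Suc n) (content (tape y n) y n)"
    using y_active[OF act] assms by (auto simp: Let_def simp del: upt_Suc split: option.splits if_splits)
qed

lemma erased_if_unconfirmed:
  assumes "active i n" "\<not> confirmed (H i (x \<restriction> Suc n)) (Suc n) (content i y n)" "may_erase (y \<restriction> n)"
  shows "y n = Back" "content i y (Suc n) = []"
proof -
  show "y n = Back" using assms y_active[OF assms(1)] by (simp del: upt_Suc)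
  then show "content i y (Suc n) = []" using assms(1) by (simp add: active_def)
qed

text \<open>An empty content is confirmed by every hypothesis, so the hypothesis of a tape may still
  change before anything is written there. This is needed when hypotheses are assigned to tapes in
  the course of the play.\<close>

lemma confirmed_if_stable:
  assumes "\<And>n. content i y n \<noteq> [] \<Longrightarrow> H i (x \<restriction> Suc n) = H i (x \<restriction> n)"
  shows "confirmed (H i (x \<restriction> n)) n (content i y n)"
    "confirmed (H i (x \<restriction> Suc n)) (Suc n) (content i y n)"
proof -
  have step: "confirmed (H i (x \<restriction> Suc n)) (Suc n) (content i y n)"
    if "confirmed (H i (x \<restriction> n)) n (content i y n)" for n
  proof (cases "content i y n = []")
    case False
    then show ?thesis using that assms[OF False] confirmed_mono[of _ n _ "Suc n"] by (simp del: upt_Suc)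
  qed (simp add: confirmed_def)
  show *: "confirmed (H i (x \<restriction> n)) n (content i y n)"
  proof (induction n)
    case (Suc n)
    show ?case by (rule confirmed_Suc(1)[OF step[OF Suc]])
  qed (simp add: confirmed_def)
  show "confirmed (H i (x \<restriction> Suc n)) (Suc n) (content i y n)" by (rule step[OF *])
qed

text \<open>Once the hypothesis is final and the tape has been active again, its content only grows
  and consists of digits of \<open>h\<close>. Every digit is computed within some number of stages,
  and the tape is active after that, so the length is unbounded.\<close>

lemma content_lim_follow:
  assumes act: "\<exists>\<^sub>\<infinity>n. active i n" and H: "\<forall>\<^sub>\<infinity>n. H i (x \<restriction> n) = c" and Phi: "Phi c x = Some h"
    and erase: "\<And>n. active i n \<Longrightarrow> \<not> confirmed (H i (x \<restriction> Suc n)) (Suc n) (content i y n) \<Longrightarrow>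
      may_erase (y \<restriction> n)"
  shows "content_lim i y h"
proof -
  obtain N where N: "\<And>n. n \<ge> N \<Longrightarrow> H i (x \<restriction> n) = c" using H unfolding MOST_nat_le by blast
  obtain n0 where n0: "n0 \<ge> N" "active i n0" using act unfolding INFM_nat_le by blast
  \<comment> \<open>Digits from earlier hypotheses may remain until the tape is next active. At
    \<open>n0\<close> they are either confirmed by the final hypothesis \<open>c\<close> or erased,
    which \<open>erase\<close> permits; afterwards confirmation is never lost.\<close>
  have conf: "confirmed c n (content i y n)" if "n > n0" for n
    using Suc_leI[OF that]
  proof (induction rule: dec_induct)
    case base
    have c: "H i (x \<restriction> Suc n0) = c" using n0 by (intro N) simp
    show ?case
    proof (cases "confirmed c (Suc n0) (content i y n0)")
      case True
      then show ?thesis using confirmed_Suc(1)[of i n0] unfolding c by blast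
    next
      case False
      then show ?thesis using erased_if_unconfirmed(2)[OF n0(2)] erase[OF n0(2)] unfolding c
        by (simp add: confirmed_def)
    qed
  next
    case (step n)
    have c: "H i (x \<restriction> Suc n) = c" using n0 step.hyps by (intro N) simp
    show ?case using confirmed_Suc(1)[of i n] confirmed_mono[OF step.IH, of "Suc n"] unfolding c by simp
  qed
  have pre: "prefix (content i y n) (content i y n')" if "n0 < n" "n \<le> n'" for n n'
    using that(2)
  proof (induction rule: dec_induct)
    case (step k)
    have c: "H i (x \<restriction> Suc k) = c" using n0 step.hyps that by (intro N) simp
    have "prefix (content i y k) (content i y (Suc k))"
      using confirmed_Suc(2)[of i k] confirmed_mono[OF conf, of k "Suc k"] step.hyps that unfolding c by simp
    with step.IH show ?case by (rule prefix_order.trans)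
  qed simp
  have h: "u ! k = h k" if "confirmed c n u" "k < length u" for n u k
  proof -
    have "computes (Some \<circ> x) c k (u ! k)" using that unfolding confirmed_def computes_def by blast
    then show ?thesis using Phi_eqD[OF Phi] by (rule computes_unique)
  qed
  have grow: "\<exists>n > n0. k \<le> length (content i y n)" for k
  proof (induction k)
    case 0
    show ?case by blast
  next
    case (Suc k)
    then obtain n where n: "n > n0" "k \<le> length (content i y n)" by blast
    from Phi_eqD[OF Phi, of k] obtain t where t: "run (Some \<circ> x) t (prog_of c) k = Some (h k)"
      unfolding computes_def by blast
    \<comment> \<open>A stage at which the tape is active and the computation of digit
      \<open>k\<close> has had enough time; if the digit is still missing, it is written
      now.\<close>
    obtain n' where n': "n' \<ge> max n t" "active i n'" using act unfolding INFM_nat_le by blast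
    have len: "k \<le> length (content i y n')" using pre[of n n'] n n' by (auto dest: prefix_length_le)
    have c: "H i (x \<restriction> Suc n') = c" using n0 n n' by (intro N) simp
    have conf': "confirmed c (Suc n') (content i y n')" using conf[of n'] n n' confirmed_mono by auto
    have "Suc k \<le> length (content i y (Suc n'))"
    proof (cases "k = length (content i y n')")
      case True
      have "run (Some \<circ> x) (Suc n') (prog_of c) k = Some (h k)" using t n' by (intro run_mono[OF t]) simp
      then have "y n' = Num (h k)"
        using y_active[OF n'(2)] conf' True unfolding c by (simp add: Let_def)
      then show ?thesis using n'(2) True by (simp add: active_def)
    next
      case False
      then show ?thesis using len pre[of n' "Suc n'"] n n' by (auto dest!: prefix_length_le)
    qed
    then show ?case using n n' by (intro exI[of _ "Suc n'"]) auto
  qed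
  show ?thesis unfolding content_lim_def MOST_nat_le
  proof
    fix k
    obtain n where n: "n > n0" "Suc k \<le> length (content i y n)" using grow by blast
    have "k < length (content i y n') \<and> content i y n' ! k = h k" if "n' \<ge> n" for n'
    proof -
      have "k < length (content i y n')"
        using pre[OF n(1) that] n(2) by (auto dest: prefix_length_le)
      then show ?thesis using h[OF conf] n that by auto
    qed
    then show "\<exists>m. \<forall>n\<ge>m. k < length (content i y n) \<and> content i y n ! k = h k" by blast
  qed
qed

end

lemma follow_play_response:
  assumes "computable_strategy X (play (follow sched H may_erase))"
  shows "follow_play sched H may_erase x (response (play (follow sched H may_erase)) x)"
  using response_play assms unfolding computable_strategy_def by unfold_locales blast

lemma LIMSEQ_nat_MOST: "(a :: nat \<Rightarrow> nat) \<longlonglongrightarrow> c \<longleftrightarrow> (\<forall>\<^sub>\<infinity>n. a n = c)"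
  by (simp add: tendsto_discrete cofinite_eq_sequentially)

lemma ecard_eq_1: "ecard A = 1 \<longleftrightarrow> (\<exists>a. A = {a})"
  by (auto simp: ecard_def one_enat_def card_1_singleton_iff)

lemma finite_card_le_if_initial:
  fixes A :: "nat set"
  assumes "\<And>n. card (A \<inter> {..<n}) \<le> K"
  shows "finite A" "card A \<le> K"
proof -
  have *: "card F \<le> K" if F: "F \<subseteq> A" "finite F" for F :: "nat set"
  proof -
    obtain n where "F \<subseteq> {..<n}" using F(2) by (metis finite_nat_iff_bounded)
    then have "card F \<le> card (A \<inter> {..<n})" using F by (intro card_mono) auto
    then show ?thesis using assms[of n] by simp
  qed
  show fin: "finite A"
  proof (rule ccontr)
    assume "infinite A"
    then obtain F where "F \<subseteq> A" "finite F" "card F = Suc K"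
      using infinite_arbitrarily_large by blast
    then show False using *[of F] by simp
  qed
  show "card A \<le> K" by (rule *[OF _ fin]) simp
qed

section \<open>A single tape with erasing\<close>

text \<open>The cap on \<open>Back\<close>s matters on inputs outside \<open>dom f\<close>, where
  the learner may change its mind too often but rule \<open>m\<close> still binds. On the domain it
  never prevents a necessary erasure.\<close>

definition erasing_strategy :: "nat \<Rightarrow> enat \<Rightarrow> nat list \<Rightarrow> sym list"
  where "erasing_strategy e \<beta> =
    play (follow (\<lambda>_ _. None) (\<lambda>_ \<sigma>. Psi e \<sigma>) (\<lambda>ys. enat (Suc (backs_of 0 ys)) < \<beta>))"

lemma computable_erasing_strategy: "computable_strategy (P \<union> B) (erasing_strategy e \<beta>)"
  unfolding erasing_strategy_def
proof (rule computable_strategy_follow)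
  show "recf {Map.empty} (\<lambda>g ys. enat (Suc (backs_of 0 ys)) < \<beta>)"
    by (cases \<beta>) (simp_all, (intro recf_intros)+)
qed (auto simp: P_def B_def intro!: recf_intros)

lemma erasing_strategy_no_Move: "response (erasing_strategy e \<beta>) x n \<notin> range Move"
  using computable_erasing_strategy strategy_response[of "P \<union> B" "erasing_strategy e \<beta>" x n]
  by (auto simp: computable_strategy_def P_def B_def)

lemma erasing_strategy_backs:
  assumes "0 < m"
  shows "\<not> II_violates_rule m (response (erasing_strategy e (enat m)) x)"
proof -
  define y where "y = response (erasing_strategy e (enat m)) x"
  interpret follow_play "\<lambda>_ _. None" "\<lambda>_ \<sigma>. Psi e \<sigma>" "\<lambda>ys. enat (Suc (backs_of 0 ys)) < enat m" x y
    unfolding y_def erasing_strategy_def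
    by (rule follow_play_response, fold erasing_strategy_def, rule computable_erasing_strategy)
  have backs: "backs 0 y = {n. y n = Back}"
    unfolding y_def by (rule backs_single_tape) (simp add: erasing_strategy_no_Move)
  have "card (backs 0 y \<inter> {..<n}) \<le> m - 1" for n
  proof (induction n)
    case (Suc n)
    show ?case
    proof (cases "n \<in> backs 0 y")
      case True
      then have "y n = Back" by (simp add: backs)
      from y_Back(2)[OF this] have "Suc (card (backs 0 y \<inter> {..<n})) < m"
        by (simp add: state_of_init_seg)
      then show ?thesis using True by (simp add: card_Int_lessThan_Suc)
    next
      case False
      then show ?thesis using Suc by (simp add: card_Int_lessThan_Suc)
    qed
  qed simp
  from finite_card_le_if_initial[OF this] assms show ?thesis
    unfolding II_violates_rule_def y_def[symmetric] backs[symmetric] by (simp add: ecard_def)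
qed

text \<open>Every \<open>Back\<close> is charged to the mind change of the same round: a content
  confirmed before the round can fail to be confirmed afterwards only if the hypothesis has changed.
  As there are fewer than \<beta> mind changes, the cap always leaves room for the next
  \<open>Back\<close>.\<close>

lemma erasing_strategy_wins:
  assumes lim: "(\<lambda>n. Psi e (x \<restriction> n)) \<longlonglongrightarrow> c" and Phi: "Phi c x = f x" and x: "x \<in> dom f"
    and changes: "ecard {n. Psi e (x \<restriction> Suc n) \<noteq> Psi e (x \<restriction> n)} < \<beta>"
  shows "wins f x (response (erasing_strategy e \<beta>) x)"
proof -
  define y where "y = response (erasing_strategy e \<beta>) x"
  interpret follow_play "\<lambda>_ _. None" "\<lambda>_ \<sigma>. Psi e \<sigma>" "\<lambda>ys. enat (Suc (backs_of 0 ys)) < \<beta>" x y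
    unfolding y_def erasing_strategy_def
    by (rule follow_play_response, fold erasing_strategy_def, rule computable_erasing_strategy)
  define Ch where "Ch = {n. Psi e (x \<restriction> Suc n) \<noteq> Psi e (x \<restriction> n)}"
  have no_move: "\<forall>n. y n \<notin> range Move" by (simp add: y_def erasing_strategy_no_Move)
  then have tape: "tape y n = 0" for n by (rule tape_eq_0)
  have backs: "backs 0 y = {n. y n = Back}" using no_move by (rule backs_single_tape)
  have act: "active 0 n" for n by (simp add: active_def tape)
  obtain h where h: "f x = Some h" using x by blast
  obtain N where N: "\<And>n. n \<ge> N \<Longrightarrow> Psi e (x \<restriction> n) = c"
    using lim unfolding LIMSEQ_nat_MOST MOST_nat_le by blast
  have "n < N" if "n \<in> Ch" for n
    using that N[of n] N[of "Suc n"] unfolding Ch_def by fastforce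
  then have finCh: "finite Ch" by (intro finite_subset[of Ch "{..<N}"]) auto
  have unconfirmed: "n \<in> Ch \<and> may_erase_n"
    if "confirmed (Psi e (x \<restriction> n)) n (content 0 y n)" "backs 0 y \<inter> {..<n} \<subseteq> Ch"
      "\<not> confirmed (Psi e (x \<restriction> Suc n)) (Suc n) (content 0 y n)"
      "may_erase_n = (enat (Suc (backs_of 0 (y \<restriction> n))) < \<beta>)" for n may_erase_n
  proof -
    have Ch: "n \<in> Ch"
      using that(1,3) confirmed_mono[of _ n _ "Suc n"] unfolding Ch_def by fastforce
    have "insert n (backs 0 y \<inter> {..<n}) \<subseteq> Ch" using Ch that(2) by blast
    then have "card (insert n (backs 0 y \<inter> {..<n})) \<le> card Ch" using finCh by (intro card_mono)
    then have "enat (Suc (card (backs 0 y \<inter> {..<n}))) \<le> ecard Ch" using finCh by (simp add: ecard_def)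
    also have "\<dots> < \<beta>" using changes by (simp add: Ch_def)
    finally show ?thesis using Ch that(4) by (simp add: state_of_init_seg)
  qed
  \<comment> \<open>Both halves are proved together: restoring confirmation takes permission to
    erase, and permission follows from the \<open>Back\<close>s so far being among the mind
    changes.\<close>
  have inv: "confirmed (Psi e (x \<restriction> n)) n (content 0 y n) \<and> backs 0 y \<inter> {..<n} \<subseteq> Ch" for n
  proof (induction n)
    case 0
    show ?case by (simp add: confirmed_def)
  next
    case (Suc n)
    show ?case
    proof (cases "confirmed (Psi e (x \<restriction> Suc n)) (Suc n) (content 0 y n)")
      case True
      then have "n \<notin> backs 0 y" using y_Back(3)[of n] tape by (auto simp: backs)
      then have "backs 0 y \<inter> {..<Suc n} = backs 0 y \<inter> {..<n}" by (auto simp: less_Suc_eq)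
      then show ?thesis using Suc confirmed_Suc(1)[OF True] by simp
    next
      case False
      note un = unconfirmed[OF conjunct1[OF Suc] conjunct2[OF Suc] False refl]
      have "content 0 y (Suc n) = []"
        by (rule erased_if_unconfirmed(2)[OF act False]) (use un in blast)
      then have "confirmed (Psi e (x \<restriction> Suc n)) (Suc n) (content 0 y (Suc n))"
        by (simp add: confirmed_def)
      moreover have "backs 0 y \<inter> {..<Suc n} \<subseteq> Ch" using Suc un by (auto simp: less_Suc_eq)
      ultimately show ?thesis by blast
    qed
  qed
  have "content_lim 0 y h"
  proof (rule content_lim_follow)
    show "\<exists>\<^sub>\<infinity>n. active 0 n" using act by simp
    show "\<forall>\<^sub>\<infinity>n. Psi e (x \<restriction> n) = c" using lim by (simp add: LIMSEQ_nat_MOST)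
    show "Phi c x = Some h" using Phi h by simp
    show "enat (Suc (backs_of 0 (y \<restriction> n))) < \<beta>"
      if "\<not> confirmed (Psi e (x \<restriction> Suc n)) (Suc n) (content 0 y n)" for n
      using unconfirmed[OF conjunct1[OF inv] conjunct2[OF inv] that refl] by blast
  qed
  moreover from this have "\<not> II_violates_basic y"
    using content_lim_finite_backs[of 0 y h] by (intro content_lim_basic) (auto simp: backs)
  ultimately show ?thesis unfolding wins_def y_def[symmetric] content_infinite_def using h by blast
qed

section \<open>Dovetailing over several tapes\<close>

text \<open>Even rounds only move to the tape that the schedule \<open>t\<close> prescribes, and odd
  rounds work there. With \<open>b = False\<close> nothing is ever erased, which suits hypotheses
  that are constant along the play.\<close>

definition dovetail_strategy :: "(nat \<Rightarrow> nat) \<Rightarrow> (nat \<Rightarrow> nat list \<Rightarrow> nat) \<Rightarrow> bool \<Rightarrow> nat list \<Rightarrow> sym list"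
  where "dovetail_strategy t H b =
    play (follow (\<lambda>_ ys. if length ys mod 2 = 0 then Some (t (length ys div 2)) else None) H (\<lambda>_. b))"

lemma computable_dovetail_strategy:
  assumes t: "recf {Map.empty} (\<lambda>_. t)" and H: "recf {Map.empty} (\<lambda>_ z. H (fst z) (snd z))"
    and X: "\<And>k. Move (t k) \<in> X" "Pass \<in> X" "b \<Longrightarrow> Back \<in> X"
  shows "computable_strategy X (dovetail_strategy t H b)"
  unfolding dovetail_strategy_def
proof (rule computable_strategy_follow)
  show "recf {Map.empty} (\<lambda>g (z :: nat list \<times> sym list).
      if length (snd z) mod 2 = 0 then Some (t (length (snd z) div 2)) else None)"
    by (intro recf_intros recf_comp[OF t]) simp_all
qed (use assms in \<open>auto split: if_splits intro: recf_const\<close>)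

lemma dovetail_strategy_content_lim:
  assumes str: "computable_strategy X (dovetail_strategy t H b)"
    and t: "\<exists>\<^sub>\<infinity>k. t k = i" and H: "\<forall>\<^sub>\<infinity>n. H i (x \<restriction> n) = c" and Phi: "Phi c x = Some h"
    and b: "\<not> b \<Longrightarrow> (\<And>n. H i (x \<restriction> n) = c)"
  shows "content_lim i (response (dovetail_strategy t H b) x) h"
proof -
  define y where "y = response (dovetail_strategy t H b) x"
  interpret follow_play "\<lambda>_ ys. if length ys mod 2 = 0 then Some (t (length ys div 2)) else None" H "\<lambda>_. b" x y
    unfolding y_def dovetail_strategy_def
    by (rule follow_play_response) (use str in \<open>simp add: dovetail_strategy_def\<close>)
  have act: "active i (Suc (2 * k))" if "t k = i" for k
  proof -
    have "y (2 * k) = Move (t k)" by (subst y) (simp add: follow_def)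
    then show ?thesis using that by (simp add: active_def)
  qed
  have "\<exists>m \<ge> n. active i m" for n
  proof -
    obtain k where "k \<ge> n" "t k = i" using t unfolding INFM_nat_le by blast
    then show ?thesis using act[of k] by (intro exI[of _ "Suc (2 * k)"]) simp
  qed
  then have "\<exists>\<^sub>\<infinity>n. active i n" unfolding INFM_nat_le by blast
  then have "content_lim i y h"
  proof (rule content_lim_follow[OF _ H Phi])
    fix n assume "\<not> confirmed (H i (x \<restriction> Suc n)) (Suc n) (content i y n)"
    \<comment> \<open>If erasing is forbidden, the hypothesis is constant and the content is always
      confirmed; an unconfirmed content therefore forces \<open>b\<close>.\<close>
    then show b using b confirmed_if_stable(2)[of i n] by metis
  qed
  then show ?thesis by (simp add: y_def)
qed

section \<open>One tape for each hypothesis\<close>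

primrec pos :: "nat \<Rightarrow> nat list \<Rightarrow> nat"
  where
    "pos a [] = 0"
  | "pos a (b # bs) = (if b = a then 0 else Suc (pos a bs))"

lemma pos_less: "pos a bs < length bs \<longleftrightarrow> a \<in> set bs"
  by (induction bs) auto

lemma nth_pos: "a \<in> set bs \<Longrightarrow> bs ! pos a bs = a"
  by (induction bs) auto

lemma pos_append: "a \<in> set bs \<Longrightarrow> pos a (bs @ cs) = pos a bs"
  by (induction bs) auto

lemma recf_pos [recf_intros]:
  assumes "recf D A" "recf D L"
  shows "recf D (\<lambda>g x. pos (A g x) (L g x))"
proof -
  \<comment> \<open>Reading from right to left, the last reset of the counter happens at the first
    occurrence of \<open>a\<close>.\<close>
  have eq: "pos a bs = foldl (\<lambda>n b. if b = a then 0 else Suc n) 0 (rev bs)" for a bs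
    by (induction bs) auto
  have "recf D (\<lambda>g z. pos (fst z) (snd z))"
    unfolding eq by (intro recf_intros)
  from recf_comp[OF this, of "\<lambda>g x. (A g x, L g x)"]
  show ?thesis by (simp add: recf_Pair assms)
qed

definition insert_last :: "nat \<Rightarrow> nat list \<Rightarrow> nat list"
  where "insert_last a as = (if pos a as < length as then as else as @ [a])"

lemma set_insert_last: "set (insert_last a as) = insert a (set as)"
  by (auto simp: insert_last_def pos_less)

lemma distinct_insert_last: "distinct as \<Longrightarrow> distinct (insert_last a as)"
  by (auto simp: insert_last_def pos_less)

text \<open>The conjectures in the order of their first appearance. The list only grows at its end,
  so the position of a hypothesis, which serves as its tape, never changes.\<close>

definition hyps :: "nat \<Rightarrow> nat list \<Rightarrow> nat list"
  where "hyps e \<sigma> = rec_nat [] (\<lambda>n hs. insert_last (Psi e (take n \<sigma>)) hs) (Suc (length \<sigma>))"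

lemma recf_hyps [recf_intros]:
  assumes "recf D E" "recf D S"
  shows "recf D (\<lambda>g x. hyps (E g x) (S g x))"
proof -
  have "recf D (\<lambda>g z. hyps (fst z) (snd z))"
    unfolding hyps_def insert_last_def by (intro recf_intros)
  from recf_comp[OF this, of "\<lambda>g x. (E g x, S g x)"]
  show ?thesis by (simp add: recf_Pair assms)
qed

lemma hyps_Suc: "hyps e (x \<restriction> Suc n) = insert_last (Psi e (x \<restriction> Suc n)) (hyps e (x \<restriction> n))"
proof -
  have "rec_nat [] (\<lambda>k hs. insert_last (Psi e (take k (x \<restriction> Suc n))) hs) k =
      rec_nat [] (\<lambda>k hs. insert_last (Psi e (take k (x \<restriction> n))) hs) k" if "k \<le> Suc n" for k
    using that by (induction k) (simp_all add: take_map del: upt_Suc)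
  from this[of "Suc n"] show ?thesis by (simp add: hyps_def)
qed

lemma hyps_0: "hyps e (x \<restriction> 0) = [Psi e (x \<restriction> 0)]"
  by (simp add: hyps_def insert_last_def)

lemma set_hyps: "set (hyps e (x \<restriction> n)) = (\<lambda>k. Psi e (x \<restriction> k)) ` {..n}"
  by (induction n) (simp_all only: hyps_0 hyps_Suc set_insert_last atMost_Suc, simp_all)

lemma distinct_hyps: "distinct (hyps e (x \<restriction> n))"
  by (induction n) (simp_all only: hyps_0 hyps_Suc distinct_insert_last, simp)

lemma prefix_hyps: "n \<le> n' \<Longrightarrow> prefix (hyps e (x \<restriction> n)) (hyps e (x \<restriction> n'))"
proof (induction rule: dec_induct)
  case (step k)
  have "prefix (hyps e (x \<restriction> k)) (hyps e (x \<restriction> Suc k))"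
    unfolding hyps_Suc by (simp add: insert_last_def)
  with step.IH show ?case by (rule prefix_order.trans)
qed simp

text \<open>The guard \<open>j < m\<close> keeps the moves legal on inputs outside
  \<open>dom f\<close>, where more than \<open>m\<close> hypotheses may appear. The default
  hypothesis 0 concerns tapes that have not been assigned yet; the play has not visited
  them.\<close>

definition moving_strategy :: "nat \<Rightarrow> nat \<Rightarrow> nat list \<Rightarrow> sym list"
  where "moving_strategy e m = play (follow
    (\<lambda>\<sigma> ys. let j = pos (Psi e \<sigma>) (hyps e \<sigma>) in if j < m \<and> j \<noteq> tape_of ys then Some j else None)
    (\<lambda>i \<sigma>. nth_default 0 (hyps e \<sigma>) i) (\<lambda>_. False))"

lemma computable_moving_strategy: "computable_strategy (P \<union> M (enat m)) (moving_strategy e m)"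
  unfolding moving_strategy_def
proof (rule computable_strategy_follow)
  show "recf {Map.empty} (\<lambda>g z. let j = pos (Psi e (fst z)) (hyps e (fst z)) in
      if j < m \<and> j \<noteq> tape_of (snd z) then Some j else None)"
    by (intro recf_intros)
  show "recf {Map.empty} (\<lambda>g z. nth_default 0 (hyps e (snd z)) (fst z))"
    by (intro recf_intros)
qed (auto simp: P_def M_def Let_def intro: recf_const split: if_splits)

text \<open>When the learner has settled, the position of its hypothesis is fixed; at most one more
  move leads to that tape, and the play stays there. This gives rule \<open>*\<close> and leaves
  only one tape with infinite content.\<close>

lemma moving_strategy_wins:
  assumes lim: "(\<lambda>n. Psi e (x \<restriction> n)) \<longlonglongrightarrow> c" and Phi: "Phi c x = f x" and x: "x \<in> dom f"
    and range: "ecard (range (\<lambda>n. Psi e (x \<restriction> n))) \<le> enat m"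
  shows "wins f x (response (moving_strategy e m) x)" "\<not> II_violates_star (response (moving_strategy e m) x)"
proof -
  define y where "y = response (moving_strategy e m) x"
  define sched where "sched \<sigma> ys = (let j = pos (Psi e \<sigma>) (hyps e \<sigma>) in
    if j < m \<and> j \<noteq> tape_of ys then Some j else None)" for \<sigma> ys
  interpret follow_play sched "\<lambda>i \<sigma>. nth_default 0 (hyps e \<sigma>) i" "\<lambda>_. False" x y
    unfolding y_def sched_def moving_strategy_def
    by (rule follow_play_response, fold moving_strategy_def, rule computable_moving_strategy)
  define p where "p n = pos (Psi e (x \<restriction> n)) (hyps e (x \<restriction> n))" for n
  have mem: "Psi e (x \<restriction> n) \<in> set (hyps e (x \<restriction> n))" for n by (simp add: set_hyps)
  have sched: "sched (x \<restriction> Suc n) (y \<restriction> n) =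
      (if p (Suc n) < m \<and> p (Suc n) \<noteq> tape y n then Some (p (Suc n)) else None)" for n
    by (simp add: sched_def p_def Let_def state_of_init_seg del: upt_Suc)
  have Move: "y n = Move j \<longleftrightarrow> sched (x \<restriction> Suc n) (y \<restriction> n) = Some j" for n j
    by (subst y) (auto simp: follow_def Let_def split: option.split)
  have tape_less: "tape y n < length (hyps e (x \<restriction> n))" for n
  proof (induction n)
    case 0
    show ?case by (simp add: hyps_def insert_last_def)
  next
    case (Suc n)
    have "length (hyps e (x \<restriction> n)) \<le> length (hyps e (x \<restriction> Suc n))"
      by (rule prefix_length_le[OF prefix_hyps]) simp
    with Suc have "tape y n < length (hyps e (x \<restriction> Suc n))" by linarith
    moreover have "j < length (hyps e (x \<restriction> Suc n))" if "y n = Move j" for j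
      using that mem[of "Suc n"] unfolding Move sched by (auto simp: p_def pos_less split: if_splits)
    ultimately show ?case by (auto simp del: upt_Suc split: sym.split)
  qed
  have content: "i < length (hyps e (x \<restriction> n))" if "content i y n \<noteq> []" for i n
    using that
  proof (induction n)
    case (Suc n)
    then have "i < length (hyps e (x \<restriction> n))"
      using tape_less[of n] by (auto simp del: upt_Suc split: if_splits)
    also have "\<dots> \<le> length (hyps e (x \<restriction> Suc n))" by (rule prefix_length_le[OF prefix_hyps]) simp
    finally show ?case .
  qed simp
  have stable: "nth_default 0 (hyps e (x \<restriction> n')) i = hyps e (x \<restriction> n) ! i"
    if "i < length (hyps e (x \<restriction> n))" "n \<le> n'" for i n n'
    using that prefix_hyps[OF that(2), of e x] by (auto simp: prefix_def nth_default_append)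
  obtain N where N: "\<And>n. n \<ge> N \<Longrightarrow> Psi e (x \<restriction> n) = c"
    using lim unfolding LIMSEQ_nat_MOST MOST_nat_le by blast
  have p: "p n = p N" if "n \<ge> N" for n
    using prefix_hyps[OF that, of e x] mem[of N] N[OF that] N[of N]
    by (auto simp: p_def prefix_def pos_append)
  have pN: "p N < length (hyps e (x \<restriction> N))" using mem by (simp add: p_def pos_less)
  \<comment> \<open>The position is less than the number of different conjectures so far, which is
    at most \<open>m\<close>; so the guard does not block the move to this tape.\<close>
  have "finite (range (\<lambda>n. Psi e (x \<restriction> n)))" "card (range (\<lambda>n. Psi e (x \<restriction> n))) \<le> m"
    using range by (auto simp: ecard_def split: if_splits)
  moreover have "card (set (hyps e (x \<restriction> N))) \<le> card (range (\<lambda>n. Psi e (x \<restriction> n)))"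
    using calculation(1) by (rule card_mono) (auto simp: set_hyps)
  ultimately have pm: "p N < m" using pN distinct_card[OF distinct_hyps[of e x N]] by simp
  have tape: "tape y n = p N" if "n > N" for n
    using Suc_leI[OF that]
  proof (induction rule: dec_induct)
    case base
    show ?case
    proof (cases "tape y N = p N")
      case True
      then have "y N \<noteq> Move j" for j using p[of "Suc N"] unfolding Move sched by simp
      then show ?thesis using True by (auto split: sym.split)
    next
      case False
      then have "y N = Move (p N)" using p[of "Suc N"] pm unfolding Move sched by simp
      then show ?thesis by simp
    qed
  next
    case (step n)
    then have "y n \<noteq> Move j" for j using p[of "Suc n"] unfolding Move sched by simp
    then show ?case using step.IH by (auto split: sym.split)
  qed
  have no_sched: "sched (x \<restriction> Suc n) (y \<restriction> n) = None" if "n > N" for n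
    using that p[of "Suc n"] tape[OF that] unfolding sched by simp
  obtain h where h: "f x = Some h" using x by blast
  have lim: "content_lim (p N) y h"
  proof (rule content_lim_follow)
    have "active (p N) n" if "n > N" for n using that no_sched tape by (simp add: active_def)
    then show "\<exists>\<^sub>\<infinity>n. active (p N) n" 
      unfolding INFM_nat_le by (meson le_SucI lessI max.cobounded1 max.cobounded2 le_less_trans)
    have "nth_default 0 (hyps e (x \<restriction> n)) (p N) = c" if "n \<ge> N" for n
      using stable[OF pN that] nth_pos[OF mem[of N]] N[of N] by (simp add: p_def)
    then show "\<forall>\<^sub>\<infinity>n. nth_default 0 (hyps e (x \<restriction> n)) (p N) = c" unfolding MOST_nat_le by blast
    show "Phi c x = Some h" using Phi h by simp
    \<comment> \<open>A tape with content already has its hypothesis, which stays the same. Hence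
      contents are always confirmed and the ban on erasing is harmless.\<close>
    have "nth_default 0 (hyps e (x \<restriction> Suc n)) i = nth_default 0 (hyps e (x \<restriction> n)) i"
      if "content i y n \<noteq> []" for i n
      using stable[OF content[OF that], of "Suc n"] stable[OF content[OF that], of n] by simp
    note confirmed_if_stable(2)[OF this]
    then show False if "\<not> confirmed (nth_default 0 (hyps e (x \<restriction> Suc n)) (p N)) (Suc n) (content (p N) y n)" for n
      using that by blast
  qed
  have "y n \<noteq> Back" for n using y_Back(2)[of n] by blast
  then have basic: "\<not> II_violates_basic y" by (intro content_lim_basic[OF lim]) simp
  have "\<forall>\<^sub>\<infinity>n. tape y n = p N" unfolding MOST_nat using tape by blast
  \<comment> \<open>All other tapes are abandoned eventually, so \<open>p N\<close> is the least
    tape with infinite content.\<close>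
  then have "\<not> content_infinite j y" if "j < p N" for j
    using that content_lim_eventual_tape unfolding content_infinite_def by blast
  then show "wins f x (response (moving_strategy e m) x)"
    using lim basic h unfolding wins_def y_def[symmetric] content_infinite_def by blast
  have "y n \<notin> range Move" if "n > N" for n using Move no_sched[OF that] by auto
  then show "\<not> II_violates_star (response (moving_strategy e m) x)"
    unfolding II_violates_star_def y_def[symmetric] not_INFM MOST_nat by blast
qed

section \<open>The equivalences\<close>

lemma content_lim_tape_bound:
  assumes "strategy X \<psi>" "X \<inter> range Move \<subseteq> M \<alpha>" "0 < \<alpha>" "content_lim i (response \<psi> x) h"
  shows "enat i < \<alpha>"
proof -
  have "enat j < \<alpha>" if "response \<psi> x n = Move j" for n j
    using strategy_response[OF assms(1), of x n] assms(2) that by (auto simp: M_def)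
  then have "enat (tape (response \<psi> x) n) < \<alpha>" for n
    using tape_less[of \<alpha> "response \<psi> x" n] assms(3) by (simp add: zero_enat_def)
  then show ?thesis using content_lim_tape[OF assms(4)] by blast
qed

text \<open>Winnability with the tapewise rule is the weakest of the winning conditions, so this
  covers every passage from strategies to learners except the one under rule \<open>*\<close>. With
  \<open>0 < \<alpha>\<close> the initial tape 0 also has its learner.\<close>

lemma learner_computable_if_strategy:
  assumes str: "computable_strategy X \<psi>" and X: "X \<inter> range Move \<subseteq> M \<alpha>" "0 < \<alpha>"
    and win: "\<And>x. x \<in> dom f \<Longrightarrow> winnable_tapewise f x (response \<psi> x)"
    and backs: "\<And>x i h. x \<in> dom f \<Longrightarrow> content_lim i (response \<psi> x) h \<Longrightarrow>
      enat (card (backs i (response \<psi> x))) < \<beta>"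
  shows "(\<alpha>,\<beta>|\<infinity>)-computable f"
proof (rule learner_computable_if_tapes[OF str])
  fix x assume x: "x \<in> dom f"
  then obtain i h where "content_lim i (response \<psi> x) h" "f x = Some h"
    using win unfolding winnable_tapewise_def I_violates_basic_def by blast
  moreover from this have "enat i < \<alpha>"
    using str X by (intro content_lim_tape_bound) (auto simp: computable_strategy_def)
  ultimately show "\<exists>i h. enat i < \<alpha> \<and> content_lim i (response \<psi> x) h \<and> f x = Some h \<and>
      enat (card (backs i (response \<psi> x))) < \<beta>" using backs[OF x] by blast
qed

lemma winnable_if_content_lim:
  "content_lim i y h \<Longrightarrow> f x = Some h \<Longrightarrow> finite {n. y n = Back} \<Longrightarrow> winnable f x y"
  unfolding winnable_def using content_lim_basic by blast

lemma wins_imp_winnable: "wins f x y \<Longrightarrow> winnable f x y"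
  unfolding wins_def winnable_def by blast

lemma backs_empty:
  assumes "strategy X \<psi>" "Back \<notin> X"
  shows "response \<psi> x n \<noteq> Back" "backs i (response \<psi> x) = {}"
proof -
  show "response \<psi> x n \<noteq> Back" for n using strategy_response[OF assms(1), of x n] assms(2) by auto
  then show "backs i (response \<psi> x) = {}" by (simp add: backs_def)
qed

lemma computable_bounded_mind_changes:
  assumes "0 < m"
  shows "(1,enat m|\<infinity>)-computable f \<longleftrightarrow> has_computable_strategy (wins_rule m f) (P \<union> B)"
proof
  assume "(1,enat m|\<infinity>)-computable f"
  then obtain e where e: "\<And>g. g \<in> dom f \<Longrightarrow> \<exists>c. (\<lambda>n. Psi e (g \<restriction> n)) \<longlonglongrightarrow> c \<and> Phi c g = f g \<and>
      ecard {n. Psi e (g \<restriction> Suc n) \<noteq> Psi e (g \<restriction> n)} < enat m"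
    unfolding learner_computable_def ecard_eq_1 by blast
  have "wins_rule m f x (response (erasing_strategy e (enat m)) x)" for x
    unfolding wins_rule_def
  proof
    show "wins f x (response (erasing_strategy e (enat m)) x)"
      using e[of x] erasing_strategy_wins by (cases "x \<in> dom f") (blast, simp add: wins_def I_violates_basic_def)
    show "\<not> II_violates_rule m (response (erasing_strategy e (enat m)) x)"
      using assms by (rule erasing_strategy_backs)
  qed
  then show "has_computable_strategy (wins_rule m f) (P \<union> B)"
    unfolding has_computable_strategy_def using computable_erasing_strategy by blast
next
  assume "has_computable_strategy (wins_rule m f) (P \<union> B)"
  then obtain \<psi> where \<psi>: "computable_strategy (P \<union> B) \<psi>" "\<And>x. wins_rule m f x (response \<psi> x)"
    unfolding has_computable_strategy_def by blast
  show "(1,enat m|\<infinity>)-computable f"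
  proof (rule learner_computable_if_strategy[OF \<psi>(1)])
    show "winnable_tapewise f x (response \<psi> x)" for x
      using \<psi>(2) unfolding wins_rule_def
      by (blast intro: winnable_imp_winnable_tapewise wins_imp_winnable)
    show "enat (card (backs i (response \<psi> x))) < enat m" for x i
    proof -
      have "ecard {n. response \<psi> x n = Back} < enat m"
        using \<psi>(2)[of x] unfolding wins_rule_def II_violates_rule_def by (simp add: not_le)
      moreover have "ecard (backs i (response \<psi> x)) \<le> ecard {n. response \<psi> x n = Back}"
        by (rule ecard_mono) (auto simp: backs_def)
      ultimately have "ecard (backs i (response \<psi> x)) < enat m" by (rule le_less_trans[rotated])
      then show ?thesis by (simp add: ecard_def split: if_splits)
    qed
  qed (auto simp: P_def B_def)
qed

text \<open>Obeying rule 1 on every input means never playing \<open>Back\<close>, so the game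
  without \<open>Back\<close> is the case \<open>m = 1\<close> of the game with bounded
  erasing.\<close>

lemma has_computable_strategy_P_iff_wins_rule_1:
  "has_computable_strategy (wins f) P \<longleftrightarrow> has_computable_strategy (wins_rule 1 f) (P \<union> B)"
proof
  assume "has_computable_strategy (wins f) P"
  then obtain \<psi> where \<psi>: "computable_strategy P \<psi>" "\<And>x. wins f x (response \<psi> x)"
    unfolding has_computable_strategy_def by blast
  have "response \<psi> x n \<noteq> Back" for x n
    using \<psi>(1) by (intro backs_empty[of P]) (auto simp: computable_strategy_def P_def)
  then have "wins_rule 1 f x (response \<psi> x)" for x
    using \<psi>(2) by (simp add: wins_rule_def II_violates_rule_def ecard_def)
  moreover have "computable_strategy (P \<union> B) \<psi>"
    using \<psi>(1) unfolding computable_strategy_def strategy_def by blast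
  ultimately show "has_computable_strategy (wins_rule 1 f) (P \<union> B)"
    unfolding has_computable_strategy_def by blast
next
  assume "has_computable_strategy (wins_rule 1 f) (P \<union> B)"
  then obtain \<psi> where \<psi>: "computable_strategy (P \<union> B) \<psi>" "\<And>x. wins_rule 1 f x (response \<psi> x)"
    unfolding has_computable_strategy_def by blast
  have str: "strategy (P \<union> B) \<psi>" using \<psi>(1) by (simp add: computable_strategy_def)
  have nb: "response \<psi> x n \<noteq> Back" for x n
  proof -
    have "ecard {n. response \<psi> x n = Back} < enat 1"
      using \<psi>(2)[of x] unfolding wins_rule_def II_violates_rule_def by (simp add: not_le)
    then have "{n. response \<psi> x n = Back} = {}" by (simp add: ecard_def split: if_splits)
    then show ?thesis by blast
  qed
  have "Back \<notin> set (\<psi> \<sigma>)" for \<sigma>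
  proof -
    \<comment> \<open>Every finite input is an initial segment of an infinite one, here padded with
      zeros; so \<open>Back\<close> is absent from all finite outputs, as required of a strategy on
      the smaller set of symbols.\<close>
    have "nth_default 0 \<sigma> \<restriction> length \<sigma> = \<sigma>" by (rule nth_equalityI) (simp_all add: nth_default_def)
    then have "\<psi> \<sigma> = response \<psi> (nth_default 0 \<sigma>) \<restriction> length \<sigma>"
      using strategy_init_seg[OF str, of "nth_default 0 \<sigma>" "length \<sigma>"] by simp
    then show ?thesis using nb by (metis (no_types, lifting) ex_map_conv)
  qed
  then have "computable_strategy P \<psi>"
    using \<psi>(1) unfolding computable_strategy_def strategy_def B_def by blast
  then show "has_computable_strategy (wins f) P"
    using \<psi>(2) unfolding has_computable_strategy_def wins_rule_def by blast
qed

lemma computable_bounded_hypotheses: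
  assumes "1 \<le> m"
  shows "(1,\<infinity>|enat m)-computable f \<longleftrightarrow> has_computable_strategy (wins_star f) (P \<union> M (enat m))"
proof
  assume "(1,\<infinity>|enat m)-computable f"
  then obtain e where e: "\<And>g. g \<in> dom f \<Longrightarrow> \<exists>c. (\<lambda>n. Psi e (g \<restriction> n)) \<longlonglongrightarrow> c \<and> Phi c g = f g \<and>
      ecard (range (\<lambda>n. Psi e (g \<restriction> n))) \<le> enat m"
    unfolding learner_computable_def ecard_eq_1 by blast
  have "wins_star f x (response (moving_strategy e m) x)" for x
    using e[of x] moving_strategy_wins[of e x] unfolding wins_star_def I_violates_basic_def by blast
  then show "has_computable_strategy (wins_star f) (P \<union> M (enat m))"
    unfolding has_computable_strategy_def using computable_moving_strategy by blast
next
  assume "has_computable_strategy (wins_star f) (P \<union> M (enat m))"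
  then show "(1,\<infinity>|enat m)-computable f"
    unfolding has_computable_strategy_def using learner_computable_if_moves assms by blast
qed

lemma computable_finite_mind_changes:
  "(1,\<infinity>|\<infinity>)-computable f \<longleftrightarrow> has_computable_strategy (wins f) (P \<union> B)"
proof
  assume "(1,\<infinity>|\<infinity>)-computable f"
  then obtain e where e: "\<And>g. g \<in> dom f \<Longrightarrow> \<exists>c. (\<lambda>n. Psi e (g \<restriction> n)) \<longlonglongrightarrow> c \<and> Phi c g = f g \<and>
      ecard {n. Psi e (g \<restriction> Suc n) \<noteq> Psi e (g \<restriction> n)} < \<infinity>"
    unfolding learner_computable_def ecard_eq_1 by blast
  have "wins f x (response (erasing_strategy e \<infinity>) x)" for x
    using e[of x] erasing_strategy_wins by (cases "x \<in> dom f") (blast, simp add: wins_def I_violates_basic_def)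
  then show "has_computable_strategy (wins f) (P \<union> B)"
    unfolding has_computable_strategy_def using computable_erasing_strategy by blast
next
  assume "has_computable_strategy (wins f) (P \<union> B)"
  then obtain \<psi> where \<psi>: "computable_strategy (P \<union> B) \<psi>" "\<And>x. wins f x (response \<psi> x)"
    unfolding has_computable_strategy_def by blast
  show "(1,\<infinity>|\<infinity>)-computable f"
  proof (rule learner_computable_if_strategy[OF \<psi>(1)])
    show "winnable_tapewise f x (response \<psi> x)" for x
      using \<psi>(2) by (blast intro: winnable_imp_winnable_tapewise wins_imp_winnable)
  qed (auto simp: P_def B_def)
qed

text \<open>The first component of a decoded pair takes every value infinitely often; values from
  \<open>m\<close> on are sent to tape 0 to keep the moves legal.\<close>

lemma recf_round_robin: "recf D (\<lambda>_ k. if fst (prod_decode k) < m then fst (prod_decode k) else 0)"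
  by (intro recf_intros)

lemma infinitely_often_round_robin: "\<exists>\<^sub>\<infinity>k. fst (prod_decode k) = i"
  unfolding INFM_nat_le
proof
  fix n show "\<exists>k \<ge> n. fst (prod_decode k) = i"
    by (rule exI[of _ "prod_encode (i, n)"]) (simp add: le_prod_encode_2)
qed

lemma infinitely_often_bounded_round_robin:
  "i < m \<Longrightarrow> \<exists>\<^sub>\<infinity>k. (if fst (prod_decode k) < m then fst (prod_decode k) else 0) = i"
  by (rule INFM_mono[OF infinitely_often_round_robin[of i]]) simp

text \<open>A learner without mind changes thus amounts to one index, which depends on the learner
  alone and can be built into a strategy.\<close>

lemma no_changes_constant:
  assumes "(\<lambda>n. Psi e (g \<restriction> n)) \<longlonglongrightarrow> c" "ecard {n. Psi e (g \<restriction> Suc n) \<noteq> Psi e (g \<restriction> n)} < 1"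
  shows "c = Psi e []"
proof -
  have "{n. Psi e (g \<restriction> Suc n) \<noteq> Psi e (g \<restriction> n)} = {}"
    using assms(2) by (simp add: ecard_def one_enat_def split: if_splits)
  then have step: "Psi e (g \<restriction> Suc n) = Psi e (g \<restriction> n)" for n by blast
  have "Psi e (g \<restriction> n) = Psi e []" for n
  proof (induction n)
    case (Suc n)
    then show ?case using step[of n] by argo
  qed simp
  then show ?thesis using assms(1) by (simp add: LIMSEQ_const_iff)
qed

lemma learner_computable_if_no_Back:
  assumes "has_computable_strategy (winnable f) (P \<union> M \<alpha>)" "0 < \<alpha>"
  shows "(\<alpha>,1|\<infinity>)-computable f"
proof -
  obtain \<psi> where \<psi>: "computable_strategy (P \<union> M \<alpha>) \<psi>" "\<And>x. winnable f x (response \<psi> x)"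
    using assms(1) unfolding has_computable_strategy_def by blast
  show ?thesis
  proof (rule learner_computable_if_strategy[OF \<psi>(1)])
    show "winnable_tapewise f x (response \<psi> x)" for x
      using \<psi>(2) by (rule winnable_imp_winnable_tapewise)
    have "backs i (response \<psi> x) = {}" for i x
      using \<psi>(1) by (intro backs_empty(2)[of "P \<union> M \<alpha>"]) (auto simp: computable_strategy_def P_def M_def)
    then show "enat (card (backs i (response \<psi> x))) < 1" for i x
      by (simp add: one_enat_def)
  qed (use assms in \<open>auto simp: P_def\<close>)
qed

text \<open>Tape \<open>i\<close> follows the fixed index \<open>d i\<close>, so nothing written is
  ever revised. Which tape succeeds on \<open>x\<close> need not be computable, since winnability
  only asks that one exists.\<close>

lemma dovetail_strategy_winnable:
  fixes t d :: "nat \<Rightarrow> nat"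
  assumes t: "recf {Map.empty} (\<lambda>_. t)" "\<And>k. enat (t k) < \<alpha>" and d: "recf {Map.empty} (\<lambda>_. d)"
    and f: "\<And>x. x \<in> dom f \<Longrightarrow> \<exists>i. (\<exists>\<^sub>\<infinity>k. t k = i) \<and> Phi (d i) x = f x"
  shows "has_computable_strategy (winnable f) (P \<union> M \<alpha>)"
proof -
  let ?\<psi> = "dovetail_strategy t (\<lambda>i \<sigma>. d i) False"
  have "recf {Map.empty} (\<lambda>_ (z :: nat \<times> nat list). d (fst z))"
    by (intro recf_comp[OF d] recf_intros)
  then have \<psi>: "computable_strategy (P \<union> M \<alpha>) ?\<psi>"
    using t by (intro computable_dovetail_strategy) (auto simp: P_def M_def)
  have "winnable f x (response ?\<psi> x)" for x
  proof (cases "x \<in> dom f")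
    case True
    then obtain i h where i: "\<exists>\<^sub>\<infinity>k. t k = i" "Phi (d i) x = Some h" "f x = Some h" using f by force
    then have "content_lim i (response ?\<psi> x) h"
      by (intro dovetail_strategy_content_lim[OF \<psi>]) simp_all
    moreover have "response ?\<psi> x n \<noteq> Back" for n
      using \<psi> by (intro backs_empty[of "P \<union> M \<alpha>"]) (auto simp: computable_strategy_def P_def M_def)
    ultimately show ?thesis using i(3) by (intro winnable_if_content_lim) simp_all
  qed (simp add: winnable_def I_violates_basic_def)
  with \<psi> show ?thesis unfolding has_computable_strategy_def by blast
qed

lemma ecard_eq_enat:
  assumes "ecard I = enat m"
  obtains es where "set es = I" "length es = m"
  using assms finite_distinct_list[of I] by (force simp: ecard_def distinct_card split: if_splits)

lemma computable_team_no_mind_changes: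
  assumes "1 \<le> m"
  shows "(enat m,1|\<infinity>)-computable f \<longleftrightarrow> has_computable_strategy (winnable f) (P \<union> M (enat m))"
proof
  assume "(enat m,1|\<infinity>)-computable f"
  then obtain I where I: "ecard I = enat m" "\<And>g. g \<in> dom f \<Longrightarrow> \<exists>e\<in>I. \<exists>c.
      (\<lambda>n. Psi e (g \<restriction> n)) \<longlonglongrightarrow> c \<and> Phi c g = f g \<and>
      ecard {n. Psi e (g \<restriction> Suc n) \<noteq> Psi e (g \<restriction> n)} < 1"
    unfolding learner_computable_def by blast
  \<comment> \<open>A finite team can be listed, and the list enters the strategy as a constant,
    whether or not there is an effective way to find it.\<close>
  obtain es where es: "set es = I" "length es = m" using I(1) by (rule ecard_eq_enat)
  show "has_computable_strategy (winnable f) (P \<union> M (enat m))"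
  proof (rule dovetail_strategy_winnable[OF recf_round_robin[of _ m]])
    show "recf {Map.empty} (\<lambda>_ i. Psi (nth_default 0 es i) [])" by (intro recf_intros)
    fix x assume "x \<in> dom f"
    then obtain e c where e: "e \<in> I" "(\<lambda>n. Psi e (x \<restriction> n)) \<longlonglongrightarrow> c" "Phi c x = f x"
      "ecard {n. Psi e (x \<restriction> Suc n) \<noteq> Psi e (x \<restriction> n)} < 1" using I(2) by blast
    obtain i where i: "i < m" "es ! i = e" using es e(1) by (metis in_set_conv_nth)
    have "Phi (Psi (nth_default 0 es i) []) x = f x"
      using i es(2) e(3) no_changes_constant[OF e(2,4)] by (simp add: nth_default_def)
    with infinitely_often_bounded_round_robin[OF i(1)]
    show "\<exists>i. (\<exists>\<^sub>\<infinity>k. (if fst (prod_decode k) < m then fst (prod_decode k) else 0) = i) \<and>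
      Phi (Psi (nth_default 0 es i) []) x = f x" by blast
  qed (use assms in auto)
next
  assume "has_computable_strategy (winnable f) (P \<union> M (enat m))"
  then show "(enat m,1|\<infinity>)-computable f"
    by (rule learner_computable_if_no_Back) (use assms in \<open>simp add: zero_enat_def\<close>)
qed

lemma computable_countable_team_no_mind_changes:
  "(\<infinity>,1|\<infinity>)-computable f \<longleftrightarrow> has_computable_strategy (winnable f) (P \<union> M \<infinity>)"
proof
  assume f: "(\<infinity>,1|\<infinity>)-computable f"
  \<comment> \<open>The given team need not be computable, but tape \<open>i\<close> may simply follow the \<open>i\<close>-th functional.\<close>
  show "has_computable_strategy (winnable f) (P \<union> M \<infinity>)"
  proof (rule dovetail_strategy_winnable)
    show "recf {Map.empty} (\<lambda>_ k. fst (prod_decode k))" by (intro recf_intros)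
    show "recf {Map.empty} (\<lambda>_ i. i)" by (rule recf_id)
    show "\<exists>i. (\<exists>\<^sub>\<infinity>k. fst (prod_decode k) = i) \<and> Phi i x = f x" if "x \<in> dom f" for x
      using f that infinitely_often_round_robin unfolding learner_computable_def by blast
  qed simp
next
  assume "has_computable_strategy (winnable f) (P \<union> M \<infinity>)"
  then show "(\<infinity>,1|\<infinity>)-computable f" by (rule learner_computable_if_no_Back) simp
qed

text \<open>Learners of the team that do not converge may cause infinitely many \<open>Back\<close>s
  on their own tapes; the tapewise rule only restricts the tape of a successful learner.\<close>

lemma computable_team:
  assumes "1 \<le> m"
  shows "(enat m,\<infinity>|\<infinity>)-computable f \<longleftrightarrow>
    has_computable_strategy (winnable_tapewise f) (P \<union> B \<union> M (enat m))"
proof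
  assume "(enat m,\<infinity>|\<infinity>)-computable f"
  then obtain I where I: "ecard I = enat m" "\<And>g. g \<in> dom f \<Longrightarrow> \<exists>e\<in>I. \<exists>c.
      (\<lambda>n. Psi e (g \<restriction> n)) \<longlonglongrightarrow> c \<and> Phi c g = f g"
    unfolding learner_computable_def by blast
  obtain es where es: "set es = I" "length es = m" using I(1) by (rule ecard_eq_enat)
  let ?\<psi> = "dovetail_strategy (\<lambda>k. if fst (prod_decode k) < m then fst (prod_decode k) else 0)
    (\<lambda>i \<sigma>. Psi (nth_default 0 es i) \<sigma>) True"
  have "recf {Map.empty} (\<lambda>_ z. Psi (nth_default 0 es (fst z)) (snd z))" by (intro recf_intros)
  then have \<psi>: "computable_strategy (P \<union> B \<union> M (enat m)) ?\<psi>"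
    using assms by (intro computable_dovetail_strategy recf_round_robin) (auto simp: P_def B_def M_def)
  have "winnable_tapewise f x (response ?\<psi> x)" for x
  proof (cases "x \<in> dom f")
    case True
    then obtain e c h where e: "e \<in> I" "(\<lambda>n. Psi e (x \<restriction> n)) \<longlonglongrightarrow> c" "Phi c x = Some h" "f x = Some h"
      using I(2) by force
    obtain i where i: "i < m" "es ! i = e" using es e(1) by (metis in_set_conv_nth)
    have "content_lim i (response ?\<psi> x) h"
    proof (rule dovetail_strategy_content_lim[OF \<psi> infinitely_often_bounded_round_robin[OF i(1)] _ e(3)])
      show "\<forall>\<^sub>\<infinity>n. Psi (nth_default 0 es i) (x \<restriction> n) = c"
        using e(2) i es(2) by (simp add: nth_default_def LIMSEQ_nat_MOST)
    qed simp
    then show ?thesis using e(4) content_lim_basic_on unfolding winnable_tapewise_def by blast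
  qed (simp add: winnable_tapewise_def I_violates_basic_def)
  with \<psi> show "has_computable_strategy (winnable_tapewise f) (P \<union> B \<union> M (enat m))"
    unfolding has_computable_strategy_def by blast
next
  assume "has_computable_strategy (winnable_tapewise f) (P \<union> B \<union> M (enat m))"
  then obtain \<psi> where \<psi>: "computable_strategy (P \<union> B \<union> M (enat m)) \<psi>"
    "\<And>x. winnable_tapewise f x (response \<psi> x)"
    unfolding has_computable_strategy_def by blast
  show "(enat m,\<infinity>|\<infinity>)-computable f"
    by (rule learner_computable_if_strategy[OF \<psi>(1) _ _ \<psi>(2)])
      (use assms in \<open>auto simp: P_def B_def zero_enat_def\<close>)
qed

text \<open>For \<open>m = 0\<close> the learner sides that involve \<open>m\<close> hold only for
  the nowhere defined function, whereas every play violates rule 0, and a strategy without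
  \<open>Move\<close> symbols still has tape 0 at its disposal. Hence the assumption
  \<open>m \<ge> 1\<close>.\<close>

theorem theorem6p13:
  fixes f :: "baire \<rightharpoonup> baire" and m :: nat
  assumes "m \<ge> 1"
  shows
    "((1,1|\<infinity>)-computable f \<longleftrightarrow> has_computable_strategy (wins f) P) \<and>
     ((1,enat m|\<infinity>)-computable f \<longleftrightarrow> has_computable_strategy (wins_rule m f) (P \<union> B)) \<and>
     ((1,\<infinity>|enat m)-computable f \<longleftrightarrow> has_computable_strategy (wins_star f) (P \<union> M (enat m))) \<and>
     ((1,\<infinity>|\<infinity>)-computable f \<longleftrightarrow> has_computable_strategy (wins f) (P \<union> B)) \<and>
     ((enat m,1|\<infinity>)-computable f \<longleftrightarrow> has_computable_strategy (winnable f) (P \<union> M (enat m))) \<and>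
     ((enat m,\<infinity>|\<infinity>)-computable f \<longleftrightarrow>
        has_computable_strategy (winnable_tapewise f) (P \<union> B \<union> M (enat m))) \<and>
     ((\<infinity>,1|\<infinity>)-computable f \<longleftrightarrow> has_computable_strategy (winnable f) (P \<union> M \<infinity>))"
proof (intro conjI)
  show "(1,1|\<infinity>)-computable f \<longleftrightarrow> has_computable_strategy (wins f) P"
    using computable_bounded_mind_changes[of 1 f] has_computable_strategy_P_iff_wins_rule_1[of f]
    by (simp add: one_enat_def)
qed (use assms in \<open>simp_all add: computable_bounded_mind_changes computable_bounded_hypotheses
    computable_finite_mind_changes computable_team_no_mind_changes computable_team
    computable_countable_team_no_mind_changes\<close>)

end
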